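(* Let $(W,H,\mu)$ be an abstract Wiener space, let $a,b,c$ be measurable, positive functions on $W$, and let $s,t\in[0,1]$ with $s+t=1$ be given. Consider the condition (P) for any $h,k\in H$, for $\mu$-almost every $w$, $$a(w+sh+tk)\exp\left(-\tfrac12|sh+tk|_H^2\right)\ge\left(b(w+h)e^{-\frac12|h|_H^2}\right)^s\left(c(w+k)e^{-\frac12|k|_H^2}\right)^t .$$ 1. Condition (P) holds if and only if, for every $n\ge1$ and any $h,k\in H$, for $\mu$-almost every $w$, $$E[a|V_n](w+s\pi_nh+t\pi_nk)\,e^{-\frac12|s\pi_nh+t\pi_nk|_H^2}\ge\left(E[b|V_n](w+\pi_nh)\,e^{-\frac12|\pi_nh|_H^2}\right)^s\left(E[c|V_n](w+\pi_nk)\,e^{-\frac12|\pi_nk|_H^2}\right)^t .$$ 2. Condition (P) holds if and only if, for any $\tau\ge0$ and any $h,k\in H$, for $\mu$-almost every $w$, $$P_\tau a(w+sh+tk)\,e^{-\frac12|sh+tk|_H^2}\ge\left(P_\tau b(w+h)\,e^{-\frac12|h|_H^2}\right)^s\left(P_\tau c(w+k)\,e^{-\frac12|k|_H^2}\right)^t .$$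
   Context: An abstract Wiener space $(W,H,\mu)$: $W$ is a separable Fréchet space, $H\subset W$ a separable Hilbert space densely and continuously injected (the Cameron-Martin space), $\mu$ the standard Gaussian measure on $W$, i.e. $\int e^{i\langle l,w\rangle}d\mu(w)=e^{-\frac12|l|_H^2}$ for $l\in W^\star\subset H^\star= H$; it is quasi-invariant under translations by elements of $H$. "Positive" means nonnegative. $(e_n)_{n\ge1}\subset W^\star$ is a complete orthonormal basis of $H$; $V_n$ is the sigma-algebra generated by $\{\delta e_1,\dots,\delta e_n\}$, where $\delta e_i(w)=\langle e_i,w\rangle$, completed with the $\mu$-negligible sets; $\pi_n$ is the orthogonal projection of $H$ onto the span of $\{e_1,\dots,e_n\}$; $E[\cdot|V_n]$ is conditional expectation under $\mu$. $(P_\tau)_{\tau\ge0}$ is the Ornstein-Uhlenbeck semigroup, $P_\tau f(w)=\int_W f(e^{-\tau}w+\sqrt{1-e^{-2\tau}}\,y)\,\mu(dy)$. Conditional expectations and $P_\tau$ of positive functions may take the value $+\infty$; conventions: $0^0=\infty^0=1$, $0\cdot\infty=0$.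
   Formalization: In item 1, the implication from the V_n-inequalities back to (P) is proved only assuming that for almost every w some E[a|V_n](w), n≥1, is finite; without this it is false (E[a|V_n] can be identically +∞). The other implications are as stated. *)

theory Defs
  imports "HOL-Probability.Probability"
begin

text \<open>Separable Frechet spaces: locally convex spaces that are completely metrizable by a
  translation-invariant metric. Joint continuity of addition follows from the invariance of
  the metric.\<close>

class separable_frechet_space = real_vector + polish_space +
  assumes dist_translation: "dist (x + z) (y + z) = dist x y"
    and tendsto_scaleR_Pair:
      "LIM p (nhds r \<times>\<^sub>F nhds x). fst p *\<^sub>R snd p :> nhds (r *\<^sub>R x)"
    and locally_convex:
      "open U \<Longrightarrow> 0 \<in> U \<Longrightarrow> \<exists>C. open C \<and> 0 \<in> C \<and> C \<subseteq> U \<and>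
        (\<forall>x\<in>C. \<forall>y\<in>C. \<forall>u\<ge>0. \<forall>v\<ge>0. u + v = 1 \<longrightarrow> u *\<^sub>R x + v *\<^sub>R y \<in> C)"

definition dual :: "('w::separable_frechet_space \<Rightarrow> real) set" where
  "dual = {l. linear l \<and> continuous_on UNIV l}"

text \<open>The injection of the Cameron-Martin space \<open>H\<close> into \<open>W\<close> is an explicit map \<open>\<iota>\<close>.
  The inclusion of the dual of \<open>W\<close> into \<open>H\<close> sends \<open>l\<close> to the Riesz representative
  of the restriction of \<open>l\<close> to \<open>H\<close>.\<close>

definition riesz_rep :: "('h::{real_inner,polish_space} \<Rightarrow> 'w::separable_frechet_space) \<Rightarrow>
    ('w \<Rightarrow> real) \<Rightarrow> 'h" where
  "riesz_rep \<iota> l = (THE r. \<forall>h. l (\<iota> h) = r \<bullet> h)"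

locale abstract_wiener_space = prob_space \<mu>
  for \<mu> :: "'w::separable_frechet_space measure" +
  fixes \<iota> :: "'h::{real_inner,polish_space} \<Rightarrow> 'w"
  assumes sets_mu: "sets \<mu> = sets borel"
    and linear_inj: "linear \<iota>"
    and inj_inj: "inj \<iota>"
    and continuous_inj: "continuous_on UNIV \<iota>"
    and dense_inj: "closure (range \<iota>) = UNIV"
    and char_mu: "l \<in> dual \<Longrightarrow>
      (CLINT w|\<mu>. iexp (l w)) = complex_of_real (exp (- (1/2) * (norm (riesz_rep \<iota> l))\<^sup>2))"

text \<open>A complete orthonormal basis of \<open>H\<close> made of elements of the dual of \<open>W\<close>. The index
  set is \<open>{1..}\<close>, or \<open>{1..d}\<close> when \<open>H\<close> has finite dimension \<open>d\<close>.\<close>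

definition dual_basis :: "('h::{real_inner,polish_space} \<Rightarrow> 'w::separable_frechet_space) \<Rightarrow>
    nat set \<Rightarrow> (nat \<Rightarrow> 'w \<Rightarrow> real) \<Rightarrow> bool" where
  "dual_basis \<iota> I e \<longleftrightarrow>
     (I = {1..} \<or> (\<exists>d. I = {1..d})) \<and>
     (\<forall>i\<in>I. e i \<in> dual) \<and>
     (\<forall>i\<in>I. \<forall>j\<in>I. riesz_rep \<iota> (e i) \<bullet> riesz_rep \<iota> (e j) = (if i = j then 1 else 0)) \<and>
     closure (span ((\<lambda>i. riesz_rep \<iota> (e i)) ` I)) = UNIV"

text \<open>The completed sigma-algebra \<open>V\<^sub>n\<close>, as a measure space of which only the measurable sets
  matter; it is a subalgebra of \<open>completion \<mu>\<close>, not of \<open>\<mu>\<close>.\<close>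

definition V_alg :: "'w measure \<Rightarrow> nat set \<Rightarrow> (nat \<Rightarrow> 'w \<Rightarrow> real) \<Rightarrow> nat \<Rightarrow> 'w measure" where
  "V_alg \<mu> I e n = sigma (space \<mu>)
     ({e i -` B \<inter> space \<mu> | i B. i \<in> I \<inter> {1..n} \<and> B \<in> sets borel} \<union> null_sets (completion \<mu>))"

definition cond_V :: "'w measure \<Rightarrow> nat set \<Rightarrow> (nat \<Rightarrow> 'w \<Rightarrow> real) \<Rightarrow> nat \<Rightarrow>
    ('w \<Rightarrow> ennreal) \<Rightarrow> 'w \<Rightarrow> ennreal" where
  "cond_V \<mu> I e n f = nn_cond_exp (completion \<mu>) (V_alg \<mu> I e n) f"

definition orthogonal_projection :: "'h::real_inner set \<Rightarrow> 'h \<Rightarrow> 'h" where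
  "orthogonal_projection S h = (THE p. p \<in> S \<and> (\<forall>v\<in>S. (h - p) \<bullet> v = 0))"

definition proj_n :: "('h::{real_inner,polish_space} \<Rightarrow> 'w::separable_frechet_space) \<Rightarrow>
    nat set \<Rightarrow> (nat \<Rightarrow> 'w \<Rightarrow> real) \<Rightarrow> nat \<Rightarrow> 'h \<Rightarrow> 'h" where
  "proj_n \<iota> I e n = orthogonal_projection (span ((\<lambda>i. riesz_rep \<iota> (e i)) ` (I \<inter> {1..n})))"

definition OU_semigroup :: "'w::separable_frechet_space measure \<Rightarrow> real \<Rightarrow>
    ('w \<Rightarrow> ennreal) \<Rightarrow> 'w \<Rightarrow> ennreal" where
  "OU_semigroup \<mu> \<tau> f w =
     (\<integral>\<^sup>+ y. f (exp (- \<tau>) *\<^sub>R w + sqrt (1 - exp (- 2 * \<tau>)) *\<^sub>R y) \<partial>\<mu>)"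

text \<open>Powers with exponent \<open>p \<ge> 0\<close>, where \<open>0\<^sup>0 = \<infinity>\<^sup>0 = 1\<close>. (The real function \<open>powr\<close> has
  \<open>0 powr 0 = 0\<close>.)\<close>

definition ennreal_powr :: "ennreal \<Rightarrow> real \<Rightarrow> ennreal" where
  "ennreal_powr x p =
     (if p = 0 then 1 else if x = \<infinity> then \<infinity> else ennreal (enn2real x powr p))"

text \<open>The inequality of condition (P), for given \<open>h\<close> and \<open>k\<close>.\<close>

definition gauss_ineq :: "'w::separable_frechet_space measure \<Rightarrow>
    ('h::{real_inner,polish_space} \<Rightarrow> 'w) \<Rightarrow> real \<Rightarrow> real \<Rightarrow>
    ('w \<Rightarrow> ennreal) \<Rightarrow> ('w \<Rightarrow> ennreal) \<Rightarrow> ('w \<Rightarrow> ennreal) \<Rightarrow> 'h \<Rightarrow> 'h \<Rightarrow> bool" where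
  "gauss_ineq \<mu> \<iota> s t a b c h k \<longleftrightarrow>
     (AE w in \<mu>.
        a (w + \<iota> (s *\<^sub>R h + t *\<^sub>R k)) * ennreal (exp (- (1/2) * (norm (s *\<^sub>R h + t *\<^sub>R k))\<^sup>2))
        \<ge> ennreal_powr (b (w + \<iota> h) * ennreal (exp (- (1/2) * (norm h)\<^sup>2))) s
          * ennreal_powr (c (w + \<iota> k) * ennreal (exp (- (1/2) * (norm k)\<^sup>2))) t)"

end

theory Submission
  imports Defs
begin

text \<open>
Write \<open>a\<close>, \<open>b\<close>, \<open>c\<close> for Borel versions of the three functions and \<open>P\<^sub>J w = (\<Sum>i\<in>J. e\<^sub>i(w) e\<^sub>i)\<close>.
Because \<open>|sh + tk|\<^sup>2 = s|h|\<^sup>2 + t|k|\<^sup>2 - st|h - k|\<^sup>2\<close>, condition (P) says that for all \<open>h\<close>, \<open>k\<close>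
in \<open>H\<close>, almost surely in \<open>w\<close>, \<open>b(w+h)\<^sup>s c(w+k)\<^sup>t \<le> a(w+sh+tk) exp(st|h-k|\<^sup>2/2)\<close> (\<open>cond_P\<close>,
\<open>gauss_ineq_iff\<close>). Along a single coordinate direction this is exactly the hypothesis of the
Prekopa--Leindler inequality for the standard Gaussian law of the line, in a version that
only asks the hypothesis for almost every pair of points. That version
(\<open>prekopa_leindler_gauss\<close>) is as elementary as the usual one: a set \<open>C\<close> that contains
\<open>sx + ty\<close> for almost all \<open>x \<in> A\<close>, \<open>y \<in> B\<close> contains, up to null sets, a copy of \<open>sA\<close> to the
left and a copy of \<open>tB\<close> to the right of almost the same point.

Both operations of the theorem are averages \<open>G \<mapsto> \<integral>G(Aw + By) d\<mu>(y)\<close> in which \<open>Aw + By\<close> has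
law \<open>\<mu>\<close> when \<open>w\<close>, \<open>y\<close> are independent with law \<open>\<mu>\<close>: conditioning on \<open>V\<^sub>n\<close> has \<open>A = P\<^sub>J\<close>,
\<open>B = 1 - P\<^sub>J\<close> with \<open>J = {1..n}\<close> (\<open>cond_V_eq_cexp\<close>), and the Ornstein--Uhlenbeck operator \<open>P\<^sub>\<tau>\<close>
has \<open>A = e\<^sup>-\<^sup>\<tau>\<close>, \<open>B = \<surd>(1 - e\<^sup>-\<^sup>2\<^sup>\<tau>)\<close>. On each coordinate they act as \<open>x \<mapsto> \<alpha>x + \<beta>y\<close> with
\<open>\<alpha>\<^sup>2 + \<beta>\<^sup>2 = 1\<close> or not at all. Acting on one coordinate preserves (P): Prekopa--Leindler is
applied on that line, and the Gaussian weights fit together because \<open>(\<alpha>u + \<beta>v)\<^sup>2 \<le> u\<^sup>2 + v\<^sup>2\<close>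
(\<open>cond_P_line_avg\<close>). Hence acting on finitely many coordinates preserves (P), and the
operation itself is an \<open>L\<^sup>1\<close> limit of those: every integrable function is close in \<open>L\<^sup>1\<close> to a
function of finitely many coordinates, on which operation and approximation agree, and all
the averages are \<open>L\<^sup>1\<close> contractions (\<open>avg_tendsto\<close>). For bounded functions the inequality
survives the limit along a subsequence; unbounded ones are truncated, which (P) tolerates
(\<open>ineq_P_min\<close>).

Conversely \<open>P\<^sub>0\<close> is the identity, and \<open>E[a|V\<^sub>n]\<close> converges to \<open>a\<close> where the conditional
expectations are finite (\<open>cond_P_of_cexp\<close>).

Three facts about the Wiener space are needed on the way. The dual of \<open>W\<close> generates the
Borel sets (Hahn--Banach and separability), so a finite Borel measure is determined by its
characteristic functional (\<open>same_char_imp_eq\<close>); this gives all the equalities of laws.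
Translations by \<open>H\<close> preserve null sets (\<open>quasi_invariant\<close>), so that versions and almost sure
limits may be evaluated at shifted points. And the coordinates \<open>e\<^sub>i\<close> generate the Borel sets
up to null sets (\<open>borel_subset_approx\<close>).
\<close>

section \<open>Frechet spaces: continuity, Hahn--Banach, Borel sets\<close>

text \<open>
Translation invariance of the metric turns the triangle inequality into
\<open>d(x+y, a+b) \<le> d(x,a) + d(y,b)\<close>, so addition is continuous and the general theory of
continuous and of measurable sums applies.
\<close>
instance separable_frechet_space \<subseteq> topological_ab_group_add
proof
  fix a b :: "'a::separable_frechet_space"
  show "LIM x (nhds a \<times>\<^sub>F nhds b). fst x + snd x :> nhds (a + b)"
  proof (rule tendstoI)
    fix \<epsilon> :: real assume e: "0 < \<epsilon>"
    have "\<forall>\<^sub>F x in nhds a. dist x a < \<epsilon>/2" "\<forall>\<^sub>F y in nhds b. dist y b < \<epsilon>/2"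
      using e by (auto simp: eventually_nhds_metric intro!: exI[of _ "\<epsilon>/2"])
    then have "\<forall>\<^sub>F x in nhds a \<times>\<^sub>F nhds b. dist (fst x) a < \<epsilon>/2 \<and> dist (snd x) b < \<epsilon>/2"
      by (auto simp: eventually_prod_filter)
    then show "\<forall>\<^sub>F x in nhds a \<times>\<^sub>F nhds b. dist (fst x + snd x) (a + b) < \<epsilon>"
    proof eventually_elim
      case (elim x)
      have "dist (fst x + snd x) (a + b)
          \<le> dist (fst x + snd x) (a + snd x) + dist (snd x + a) (b + a)"
        by (metis add.commute dist_triangle)
      then show ?case using elim by (simp add: dist_translation)
    qed
  qed
  show "(uminus \<longlongrightarrow> - a) (nhds a)"
  proof (rule tendstoI)
    fix \<epsilon> :: real assume e: "0 < \<epsilon>"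
    have "dist (- x) (- a) = dist x a" for x
      using dist_translation[of "- x" "x + a" "- a"] by (simp add: dist_commute)
    then show "\<forall>\<^sub>F x in nhds a. dist (- x) (- a) < \<epsilon>"
      using e by (auto simp: eventually_nhds_metric)
  qed
qed

lemma tendsto_scaleR_frechet [tendsto_intros]:
  fixes x :: "'w::separable_frechet_space"
  assumes "(f \<longlongrightarrow> r) F" "(g \<longlongrightarrow> x) F"
  shows "((\<lambda>z. f z *\<^sub>R g z) \<longlongrightarrow> r *\<^sub>R x) F"
  using filterlim_compose[OF tendsto_scaleR_Pair, of "\<lambda>z. (f z, g z)" r x F] assms
  by (simp add: nhds_prod[symmetric] tendsto_Pair)

lemma continuous_on_scaleR_frechet [continuous_intros]:
  fixes g :: "'x::topological_space \<Rightarrow> 'w::separable_frechet_space"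
  shows "continuous_on S f \<Longrightarrow> continuous_on S g \<Longrightarrow> continuous_on S (\<lambda>z. f z *\<^sub>R g z)"
  unfolding continuous_on_def by (auto intro: tendsto_scaleR_frechet)

lemma borel_measurable_scaleR_frechet [measurable (raw)]:
  fixes g :: "'x \<Rightarrow> 'w::separable_frechet_space"
  assumes "f \<in> borel_measurable M" "g \<in> borel_measurable M"
  shows "(\<lambda>z. f z *\<^sub>R g z) \<in> borel_measurable M"
  by (rule borel_measurable_continuous_Pair[OF assms, where H="(*\<^sub>R)"])
     (intro continuous_intros)

definition sublinear :: "('w::real_vector \<Rightarrow> real) \<Rightarrow> bool" where
  "sublinear p \<longleftrightarrow> (\<forall>x y. p (x + y) \<le> p x + p y) \<and> (\<forall>r\<ge>0. \<forall>x. p (r *\<^sub>R x) = r * p x)"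

lemma sublinear_add: "sublinear p \<Longrightarrow> p (x + y) \<le> p x + p y"
  by (simp add: sublinear_def)

lemma sublinear_scale: "sublinear p \<Longrightarrow> 0 \<le> r \<Longrightarrow> p (r *\<^sub>R x) = r * p x"
  by (simp add: sublinear_def)

lemma sublinear_0: "sublinear p \<Longrightarrow> p 0 = 0"
  using sublinear_scale[of p 0 0] by simp

lemma sublinear_neg: "sublinear p \<Longrightarrow> - p (- x) \<le> p x"
  using sublinear_add[of p x "- x"] by (simp add: sublinear_0)

lemma sublinearI:
  assumes add: "\<And>x y. p (x + y) \<le> p x + p y" and zero: "p 0 = 0"
    and half: "\<And>r x. 0 < r \<Longrightarrow> p (r *\<^sub>R x) \<le> r * p x"
  shows "sublinear p"
  unfolding sublinear_def
proof (intro conjI allI impI add)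
  fix r :: real and x assume r: "0 \<le> r"
  show "p (r *\<^sub>R x) = r * p x"
  proof (cases "r = 0")
    case False
    with r have r: "0 < r" by simp
    have "p x \<le> (1/r) * p (r *\<^sub>R x)" using half[of "1/r" "r *\<^sub>R x"] r by simp
    then have "r * p x \<le> p (r *\<^sub>R x)" using r by (simp add: field_simps)
    with half[OF r, of x] show ?thesis by simp
  qed (simp add: zero)
qed

text \<open>
By Zorn's lemma: the pointwise infimum of a chain of sublinear functionals below \<open>p\<close> is again
sublinear, and it is finite because \<open>- p (- x)\<close> is a lower bound for each of them.
\<close>
lemma sublinear_minimal:
  assumes p: "sublinear p"
  obtains q where "sublinear q" "\<And>x. q x \<le> p x"
    "\<And>q'. sublinear q' \<Longrightarrow> (\<And>x. q' x \<le> q x) \<Longrightarrow> q' = q"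
proof -
  define A where "A = {q. sublinear q \<and> q \<le> p}"
  have "\<exists>m\<in>A. \<forall>a\<in>A. a \<le> m \<longrightarrow> a = m"
  proof (rule predicate_Zorn)
    show "partial_order_on A (relation_of (\<lambda>x y. y \<le> x) A)"
      by (rule partial_order_on_relation_ofI) auto
    fix C assume C: "C \<in> Chains (relation_of (\<lambda>x y. y \<le> x) A)"
    then have CA: "C \<subseteq> A" by (rule Chains_relation_of)
    have total: "q \<le> q' \<or> q' \<le> q" if "q \<in> C" "q' \<in> C" for q q'
      using C that unfolding Chains_def relation_of_def by auto
    show "\<exists>u\<in>A. \<forall>a\<in>C. u \<le> a"
    proof (cases "C = {}")
      case True
      then show ?thesis using p by (auto simp: A_def)
    next
      case False
      define u where "u x = (INF q\<in>C. q x)" for x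
      have lower: "- p (- x) \<le> q x" if "q \<in> C" for q x
      proof -
        from that CA have "sublinear q" "q \<le> p" by (auto simp: A_def)
        then show ?thesis using sublinear_neg[of q x] by (metis le_funD le_imp_neg_le order_trans)
      qed
      have bdd: "bdd_below ((\<lambda>q. q x) ` C)" for x
        using lower by (auto intro!: bdd_belowI2)
      have le: "u x \<le> q x" if "q \<in> C" for q x
        unfolding u_def using bdd that by (rule cINF_lower)
      have approx: "\<exists>q\<in>C. q x < r" if "u x < r" for x r
        using that cINF_less_iff[OF False bdd] unfolding u_def by blast
      have "u (x + y) \<le> u x + u y" for x y
      proof (rule field_le_epsilon)
        fix \<epsilon> :: real assume e: "0 < \<epsilon>"
        obtain q1 where q1: "q1 \<in> C" "q1 x < u x + \<epsilon>/2" using approx[of x "u x + \<epsilon>/2"] e by auto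
        obtain q2 where q2: "q2 \<in> C" "q2 y < u y + \<epsilon>/2" using approx[of y "u y + \<epsilon>/2"] e by auto
        obtain q where q: "q \<in> C" "q \<le> q1" "q \<le> q2"
          using total[OF q1(1) q2(1)] q1 q2 by auto
        have "u (x + y) \<le> q (x + y)" using le q by auto
        also have "\<dots> \<le> q x + q y" using q CA by (auto simp: A_def sublinear_def)
        also have "\<dots> \<le> q1 x + q2 y" using q by (auto simp: le_fun_def intro: add_mono)
        finally show "u (x + y) \<le> u x + u y + \<epsilon>" using q1 q2 by simp
      qed
      moreover have "u (r *\<^sub>R x) \<le> r * u x" if r: "0 < r" for r x
      proof -
        have "u (r *\<^sub>R x) / r \<le> u x"
          unfolding u_def[of x]
        proof (rule cINF_greatest[OF False])
          fix q assume q: "q \<in> C"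
          then have "u (r *\<^sub>R x) \<le> r * q x" using le[OF q, of "r *\<^sub>R x"] CA r
              by (auto simp: A_def sublinear_scale)
          then show "u (r *\<^sub>R x) / r \<le> q x" using r by (simp add: divide_le_eq mult.commute)
        qed
        then show ?thesis using r by (simp add: divide_le_eq mult.commute)
      qed
      moreover have "u 0 = 0"
      proof -
        have "u 0 = (INF q\<in>C. 0)" unfolding u_def using CA
            by (intro INF_cong) (auto simp: A_def sublinear_0)
        then show ?thesis using False by simp
      qed
      ultimately have "sublinear u" by (intro sublinearI)
      moreover obtain q0 where "q0 \<in> C" using False by auto
      then have "u \<le> p" using le[OF \<open>q0 \<in> C\<close>] CA unfolding A_def le_fun_def
          by (blast intro: order_trans)
      ultimately show ?thesis
        using le by (intro bexI[of _ u]) (auto simp: A_def le_fun_def)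
    qed
  qed
  then obtain q where q: "sublinear q" "q \<le> p" "\<And>q'. sublinear q' \<Longrightarrow> q' \<le> p \<Longrightarrow> q' \<le> q \<Longrightarrow> q' = q"
    by (auto simp: A_def)
  show thesis
  proof (rule that[of q])
    show "q' = q" if "sublinear q'" "\<And>x. q' x \<le> q x" for q'
      using that q by (meson le_funI order_trans)
  qed (use q in \<open>auto simp: le_fun_def\<close>)
qed

text \<open>
A sublinear functional that is not odd at \<open>y\<close> can be lowered, by the infimum of
\<open>q (x + c y) - c q y\<close> over \<open>c \<ge> 0\<close>. Hence minimal ones are linear.
\<close>
lemma sublinear_reduce:
  assumes q: "sublinear q"
  obtains q' where "sublinear q'" "\<And>x. q' x \<le> q x" "q' (- y) \<le> - q y"
proof -
  define g where "g x c = q (x + c *\<^sub>R y) - c * q y" for x and c :: real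
  define q' where "q' x = (INF c\<in>{0..}. g x c)" for x
  have lower: "- q (- x) \<le> g x c" if "0 \<le> c" for x c
    using sublinear_add[OF q, of "x + c *\<^sub>R y" "- x"] sublinear_scale[OF q that, of y]
    by (simp add: g_def)
  have bdd: "bdd_below (g x ` {0..})" for x
    using lower by (auto intro!: bdd_belowI2)
  have le: "q' x \<le> g x c" if "0 \<le> c" for x c
    unfolding q'_def using bdd that by (intro cINF_lower) auto
  have approx: "\<exists>c\<ge>0. g x c < r" if "q' x < r" for x r
    using that cINF_less_iff[OF _ bdd, of x r] unfolding q'_def by auto
  have add: "q' (x1 + x2) \<le> q' x1 + q' x2" for x1 x2
  proof (rule field_le_epsilon)
    fix \<epsilon> :: real assume e: "0 < \<epsilon>"
    obtain a where a: "0 \<le> a" "g x1 a < q' x1 + \<epsilon>/2" using approx[of x1 "q' x1 + \<epsilon>/2"] e by auto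
    obtain b where b: "0 \<le> b" "g x2 b < q' x2 + \<epsilon>/2" using approx[of x2 "q' x2 + \<epsilon>/2"] e by auto
    have "q' (x1 + x2) \<le> g (x1 + x2) (a + b)" using a b le by auto
    also have "\<dots> \<le> g x1 a + g x2 b"
      using sublinear_add[OF q, of "x1 + a *\<^sub>R y" "x2 + b *\<^sub>R y"]
      by (simp add: g_def algebra_simps)
    finally show "q' (x1 + x2) \<le> q' x1 + q' x2 + \<epsilon>" using a b by simp
  qed
  have half: "q' (r *\<^sub>R x) \<le> r * q' x" if r: "0 < r" for r x
  proof -
    have "q' (r *\<^sub>R x) / r \<le> q' x"
      unfolding q'_def[of x]
    proof (rule cINF_greatest)
      fix c :: real assume "c \<in> {0..}"
      then have "q' (r *\<^sub>R x) \<le> g (r *\<^sub>R x) (r * c)" using r le by auto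
      also have "\<dots> = r * g x c"
        using sublinear_scale[OF q, of r "x + c *\<^sub>R y"] r by (simp add: g_def algebra_simps)
      finally show "q' (r *\<^sub>R x) / r \<le> g x c" using r by (simp add: divide_le_eq mult.commute)
    qed auto
    then show ?thesis using r by (simp add: divide_le_eq mult.commute)
  qed
  have zero: "q' 0 = 0"
  proof -
    have "g 0 c = 0" if "0 \<le> c" for c
      using sublinear_scale[OF q that, of y] by (simp add: g_def)
    then have "q' 0 = (INF c\<in>{0::real..}. 0)" unfolding q'_def by (intro INF_cong) auto
    then show ?thesis by simp
  qed
  show thesis
  proof (rule that[of q'])
    show "sublinear q'" using add zero half by (rule sublinearI)
    show "q' x \<le> q x" for x using le[of 0 x] by (simp add: g_def)
    show "q' (- y) \<le> - q y" using le[of 1 "- y"] by (simp add: g_def sublinear_0[OF q])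
  qed
qed

text \<open>
The Hahn--Banach theorem: a minimal sublinear functional is linear. Lowering \<open>p\<close> at \<open>y\<close> first
forces the value \<open>p y\<close> there.
\<close>
lemma hahn_banach_sublinear:
  fixes p :: "'w::real_vector \<Rightarrow> real"
  assumes p: "sublinear p"
  obtains l where "linear l" "\<And>x. l x \<le> p x" "l y = p y"
proof -
  obtain p' where p': "sublinear p'" "\<And>x. p' x \<le> p x" "p' (- y) \<le> - p y"
    using sublinear_reduce[OF p, of y] by blast
  obtain q where q: "sublinear q" "\<And>x. q x \<le> p' x"
    and min: "\<And>q'. sublinear q' \<Longrightarrow> (\<And>x. q' x \<le> q x) \<Longrightarrow> q' = q"
    using sublinear_minimal[OF p'(1)] by metis
  have neg: "q (- z) = - q z" for z
  proof -
    obtain q' where "sublinear q'" "\<And>x. q' x \<le> q x" "q' (- z) \<le> - q z"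
      using sublinear_reduce[OF q(1), of z] by blast
    with min[of q'] have "q (- z) \<le> - q z" by auto
    with sublinear_neg[OF q(1), of z] show ?thesis by simp
  qed
  have "linear q"
  proof (rule linearI)
    show "q (a + b) = q a + q b" for a b
      using sublinear_add[OF q(1), of a b] sublinear_add[OF q(1), of "- a" "- b"]
        neg[of "a + b"] neg[of a] neg[of b] by simp
    show "q (r *\<^sub>R a) = r *\<^sub>R q a" for r a
      using sublinear_scale[OF q(1), of r a] sublinear_scale[OF q(1), of "- r" a] neg[of "r *\<^sub>R a"]
      by (cases "0 \<le> r") auto
  qed
  moreover have "q x \<le> p x" for x using q p' order_trans by blast
  moreover have "q y = p y"
    using q(2)[of "- y"] p'(3) neg[of y] \<open>q y \<le> p y\<close> by simp
  ultimately show thesis using that by blast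
qed

text \<open>
Hahn--Banach for the Minkowski functional of \<open>C\<close>, which is at most 1 on \<open>C\<close> and at least 1 at \<open>y\<close>.
\<close>
lemma convex_absorbing_functional:
  fixes C :: "'w::real_vector set"
  assumes C: "convex C" "0 \<in> C" and absorb: "\<And>x. \<exists>r>0. (1/r) *\<^sub>R x \<in> C" and y: "y \<notin> C"
  obtains l where "linear l" "\<And>x. x \<in> C \<Longrightarrow> l x \<le> (1::real)" "1 \<le> l y"
proof -
  define S where "S x = {r. 0 < r \<and> (1/r) *\<^sub>R x \<in> C}" for x
  define p where "p x = Inf (S x)" for x
  have ne: "S x \<noteq> {}" for x using absorb by (auto simp: S_def)
  have bdd: "bdd_below (S x)" for x by (auto simp: S_def intro!: bdd_belowI[of _ 0])
  have le: "p x \<le> r" if "r \<in> S x" for x r unfolding p_def using that bdd by (rule cInf_lower)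
  have approx: "\<exists>r\<in>S x. r < z" if "p x < z" for x z
    using that cInf_less_iff[OF ne bdd] by (auto simp: p_def)
  have half: "p (r *\<^sub>R x) \<le> r * p x" if r: "0 < r" for r x
  proof -
    have "p (r *\<^sub>R x) / r \<le> p x"
      unfolding p_def[of x]
    proof (rule cInf_greatest[OF ne])
      fix a assume "a \<in> S x"
      then have "r * a \<in> S (r *\<^sub>R x)" using r by (auto simp: S_def)
      then show "p (r *\<^sub>R x) / r \<le> a" using le r by (simp add: divide_le_eq mult.commute)
    qed
    then show ?thesis using r by (simp add: divide_le_eq mult.commute)
  qed
  have "sublinear p"
  proof (rule sublinearI)
    fix x1 x2
    show "p (x1 + x2) \<le> p x1 + p x2"
    proof (rule field_le_epsilon)
      fix \<epsilon> :: real assume e: "0 < \<epsilon>"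
      obtain a where a: "a \<in> S x1" "a < p x1 + \<epsilon>/2" using approx[of x1 "p x1 + \<epsilon>/2"] e by auto
      obtain b where b: "b \<in> S x2" "b < p x2 + \<epsilon>/2" using approx[of x2 "p x2 + \<epsilon>/2"] e by auto
      have pos: "0 < a" "0 < b" using a b by (auto simp: S_def)
      have "a/(a+b) + b/(a+b) = 1" using pos by (simp add: add_divide_distrib[symmetric])
      then have "(a/(a+b)) *\<^sub>R ((1/a) *\<^sub>R x1) + (b/(a+b)) *\<^sub>R ((1/b) *\<^sub>R x2) \<in> C"
        using a b pos by (intro convexD[OF C(1)]) (auto simp: S_def)
      then have "a + b \<in> S (x1 + x2)"
        using pos by (auto simp: S_def scaleR_add_right)
      then show "p (x1 + x2) \<le> p x1 + p x2 + \<epsilon>" using le a b by fastforce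
    qed
  next
    have "S 0 = {0<..}" using C by (auto simp: S_def)
    then show "p 0 = 0" by (simp add: p_def)
  qed (rule half)
  then obtain l where l: "linear l" "\<And>x. l x \<le> p x" "l y = p y"
    using hahn_banach_sublinear by blast
  have "l x \<le> 1" if "x \<in> C" for x
    using l(2)[of x] le[of 1 x] that by (simp add: S_def)
  moreover have "1 \<le> p y"
    unfolding p_def
  proof (rule cInf_greatest[OF ne], rule ccontr)
    fix r assume r: "r \<in> S y" "\<not> 1 \<le> r"
    then have "r *\<^sub>R ((1/r) *\<^sub>R y) + (1 - r) *\<^sub>R 0 \<in> C"
      using C by (intro convexD[OF C(1)]) (auto simp: S_def)
    then show False using y r by (simp add: S_def)
  qed
  ultimately show thesis using that[of l] l by auto
qed

lemma linear_bounded_nhd_imp_continuous: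
  fixes l :: "'w::separable_frechet_space \<Rightarrow> real"
  assumes l: "linear l" and V: "open V" "0 \<in> V" "\<And>v. v \<in> V \<Longrightarrow> \<bar>l v\<bar> \<le> 1"
  shows "continuous_on UNIV l"
  unfolding continuous_on_eq_continuous_at[OF open_UNIV] continuous_at
proof (intro ballI tendstoI)
  fix x :: 'w and \<epsilon> :: real assume e: "0 < \<epsilon>"
  have "((\<lambda>z. (2/\<epsilon>) *\<^sub>R (z - x)) \<longlongrightarrow> (2/\<epsilon>) *\<^sub>R (x - x)) (at x)"
    unfolding diff_conv_add_uminus by (intro tendsto_intros)
  then have "\<forall>\<^sub>F z in at x. (2/\<epsilon>) *\<^sub>R (z - x) \<in> V"
    using V by (intro topological_tendstoD) auto
  then show "\<forall>\<^sub>F z in at x. dist (l z) (l x) < \<epsilon>"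
  proof eventually_elim
    case (elim z)
    have "\<bar>(2/\<epsilon>) * (l z - l x)\<bar> \<le> 1"
      using V(3)[OF elim] by (simp only: linear_cmul[OF l] linear_diff[OF l] real_scaleR_def)
    then show ?case using e by (simp add: dist_real_def abs_mult field_simps)
  qed
qed

lemma open_nhd_absorbing:
  fixes x :: "'w::separable_frechet_space"
  assumes "open V" "0 \<in> V"
  shows "\<exists>r>0. r *\<^sub>R x \<in> V"
proof -
  have "((\<lambda>r. r *\<^sub>R x) \<longlongrightarrow> 0 *\<^sub>R x) (at_right (0::real))"
    by (intro tendsto_intros)
  then have "\<forall>\<^sub>F r in at_right 0. r *\<^sub>R x \<in> V"
    using assms by (intro topological_tendstoD) auto
  moreover have "\<forall>\<^sub>F r in at_right (0::real). 0 < r"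
    by (simp add: eventually_at_right_less)
  ultimately have "\<forall>\<^sub>F r in at_right (0::real). 0 < r \<and> r *\<^sub>R x \<in> V"
    by eventually_elim auto
  then show ?thesis by (metis (mono_tags, lifting) eventually_happens trivial_limit_at_right_real)
qed

text \<open>
The set of all \<open>k - x0 + v\<close> is convex, absorbing and misses \<open>y - x0\<close>. The room given by \<open>V\<close> makes
the functional continuous and the separation strict.
\<close>
lemma separate_point_convex:
  fixes K :: "'w::separable_frechet_space set"
  assumes K: "convex K" "x0 \<in> K"
    and V: "open V" "convex V" "0 \<in> V" "\<And>v. v \<in> V \<Longrightarrow> - v \<in> V"
    and disj: "\<And>v. v \<in> V \<Longrightarrow> y + v \<notin> K"
  obtains l r where "l \<in> dual" "\<And>k. k \<in> K \<Longrightarrow> l k \<le> r" "r < l y"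
proof -
  define C where "C = {k - x0 + v | k v. k \<in> K \<and> v \<in> V}"
  have VC: "V \<subseteq> C" using K by (force simp: C_def)
  have "convex C"
  proof (rule convexI)
    fix x z and a b :: real
    assume "x \<in> C" "z \<in> C" and ab: "0 \<le> a" "0 \<le> b" "a + b = 1"
    then obtain k1 v1 k2 v2 where kv: "k1 \<in> K" "v1 \<in> V" "x = k1 - x0 + v1"
        "k2 \<in> K" "v2 \<in> V" "z = k2 - x0 + v2" by (auto simp: C_def)
    have "a *\<^sub>R x + b *\<^sub>R z = (a *\<^sub>R k1 + b *\<^sub>R k2) - (a + b) *\<^sub>R x0 + (a *\<^sub>R v1 + b *\<^sub>R v2)"
      unfolding kv by (simp add: algebra_simps)
    moreover have "a *\<^sub>R k1 + b *\<^sub>R k2 \<in> K" "a *\<^sub>R v1 + b *\<^sub>R v2 \<in> V"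
      using kv ab K V by (auto intro!: convexD)
    ultimately show "a *\<^sub>R x + b *\<^sub>R z \<in> C" using ab unfolding C_def by auto
  qed
  moreover have "0 \<in> C" using VC V by auto
  moreover have "\<exists>r>0. (1/r) *\<^sub>R x \<in> C" for x
  proof -
    obtain r where "0 < r" "r *\<^sub>R x \<in> V" using open_nhd_absorbing[OF V(1,3)] by blast
    then show ?thesis using VC by (intro exI[of _ "1/r"]) auto
  qed
  moreover have "y - x0 \<notin> C"
  proof
    assume "y - x0 \<in> C"
    then obtain k v where "k \<in> K" "v \<in> V" "y = k + v" by (auto simp: C_def algebra_simps)
    then show False using disj[of "- v"] V(4) by auto
  qed
  ultimately obtain l where l: "linear l" "\<And>x. x \<in> C \<Longrightarrow> l x \<le> (1::real)" "1 \<le> l (y - x0)"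
    using convex_absorbing_functional by blast
  have "\<bar>l v\<bar> \<le> 1" if "v \<in> V" for v
  proof -
    have "v \<in> C" "- v \<in> C" using VC V(4) that by auto
    from l(2)[OF this(1)] l(2)[OF this(2)] show ?thesis
        by (simp add: linear_neg[OF l(1)] abs_le_iff)
  qed
  then have "l \<in> dual"
    using linear_bounded_nhd_imp_continuous[OF l(1) V(1,3)] l(1) by (auto simp: dual_def)
  moreover obtain d where d: "0 < d" "d *\<^sub>R (y - x0) \<in> V"
    using open_nhd_absorbing[OF V(1,3)] by blast
  have "l k \<le> l x0 + 1 - d * l (y - x0)" if "k \<in> K" for k
  proof -
    have "k - x0 + d *\<^sub>R (y - x0) \<in> C" using that d by (auto simp: C_def)
    from l(2)[OF this] show ?thesis using l(1) by (simp add: linear_add linear_diff linear_cmul)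
  qed
  moreover have "l x0 + 1 - d * l (y - x0) < l y"
    using l(3) mult_pos_pos[OF d(1), of "l (y - x0)"] linear_diff[OF l(1), of y x0] by linarith
  ultimately show thesis using that by blast
qed

lemma open_affine_preimage:
  fixes x :: "'w::separable_frechet_space"
  assumes "open C" shows "open {z. a *\<^sub>R (z - x) \<in> C}"
proof -
  have "open ((\<lambda>z. a *\<^sub>R (z - x)) -` C)"
    unfolding diff_conv_add_uminus by (intro open_vimage assms continuous_intros)
  then show ?thesis by (simp add: vimage_def)
qed

text \<open>
Each point of an open set \<open>U\<close> has a convex neighbourhood whose closed half-space hull stays
inside \<open>U\<close>. By the Lindeloef property the complement of that hull is a countable union of open
half-spaces, and \<open>U\<close> is a countable union of such hulls.
\<close>
lemma borel_eq_sigma_dual: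
  "sets (borel :: 'w::separable_frechet_space measure)
    = sigma_sets UNIV {{w. l w \<le> r} | l r. l \<in> dual}"
proof (rule antisym)
  let ?G = "{{w::'w. l w \<le> r} | l r. l \<in> dual}"
  interpret S: sigma_algebra UNIV "sigma_sets UNIV ?G"
    by (rule sigma_algebra_sigma_sets) auto
  have "U \<in> sigma_sets UNIV ?G" if U: "open U" for U :: "'w set"
  proof -
    define Q where "Q x N K \<longleftrightarrow> x \<in> N \<and> open N \<and> N \<subseteq> K \<and> K \<subseteq> U \<and> K \<in> sigma_sets UNIV ?G"
      for x and N K :: "'w set"
    have "\<exists>N K. Q x N K" if x: "x \<in> U" for x
    proof -
      have "open {z. 1 *\<^sub>R (z - (- x)) \<in> U}" by (rule open_affine_preimage[OF U])
      then have "open {z. z + x \<in> U}" by simp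
      then obtain C where C: "open C" "0 \<in> C" "C \<subseteq> {z. z + x \<in> U}"
        "\<forall>a\<in>C. \<forall>b\<in>C. \<forall>u\<ge>0. \<forall>v\<ge>0. u + v = 1 \<longrightarrow> u *\<^sub>R a + v *\<^sub>R b \<in> C"
        using locally_convex[of "{z. z + x \<in> U}"] x by auto
      have cC: "convex C" using C(4) by (auto simp: convex_def)
      define N where "N = {z. 2 *\<^sub>R (z - x) \<in> C}"
      define V where "V = {z. 2 *\<^sub>R (z - 0) \<in> C} \<inter> {z. (- 2) *\<^sub>R (z - 0) \<in> C}"
      define \<H> where "\<H> = {{w. r < l w} | l r. l \<in> dual \<and> (\<forall>z\<in>N. l z \<le> r)}"
      have N: "open N" "x \<in> N"
        using open_affine_preimage[OF C(1), of 2 x] C(2) by (auto simp: N_def)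
      have cN: "convex N"
      proof (rule convexI)
        fix z1 z2 and a b :: real
        assume "z1 \<in> N" "z2 \<in> N" and ab: "0 \<le> a" "0 \<le> b" "a + b = 1"
        then have "a *\<^sub>R (2 *\<^sub>R (z1 - x)) + b *\<^sub>R (2 *\<^sub>R (z2 - x)) \<in> C"
          by (intro convexD[OF cC]) (auto simp: N_def)
        also have "a *\<^sub>R (2 *\<^sub>R (z1 - x)) + b *\<^sub>R (2 *\<^sub>R (z2 - x))
            = 2 *\<^sub>R ((a *\<^sub>R z1 + b *\<^sub>R z2) - (a + b) *\<^sub>R x)"
          by (simp add: algebra_simps)
        finally show "a *\<^sub>R z1 + b *\<^sub>R z2 \<in> N" using ab by (simp add: N_def)
      qed
      have V: "open V" "0 \<in> V" "\<And>v. v \<in> V \<Longrightarrow> - v \<in> V"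
        using open_affine_preimage[OF C(1), of 2 0] open_affine_preimage[OF C(1), of "- 2" 0] C(2)
        by (auto simp: V_def)
      have cV: "convex V"
      proof (rule convexI)
        fix z1 z2 and a b :: real
        assume z: "z1 \<in> V" "z2 \<in> V" and ab: "0 \<le> a" "0 \<le> b" "a + b = 1"
        have "a *\<^sub>R (c *\<^sub>R z1) + b *\<^sub>R (c *\<^sub>R z2) \<in> C" if "c = 2 \<or> c = - 2" for c :: real
          using z ab that by (intro convexD[OF cC]) (auto simp: V_def)
        moreover have "c *\<^sub>R (a *\<^sub>R z1 + b *\<^sub>R z2) = a *\<^sub>R (c *\<^sub>R z1) + b *\<^sub>R (c *\<^sub>R z2)" for c :: real
          by (simp add: algebra_simps)
        ultimately have "c *\<^sub>R (a *\<^sub>R z1 + b *\<^sub>R z2) \<in> C" if "c = 2 \<or> c = - 2" for c :: real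
          using that by metis
        from this[of 2] this[of "- 2"] show "a *\<^sub>R z1 + b *\<^sub>R z2 \<in> V" by (simp add: V_def)
      qed
      have op: "open H" if "H \<in> \<H>" for H
        using that by (auto simp: \<H>_def dual_def intro!: open_Collect_less continuous_on_const)
      then obtain \<H>' where H': "\<H>' \<subseteq> \<H>" "countable \<H>'" "\<Union>\<H>' = \<Union>\<H>"
        using Lindelof[of \<H>] by metis
      have Hs: "H \<in> sigma_sets UNIV ?G" if "H \<in> \<H>" for H
      proof -
        from that obtain l r where l: "l \<in> dual" "H = {w. r < l w}" by (auto simp: \<H>_def)
        have "{w. l w \<le> r} \<in> ?G" using l(1) by blast
        then have "UNIV - {w. l w \<le> r} \<in> sigma_sets UNIV ?G"
          by (intro sigma_sets.Compl[OF sigma_sets.Basic])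
        moreover have "H = UNIV - {w. l w \<le> r}" unfolding l(2) by (auto simp: not_le)
        ultimately show ?thesis by (simp only:)
      qed
      have "\<Union>\<H>' \<in> sigma_sets UNIV ?G"
        using H'(1) Hs by (intro S.countable_Union[OF H'(2)]) auto
      then have "\<Union>\<H> \<in> sigma_sets UNIV ?G" unfolding H'(3) .
      then have "UNIV - \<Union>\<H> \<in> sigma_sets UNIV ?G" by (rule sigma_sets.Compl)
      moreover have "N \<subseteq> UNIV - \<Union>\<H>" by (force simp: \<H>_def)
      moreover have "UNIV - \<Union>\<H> \<subseteq> U"
      proof (rule ccontr)
        assume "\<not> ?thesis"
        then obtain y where y: "y \<notin> \<Union>\<H>" "y \<notin> U" by auto
        have "y + v \<notin> N" if "v \<in> V" for v
        proof
          assume "y + v \<in> N"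
          then have "(1/2) *\<^sub>R (2 *\<^sub>R (y + v - x)) + (1/2) *\<^sub>R ((-2) *\<^sub>R v) \<in> C"
            using that by (intro convexD[OF cC]) (auto simp: N_def V_def)
          also have "(1/2) *\<^sub>R (2 *\<^sub>R (y + v - x)) + (1/2) *\<^sub>R ((-2) *\<^sub>R v) = y - x"
            by simp
          finally show False using C(3) y(2) by auto
        qed
        then obtain l r where l: "l \<in> dual" "\<And>k. k \<in> N \<Longrightarrow> l k \<le> r" "r < l y"
          using separate_point_convex[OF cN N(2) V(1) cV V(2,3)] by blast
        then have "{w. r < l w} \<in> \<H>" unfolding \<H>_def by blast
        then show False using y(1) l(3) by blast
      qed
      ultimately show ?thesis unfolding Q_def
        by (intro exI[of _ N] exI[of _ "UNIV - \<Union>\<H>"] conjI N)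
    qed
    then obtain N K where "\<And>x. x \<in> U \<Longrightarrow> Q x (N x) (K x)" by metis
    then have NK: "\<And>x. x \<in> U \<Longrightarrow> x \<in> N x" "\<And>x. x \<in> U \<Longrightarrow> open (N x)"
      "\<And>x. x \<in> U \<Longrightarrow> N x \<subseteq> K x" "\<And>x. x \<in> U \<Longrightarrow> K x \<subseteq> U"
      "\<And>x. x \<in> U \<Longrightarrow> K x \<in> sigma_sets UNIV ?G" by (simp_all add: Q_def)
    obtain \<N> where N: "\<N> \<subseteq> N ` U" "countable \<N>" "\<Union>\<N> = \<Union>(N ` U)"
      using Lindelof[of "N ` U"] NK(2) by auto
    then obtain X where X: "X \<subseteq> U" "countable X" "\<N> = N ` X"
      by (metis countable_subset_image)
    have "U = (\<Union>x\<in>X. K x)"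
    proof (intro equalityI subsetI)
      fix z assume "z \<in> U"
      then have "z \<in> \<Union>\<N>" using NK(1) N(3) by blast
      then obtain x where "x \<in> X" "z \<in> N x" using X(3) by blast
      then show "z \<in> (\<Union>x\<in>X. K x)" using NK(3) X(1) by blast
    next
      fix z assume "z \<in> (\<Union>x\<in>X. K x)"
      then show "z \<in> U" using NK(4) X(1) by blast
    qed
    moreover have "(\<Union>x\<in>X. K x) \<in> sigma_sets UNIV ?G"
    proof (rule S.countable_UN'[OF X(2)])
      show "K ` X \<subseteq> sigma_sets UNIV ?G" using X(1) NK(5) by blast
    qed
    ultimately show ?thesis by (simp only:)
  qed
  then show "sets borel \<subseteq> sigma_sets UNIV ?G"
    unfolding borel_def by (subst sets_measure_of; simp; intro sigma_sets_mono; blast)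
  show "sigma_sets UNIV ?G \<subseteq> sets borel"
    by (rule sets.sigma_sets_subset')
       (auto simp: dual_def intro!: borel_closed closed_Collect_le continuous_on_const)
qed

section \<open>The dual space and Riesz representatives\<close>

lemma dual_linear: "l \<in> dual \<Longrightarrow> linear l" and dual_continuous: "l \<in> dual \<Longrightarrow> continuous_on UNIV l"
  by (auto simp: dual_def)

lemma dual_measurable [measurable_dest]: "l \<in> dual \<Longrightarrow> l \<in> borel_measurable borel"
  by (auto simp: dual_def intro: borel_measurable_continuous_onI)

lemma dual_zero: "(\<lambda>_. 0) \<in> dual"
  by (auto simp: dual_def linear_zero)

lemma dual_add: "l \<in> dual \<Longrightarrow> m \<in> dual \<Longrightarrow> (\<lambda>w. l w + m w) \<in> dual"
  by (auto simp: dual_def intro!: linear_compose_add continuous_intros)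

lemma dual_scale: "l \<in> dual \<Longrightarrow> (\<lambda>w. c * l w) \<in> dual"
  using linear_compose_scale_right[of l c] by (auto simp: dual_def intro!: continuous_intros)

lemma dual_diff: "l \<in> dual \<Longrightarrow> m \<in> dual \<Longrightarrow> (\<lambda>w. l w - m w) \<in> dual"
  by (auto simp: dual_def intro!: linear_compose_sub continuous_intros)

lemma dual_sum: "(\<And>i. i \<in> J \<Longrightarrow> l i \<in> dual) \<Longrightarrow> (\<lambda>w. \<Sum>i\<in>J. l i w) \<in> dual"
  by (auto simp: dual_def intro!: linear_compose_sum continuous_intros)

text \<open>
The concave functional \<open>2 f x - |x|\<^sup>2\<close> is bounded above; the parallelogram identity makes every
maximizing sequence Cauchy, and at the maximum the first-order condition reads \<open>f h = r \<bullet> h\<close>.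
\<close>
lemma riesz_representation:
  fixes f :: "'h::{real_inner,complete_space} \<Rightarrow> real"
  assumes f: "linear f" "continuous_on UNIV f"
  obtains r where "\<And>h. f h = r \<bullet> h"
proof -
  define J where "J x = 2 * f x - (norm x)\<^sup>2" for x
  obtain d where d: "0 < d" "\<And>x. dist x 0 < d \<Longrightarrow> dist (f x) (f 0) < 1"
    using f(2) unfolding continuous_on_iff by (metis UNIV_I zero_less_one)
  have bound: "f x \<le> (2/d) * norm x" for x
  proof (cases "x = 0")
    case True then show ?thesis using f(1) by (simp add: linear_0)
  next
    case False
    have "dist ((d / (2 * norm x)) *\<^sub>R x) 0 < d" using d(1) False by simp
    from d(2)[OF this] have "f ((d / (2 * norm x)) *\<^sub>R x) < 1"
      by (simp add: linear_0[OF f(1)] dist_real_def)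
    then show ?thesis using False d(1) by (simp add: linear_cmul[OF f(1)] field_simps)
  qed
  have J_le: "J x \<le> (2/d)\<^sup>2" for x
  proof -
    have "0 \<le> (norm x)\<^sup>2 + (2/d)\<^sup>2 - 2 * ((2/d) * norm x)"
      using zero_le_power2[of "norm x - 2/d"] unfolding power2_diff by (simp add: mult.commute)
    with bound[of x] show ?thesis unfolding J_def by linarith
  qed
  define S where "S = Sup (range J)"
  have bdd: "bdd_above (range J)" using J_le by (auto intro!: bdd_aboveI2)
  have JS: "J x \<le> S" for x unfolding S_def using bdd by (intro cSup_upper) auto
  have "\<exists>x. S - 1 / real (Suc n) < J x" for n
  proof -
    have "S - 1 / real (Suc n) < S" by simp
    then show ?thesis unfolding S_def less_cSup_iff[OF _ bdd, simplified] by auto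
  qed
  then obtain X where X: "\<And>n. S - 1 / real (Suc n) < J (X n)" by metis
  have par: "(norm (x - y))\<^sup>2 = 4 * J ((1/2) *\<^sub>R (x + y)) - 2 * J x - 2 * J y" for x y
    by (simp add: J_def power2_norm_eq_inner linear_cmul[OF f(1)] linear_add[OF f(1)]
        inner_diff inner_add inner_commute algebra_simps)
  have "Cauchy X"
  proof (rule metric_CauchyI)
    fix \<epsilon> :: real assume e: "0 < \<epsilon>"
    obtain N where N: "4 / \<epsilon>\<^sup>2 < real N" using reals_Archimedean2 by blast
    show "\<exists>M. \<forall>m\<ge>M. \<forall>n\<ge>M. dist (X m) (X n) < \<epsilon>"
    proof (intro exI[of _ N] allI impI)
      fix m n assume mn: "N \<le> m" "N \<le> n"
      have Npos: "0 < real N" using N e by (smt (verit) divide_nonneg_nonneg zero_le_power2)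
      have low: "S - 1 / real N < J (X k)" if "N \<le> k" for k
      proof -
        have "1 / real (Suc k) \<le> 1 / real N" using that Npos by (intro divide_left_mono) auto
        then have "S - 1 / real N \<le> S - 1 / real (Suc k)" by (rule diff_left_mono)
        then show ?thesis using X[of k] by (rule order_le_less_trans)
      qed
      have "(dist (X m) (X n))\<^sup>2 < 4 * S - 2 * (S - 1 / real N) - 2 * (S - 1/ real N)"
        unfolding dist_norm par
        using JS[of "(1/2) *\<^sub>R (X m + X n)"] low[OF mn(1)] low[OF mn(2)] by argo
      also have "\<dots> = 4 / real N" by simp
      also have "\<dots> < \<epsilon>\<^sup>2" using N e Npos by (simp add: field_simps)
      finally show "dist (X m) (X n) < \<epsilon>" using e by (meson less_eq_real_def power2_less_imp_less)
    qed
  qed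
  then obtain r where r: "X \<longlonglongrightarrow> r" using Cauchy_convergent convergent_def by blast
  have "(\<lambda>n. J (X n)) \<longlonglongrightarrow> J r"
  proof -
    have "isCont f r" using f(2) by (simp add: continuous_on_eq_continuous_at)
    then have "(\<lambda>n. f (X n)) \<longlonglongrightarrow> f r" using r by (rule isCont_tendsto_compose)
    then show ?thesis unfolding J_def by (intro tendsto_intros r)
  qed
  moreover have "(\<lambda>n. S - 1 / real (Suc n)) \<longlonglongrightarrow> S - 0"
    by (intro tendsto_intros LIMSEQ_Suc lim_1_over_n)
  ultimately have "S \<le> J r"
    using LIMSEQ_le[of _ "S - 0" "\<lambda>n. J (X n)" "J r"] X by (auto intro: less_imp_le)
  then have max: "J x \<le> J r" for x using JS[of x] by simp
  have "f h = r \<bullet> h" for h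
  proof -
    have ineq: "2 * t * (f h - r \<bullet> h) \<le> t\<^sup>2 * (norm h)\<^sup>2" for t
    proof -
      have "(norm (r + t *\<^sub>R h))\<^sup>2 = (norm r)\<^sup>2 + 2 * t * (r \<bullet> h) + t\<^sup>2 * (norm h)\<^sup>2"
        by (simp add: power2_norm_eq_inner inner_add inner_commute power2_eq_square[of t]
            algebra_simps)
      with max[of "r + t *\<^sub>R h"] show ?thesis
        by (simp add: J_def linear_cmul[OF f(1)] linear_add[OF f(1)] algebra_simps)
    qed
    show ?thesis
    proof (cases "h = 0")
      case True then show ?thesis using f(1) by (simp add: linear_0)
    next
      case False
      define c where "c = f h - r \<bullet> h"
      define q where "q = (norm h)\<^sup>2"
      have q: "0 < q" using False by (simp add: q_def)
      have "2 * (c/q) * c \<le> (c/q)\<^sup>2 * q" using ineq[of "c/q"] by (simp add: c_def q_def)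
      then have "c * c \<le> 0" using q by (simp add: power2_eq_square field_simps)
      then have "c = 0" by (metis mult_eq_0_iff not_square_less_zero order_le_less)
      then show ?thesis by (simp add: c_def)
    qed
  qed
  then show thesis by (rule that)
qed

section \<open>Characteristic functionals determine finite measures\<close>

text \<open>
Levy's uniqueness theorem, extended from probability measures to finite measures by
normalization.
\<close>
lemma real_measure_eq_char:
  fixes M1 M2 :: "real measure"
  assumes fin: "finite_measure M1" "finite_measure M2" and sets: "sets M1 = sets borel" "sets M2
      = sets borel"
    and eq: "\<And>t. (CLINT x|M1. iexp (t * x)) = (CLINT x|M2. iexp (t * x))"
  shows "M1 = M2"
proof -
  interpret M1: finite_measure M1 by fact
  interpret M2: finite_measure M2 by fact
  have sp: "space M1 = UNIV" "space M2 = UNIV"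
    using sets_eq_imp_space_eq[OF sets(1)] sets_eq_imp_space_eq[OF sets(2)] by auto
  define m where "m = measure M1 UNIV"
  have m2: "measure M2 UNIV = m"
    using eq[of 0] sp by (simp add: m_def)
  have em: "emeasure M1 UNIV = ennreal m" "emeasure M2 UNIV = ennreal m"
    using M1.emeasure_eq_measure M2.emeasure_eq_measure m2 by (auto simp: m_def)
  show ?thesis
  proof (cases "m = 0")
    case True
    have "emeasure M1 A = emeasure M2 A" if "A \<in> sets M1" for A
    proof -
      have "emeasure M1 A \<le> emeasure M1 UNIV" using sp by (intro emeasure_mono) (auto simp: sets)
      moreover have "emeasure M2 A \<le> emeasure M2 UNIV" using sp
          by (intro emeasure_mono) (auto simp: sets)
      ultimately show ?thesis using em True by simp
    qed
    then show ?thesis using sets by (intro measure_eqI) auto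
  next
    case False
    then have m: "0 < m" by (simp add: m_def less_le)
    define N where "N M = density M (\<lambda>_::real. ennreal (1/m))" for M
    have rd: "real_distribution (N M)" and ch: "char (N M) t = (1/m) *\<^sub>R (CLINT x|M. iexp (t * x))"
      if M: "sets M = sets borel" "emeasure M UNIV = ennreal m" "space M = UNIV" for M t
    proof -
      have "emeasure (N M) UNIV = ennreal (1/m) * emeasure M UNIV"
        unfolding N_def by (rule emeasure_density_const) (simp add: M(1))
      also have "\<dots> = 1" using m by (simp add: M(2) ennreal_mult[symmetric])
      finally have "emeasure (N M) (space (N M)) = 1" by (simp add: N_def M(3))
      then interpret prob_space "N M" by (rule prob_spaceI)
      show "real_distribution (N M)"
        by standard (use M in \<open>auto simp: N_def\<close>)
      show "char (N M) t = (1/m) *\<^sub>R (CLINT x|M. iexp (t * x))"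
        unfolding char_def N_def using m M
        by (subst integral_density) (auto simp: measurable_cong_sets[OF M(1) refl])
    qed
    have "N M1 = N M2"
    proof (rule Levy_uniqueness)
      show "char (N M1) = char (N M2)"
        using ch[OF sets(1) em(1) sp(1)] ch[OF sets(2) em(2) sp(2)] eq by auto
    qed (use rd sets em sp in auto)
    then have "ennreal (1/m) * emeasure M1 A = ennreal (1/m)
        * emeasure M2 A" if "A \<in> sets borel" for A
      using that sets unfolding N_def by (metis emeasure_density_const)
    then have "emeasure M1 A = emeasure M2 A" if "A \<in> sets borel" for A
      using that m by (simp add: ennreal_mult_cancel_left)
    then show ?thesis using sets by (intro measure_eqI) auto
  qed
qed

definition same_char :: "'w::separable_frechet_space measure \<Rightarrow> 'w measure \<Rightarrow> bool" where
  "same_char M N \<longleftrightarrow> (\<forall>l\<in>dual. (CLINT w|M. iexp (l w)) = (CLINT w|N. iexp (l w)))"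

lemma integrable_bounded_iexp:
  assumes "finite_measure M" "u \<in> borel_measurable M" "g \<in> borel_measurable M" "\<And>w. \<bar>g w\<bar>
      \<le> (K::real)"
  shows "integrable M (\<lambda>w. complex_of_real (g w) * iexp (u w))"
proof -
  interpret finite_measure M by fact
  show ?thesis
    using assms by (intro integrable_const_bound[where B=K]) (auto simp: norm_mult)
qed

text \<open>
Levy's theorem applied to the images under \<open>l0\<close> of the measures with density \<open>g\<close>.
\<close>
lemma weighted_char_eq:
  fixes M N :: "'w::separable_frechet_space measure"
  assumes fin: "finite_measure M" "finite_measure N" and sets: "sets M = sets borel" "sets N
      = sets borel"
    and l0: "l0 \<in> dual" and g: "g \<in> borel_measurable borel" "\<And>w. 0 \<le> g w" "\<And>w. g w \<le> (K::real)"
    and eq: "\<And>t. (CLINT w|M. complex_of_real (g w) * iexp (t * l0 w))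
               = (CLINT w|N. complex_of_real (g w) * iexp (t * l0 w))"
    and B: "B \<in> sets borel"
  shows "(LINT w|M. indicat_real B (l0 w) * g w) = (LINT w|N. indicat_real B (l0 w) * g w)"
proof -
  note [measurable] = dual_measurable[OF l0] g(1) B
  define D where "D M = distr (density M (\<lambda>w. ennreal (g w))) borel l0" for M :: "'w measure"
  have D: "finite_measure (D M)" "(CLINT x|D M. iexp (t * x))
      = (CLINT w|M. complex_of_real (g w) * iexp (t * l0 w))"
    "measure (D M) B = (LINT w|M. indicat_real B (l0 w) * g w)"
    if M: "finite_measure M" and s: "sets M = sets borel" for M t
  proof -
    interpret finite_measure M by fact
    have [measurable_cong]: "sets M = sets borel" by fact
    have "emeasure (density M (\<lambda>w. ennreal (g w))) (space M) \<le> (\<integral>\<^sup>+ w. ennreal K \<partial>M)"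
    proof -
      have "emeasure (density M (\<lambda>w. ennreal (g w))) (space M)
          = (\<integral>\<^sup>+ w. ennreal (g w) * indicator (space M) w \<partial>M)"
        by (rule emeasure_density) auto
      also have "\<dots> \<le> (\<integral>\<^sup>+ w. ennreal K \<partial>M)"
        using g by (intro nn_integral_mono) (auto intro!: ennreal_leI split: split_indicator)
      finally show ?thesis .
    qed
    also have "\<dots> < \<infinity>" by (simp add: ennreal_mult_less_top emeasure_eq_measure)
    finally interpret dd: finite_measure "density M (\<lambda>w. ennreal (g w))"
      by (intro finite_measureI) (auto simp: less_top)
    have l0m: "l0 \<in> measurable (density M (\<lambda>w. ennreal (g w))) borel" by measurable
    show "finite_measure (D M)"
      unfolding D_def by (rule dd.finite_measure_distr[OF l0m])
    show "(CLINT x|D M. iexp (t * x)) = (CLINT w|M. complex_of_real (g w) * iexp (t * l0 w))"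
      unfolding D_def using g(2)
      by (simp add: integral_distr[OF l0m] integral_density scaleR_conv_of_real)
    have "measure (D M) B = measure (density M (\<lambda>w. ennreal (g w))) (l0 -` B \<inter> space M)"
      unfolding D_def by (simp add: measure_distr[OF l0m])
    also have "\<dots> = (LINT w|density M (\<lambda>w. ennreal (g w)). indicat_real B (l0 w))"
    proof -
      have "(LINT w|density M (\<lambda>w. ennreal (g w)). indicat_real B (l0 w))
          = (LINT w|density M (\<lambda>w. ennreal (g w)). indicat_real (l0 -` B \<inter> space M) w)"
        by (intro Bochner_Integration.integral_cong refl) (auto simp: indicator_def)
      then show ?thesis by simp
    qed
    also have "\<dots> = (LINT w|M. indicat_real B (l0 w) * g w)"
      using g(2) by (subst integral_density) (auto simp: mult.commute)
    finally show "measure (D M) B = (LINT w|M. indicat_real B (l0 w) * g w)" .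
  qed
  have "D M = D N"
    using D(1,2)[OF fin(1) sets(1)] D(1,2)[OF fin(2) sets(2)] eq
    by (intro real_measure_eq_char) (auto simp: D_def)
  then show ?thesis using D(3)[OF fin(1) sets(1)] D(3)[OF fin(2) sets(2)] by simp
qed

text \<open>
Reduces uniqueness on \<open>W\<close> to uniqueness on the line, by treating one functional \<open>l0\<close> at a time.
The weights \<open>1 + cos l\<close> and \<open>1 + sin l\<close> are nonnegative, and integrating them against
\<open>exp (\<i> t l0)\<close> gives combinations of the known integrals of \<open>exp (\<i> (t l0 \<plusminus> l))\<close>.
\<close>
lemma same_char_restrict:
  fixes M N :: "'w::separable_frechet_space measure"
  assumes fin: "finite_measure M" "finite_measure N" and sets: "sets M = sets borel" "sets N
      = sets borel"
    and eq: "same_char M N" and l0: "l0 \<in> dual" and B: "B \<in> sets borel"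
  shows "same_char (density M (\<lambda>w. indicator B (l0 w))) (density N (\<lambda>w. indicator B (l0 w)))"
  unfolding same_char_def
proof
  fix l :: "'w \<Rightarrow> real" assume l: "l \<in> dual"
  note [measurable] = dual_measurable[OF l0] dual_measurable[OF l] B
  note [measurable_cong] = sets
  interpret M: finite_measure M by fact
  interpret N: finite_measure N by fact
  have ie: "(CLINT w|M. iexp (m w)) = (CLINT w|N. iexp (m w))" if "m \<in> dual" for m
    using eq that by (auto simp: same_char_def)
  have int: "integrable M (\<lambda>w. iexp (m w))" "integrable N (\<lambda>w. iexp (m w))" if "m \<in> dual" for m
    using integrable_bounded_iexp[OF fin(1), of m "\<lambda>_. 1" 1] integrable_bounded_iexp[OF fin(2), of m
        "\<lambda>_. 1" 1]
      dual_measurable[OF that] by (auto simp: measurable_cong_sets[OF sets(1) refl]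
          measurable_cong_sets[OF sets(2) refl])
  have tl: "(\<lambda>w. t * l0 w) \<in> dual" "(\<lambda>w. t * l0 w + l w) \<in> dual" "(\<lambda>w. t * l0 w - l w) \<in> dual" for t
    by (intro dual_add dual_scale dual_diff l l0)+
  have c0: "(CLINT w|M. iexp (t * l0 w)) = (CLINT w|N. iexp (t * l0 w))" for t
    using ie[OF tl(1)] by simp
  \<comment> \<open>The integrals of \<open>cos l\<close> and \<open>sin l\<close> over \<open>l0 \<in> B\<close> are recovered by subtracting the case of
  weight 1.\<close>
  have cosid: "complex_of_real (1 + cos (l w)) * iexp (t * l0 w)
      = iexp (t * l0 w) + (1/2) * iexp (t * l0 w + l w) + (1/2) * iexp (t * l0 w - l w)" for t w
    by (simp add: cos_exp_eq cos_of_real[symmetric] algebra_simps exp_add[symmetric] exp_diff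
        exp_minus field_simps)
  have sinid: "complex_of_real (1 + sin (l w)) * iexp (t * l0 w)
      = iexp (t * l0 w) + (- \<i>/2) * iexp (t * l0 w + l w) + (\<i>/2) * iexp (t * l0 w - l w)" for t w
    by (simp add: sin_exp_eq' sin_of_real[symmetric] algebra_simps exp_add[symmetric] exp_diff
        exp_minus field_simps)
  have lin: "(CLINT w|M'. iexp (t * l0 w) + c * iexp (t * l0 w + l w) + d * iexp (t * l0 w - l w))
      = (CLINT w|M'. iexp (t * l0 w)) + c * (CLINT w|M'. iexp (t * l0 w + l w))
          + d * (CLINT w|M'. iexp (t * l0 w - l w))"
    if "M' = M \<or> M' = N" for M' t and c d :: complex
    using that int[OF tl(1)[of t]] int[OF tl(2)[of t]] int[OF tl(3)[of t]] by auto
  have 1: "(LINT w|M. indicat_real B (l0 w) * 1) = (LINT w|N. indicat_real B (l0 w) * 1)"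
    by (rule weighted_char_eq[OF fin sets l0, where K=1]) (use B c0 in auto)
  have 2: "(LINT w|M. indicat_real B (l0 w) * (1 + cos (l w)))
      = (LINT w|N. indicat_real B (l0 w) * (1 + cos (l w)))"
  proof (rule weighted_char_eq[OF fin sets l0, where K=2])
    show "(CLINT w|M. complex_of_real (1 + cos (l w)) * iexp (t * l0 w))
        = (CLINT w|N. complex_of_real (1 + cos (l w)) * iexp (t * l0 w))" for t
      by (simp only: cosid lin c0 ie[OF tl(2)] ie[OF tl(3)] simp_thms)
    show "0 \<le> 1 + cos (l w)" for w using cos_ge_minus_one[of "l w"] by linarith
  qed (use B in auto)
  have 3: "(LINT w|M. indicat_real B (l0 w) * (1 + sin (l w)))
      = (LINT w|N. indicat_real B (l0 w) * (1 + sin (l w)))"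
  proof (rule weighted_char_eq[OF fin sets l0, where K=2])
    show "(CLINT w|M. complex_of_real (1 + sin (l w)) * iexp (t * l0 w))
        = (CLINT w|N. complex_of_real (1 + sin (l w)) * iexp (t * l0 w))" for t
      by (simp only: sinid lin c0 ie[OF tl(2)] ie[OF tl(3)] simp_thms)
    show "0 \<le> 1 + sin (l w)" for w using sin_ge_minus_one[of "l w"] by linarith
  qed (use B in auto)
  define i1 where "i1 M = (LINT w|M. indicat_real B (l0 w) * 1)" for M
  define i2 where "i2 M = (LINT w|M. indicat_real B (l0 w) * (1 + cos (l w)))" for M
  define i3 where "i3 M = (LINT w|M. indicat_real B (l0 w) * (1 + sin (l w)))" for M
  have res: "(CLINT w|density M' (\<lambda>w. indicator B (l0 w)). iexp (l w))
      = complex_of_real (i2 M' - i1 M') + \<i> * complex_of_real (i3 M' - i1 M')"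
    if f: "finite_measure M'" and s: "sets M' = sets borel" for M'
  proof -
    interpret M': finite_measure M' by fact
    note [measurable_cong] = s
    have bound2: "norm (indicat_real B x * (1 + y)) \<le> 2" if "- 1 \<le> y" "y \<le> 1" for x y
      using that by (auto simp: indicator_def abs_le_iff)
    have j1: "integrable M' (\<lambda>w. indicat_real B (l0 w) * 1)"
      by (intro M'.integrable_const_bound[where B=1]) auto
    have j2: "integrable M' (\<lambda>w. indicat_real B (l0 w) * (1 + cos (l w)))"
      by (intro M'.integrable_const_bound[where B=2])
          (auto intro!: AE_I2 bound2 simp del: real_norm_def)
    have j3: "integrable M' (\<lambda>w. indicat_real B (l0 w) * (1 + sin (l w)))"
      by (intro M'.integrable_const_bound[where B=2])
          (auto intro!: AE_I2 bound2 simp del: real_norm_def)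
    have "(CLINT w|density M' (\<lambda>w. indicator B (l0 w)). iexp (l w))
        = (CLINT w|density M' (\<lambda>w. ennreal (indicat_real B (l0 w))). iexp (l w))"
      by (simp add: ennreal_indicator)
    also have "\<dots> = (CLINT w|M'. indicat_real B (l0 w) *\<^sub>R iexp (l w))"
      by (subst integral_density) auto
    also have "\<dots> = (CLINT w|M'. complex_of_real (indicat_real B (l0 w) * (1
        + cos (l w)) - indicat_real B (l0 w) * 1)
        + \<i> * complex_of_real (indicat_real B (l0 w) * (1
            + sin (l w)) - indicat_real B (l0 w) * 1))"
      by (intro Bochner_Integration.integral_cong refl)
         (simp add: exp_Euler scaleR_conv_of_real cos_of_real sin_of_real algebra_simps)
    also have "\<dots> = (CLINT w|M'. complex_of_real (indicat_real B (l0 w) * (1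
        + cos (l w)) - indicat_real B (l0 w) * 1))
        + \<i> * (CLINT w|M'. complex_of_real (indicat_real B (l0 w) * (1
            + sin (l w)) - indicat_real B (l0 w) * 1))"
    proof -
      have k1: "complex_integrable M' (\<lambda>w. complex_of_real (indicat_real B (l0 w) * (1
          + cos (l w)) - indicat_real B (l0 w) * 1))"
        by (intro integrable_of_real Bochner_Integration.integrable_diff j1 j2)
      have k2: "complex_integrable M' (\<lambda>w. complex_of_real (indicat_real B (l0 w) * (1
          + sin (l w)) - indicat_real B (l0 w) * 1))"
        by (intro integrable_of_real Bochner_Integration.integrable_diff j1 j3)
      show ?thesis
        by (simp only: Bochner_Integration.integral_add[OF k1 integrable_mult_right[OF k2]]
            integral_mult_right_zero)
    qed
    also have "\<dots> = complex_of_real (i2 M' - i1 M') + \<i> * complex_of_real (i3 M' - i1 M')"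
      unfolding integral_complex_of_real i1_def i2_def i3_def
      using j1 j2 j3 by (simp only: Bochner_Integration.integral_diff)
    finally show ?thesis .
  qed
  show "(CLINT w|density M (\<lambda>w. indicator B (l0 w)). iexp (l w))
      = (CLINT w|density N (\<lambda>w. indicator B (l0 w)). iexp (l w))"
    using res[OF fin(1) sets(1)] res[OF fin(2) sets(2)] 1 2 3 by (simp add: i1_def i2_def i3_def)
qed

text \<open>
Restricting to \<open>l \<le> r\<close> for finitely many \<open>l\<close> in turn keeps the characteristic functionals equal,
so the measures agree on the finite intersections of half-spaces, an intersection-stable
generator of the Borel sets.
\<close>
theorem same_char_imp_eq:
  fixes M N :: "'w::separable_frechet_space measure"
  assumes fin: "finite_measure M" "finite_measure N" and sets: "sets M = sets borel" "sets N
      = sets borel"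
    and eq: "same_char M N"
  shows "M = N"
proof -
  define C where "C ls = {w. \<forall>(l, r)\<in>set ls. l w \<le> r}" for ls :: "(('w \<Rightarrow> real) \<times> real) list"
  define E where "E = C ` {ls. fst ` set ls \<subseteq> dual}"
  have EI: "C ls \<in> E" if "fst ` set ls \<subseteq> dual" for ls using that by (auto simp: E_def)
  have C_Cons: "C ((l, r) # ls) = {w. l w \<le> r} \<inter> C ls" for l r ls by (auto simp: C_def)
  have C_borel: "C ls \<in> sets borel" if "fst ` set ls \<subseteq> dual" for ls
    using that
  proof (induction ls)
    case (Cons a ls)
    obtain l r where a: "a = (l, r)" by (cases a)
    with Cons have [measurable]: "l \<in> borel_measurable borel" by (auto intro: dual_measurable)
    have "{w. l w \<le> r} \<in> sets borel" by measurable
    then show ?case using Cons a by (auto simp: C_Cons)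
  qed (simp add: C_def)
  have em: "emeasure M (C ls) = emeasure N (C ls)"
    if "fst ` set ls \<subseteq> dual" "finite_measure M" "finite_measure N" "sets M = sets borel" "sets N
        = sets borel"
      "same_char M N" for ls M N
    using that
  proof (induction ls arbitrary: M N)
    case Nil
    interpret M: finite_measure M by fact
    interpret N: finite_measure N by fact
    have sp: "space M = UNIV" "space N = UNIV"
      using sets_eq_imp_space_eq[OF Nil(4)] sets_eq_imp_space_eq[OF Nil(5)] by auto
    have "(CLINT w|M. iexp ((\<lambda>_. 0) w)) = (CLINT w|N. iexp ((\<lambda>_. 0) w))"
      using Nil(6) unfolding same_char_def by (rule bspec[OF _ dual_zero])
    then have "measure M UNIV = measure N UNIV" by (simp add: sp)
    then show ?case by (simp add: C_def M.emeasure_eq_measure N.emeasure_eq_measure)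
  next
    case (Cons a ls)
    obtain l r where a: "a = (l, r)" by (cases a)
    with Cons have l: "l \<in> dual" and ls: "fst ` set ls \<subseteq> dual" by auto
    note [measurable] = dual_measurable[OF l]
    have aux: "finite_measure (density M (\<lambda>w. indicator {..r} (l w)))"
      "emeasure (density M (\<lambda>w. indicator {..r} (l w))) (C ls) = emeasure M (C (a # ls))"
      if "finite_measure M" "sets M = sets borel" for M
    proof -
      interpret finite_measure M by fact
      note [measurable_cong] = that(2)
      have C: "C ls \<in> sets M" "C (a # ls) \<in> sets M"
          using C_borel[of ls] C_borel[of "a # ls"] Cons(2) that ls by auto
      have e: "emeasure (density M (\<lambda>w. indicator {..r} (l w))) X = emeasure M ({w\<in>space M. l w
          \<le> r} \<inter> X)"
        if X: "X \<in> sets M" for X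
      proof -
        have "emeasure (density M (\<lambda>w. indicator {..r} (l w))) X
            = (\<integral>\<^sup>+ w. indicator {..r} (l w) * indicator X w \<partial>M)"
          using X by (intro emeasure_density) auto
        also have "\<dots> = (\<integral>\<^sup>+ w. indicator ({w\<in>space M. l w \<le> r} \<inter> X) w \<partial>M)"
          by (intro nn_integral_cong) (auto split: split_indicator)
        also have "\<dots> = emeasure M ({w\<in>space M. l w \<le> r} \<inter> X)" using X
            by (intro nn_integral_indicator sets.Int) auto
        finally show ?thesis .
      qed
      show "finite_measure (density M (\<lambda>w. indicator {..r} (l w)))"
        by (rule finite_measureI) (simp add: e)
      show "emeasure (density M (\<lambda>w. indicator {..r} (l w))) (C ls) = emeasure M (C (a # ls))"
        using C e[OF C(1)] sets_eq_imp_space_eq[OF that(2)] by (simp add: a C_Cons)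
    qed
    have "emeasure (density M (\<lambda>w. indicator {..r} (l w))) (C ls)
        = emeasure (density N (\<lambda>w. indicator {..r} (l w))) (C ls)"
      using Cons aux ls same_char_restrict[OF Cons(3-7) l, of "{..r}"] by (intro Cons(1)) auto
    then show ?case using aux Cons by simp
  qed
  have sE: "sigma_sets UNIV E = sets borel"
  proof (rule antisym)
    show "sigma_sets UNIV E \<subseteq> sets borel" using C_borel
        by (intro sets.sigma_sets_subset') (auto simp: E_def)
    show "sets borel \<subseteq> sigma_sets UNIV E"
      unfolding borel_eq_sigma_dual
    proof (rule sigma_sets_mono, safe)
      fix l r assume "l \<in> (dual :: ('w \<Rightarrow> real) set)"
      moreover have "{w. l w \<le> r} = C [(l, r)]" by (auto simp: C_def)
      ultimately show "{w. l w \<le> r} \<in> sigma_sets UNIV E" unfolding E_def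
          by (auto intro!: sigma_sets.Basic)
    qed
  qed
  show ?thesis
  proof (rule measure_eqI_generator_eq[where E=E and \<Omega>=UNIV and A="\<lambda>_. UNIV"])
    show "Int_stable E"
    proof (rule Int_stableI)
      fix a b assume "a \<in> E" "b \<in> E"
      then obtain la lb where ab: "fst ` set la \<subseteq> dual" "fst ` set lb \<subseteq> dual" "a = C la" "b = C lb"
        unfolding E_def by blast
      have "C la \<inter> C lb = C (la @ lb)" by (auto simp: C_def)
      moreover have "C (la @ lb) \<in> E" using ab(1,2) by (intro EI) (simp add: image_Un)
      ultimately show "a \<inter> b \<in> E" using ab(3,4) by simp
    qed
    show "range (\<lambda>_. UNIV) \<subseteq> E" using EI[of "[]"] by (simp add: C_def)
    show "emeasure M UNIV \<noteq> \<infinity>" for i :: nat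
      using finite_measure.finite_emeasure_space[OF fin(1)] sets_eq_imp_space_eq[OF sets(1)] by auto
  qed (use em fin sets eq sE in \<open>auto simp: E_def\<close>)
qed

section \<open>Linear images of the Gaussian measure\<close>

lemma norm_add_scaleR_sq:
  "(norm (a + t *\<^sub>R b :: 'a::real_inner))\<^sup>2 = (norm a)\<^sup>2 + 2 * t * (a \<bullet> b) + t\<^sup>2 * (norm b)\<^sup>2"
  by (simp add: power2_norm_eq_inner inner_add inner_commute power2_eq_square[of t] algebra_simps)

lemma std_normal_prob: "prob_space std_normal_distribution"
  using real_dist_normal_dist by (simp add: real_distribution_def)

lemma iexp_pair_integral:
  assumes "prob_space M" "prob_space N" and [measurable]: "u \<in> borel_measurable M"
      "v \<in> borel_measurable N"
  shows "(CLINT z|M \<Otimes>\<^sub>M N. iexp (u (fst z) + v (snd z)))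
      = (CLINT x|M. iexp (u x)) * (CLINT y|N. iexp (v y))"
proof -
  interpret M: prob_space M by fact
  interpret N: prob_space N by fact
  interpret P: pair_prob_space M N ..
  have int: "integrable (M \<Otimes>\<^sub>M N) (\<lambda>z. iexp (u (fst z) + v (snd z)))"
    by (intro P.integrable_const_bound[where B=1]) auto
  have "(CLINT z|M \<Otimes>\<^sub>M N. iexp (u (fst z) + v (snd z))) = (CLINT x|M. CLINT y|N. iexp (u x + v y))"
    using P.integral_fst'[OF int] by simp
  also have "\<dots> = (CLINT x|M. CLINT y|N. iexp (u x) * iexp (v y))"
    by (simp add: exp_add algebra_simps)
  also have "\<dots> = (CLINT x|M. iexp (u x)) * (CLINT y|N. iexp (v y))"
    by simp
  finally show ?thesis .
qed

lemma std_normal_iexp: "(CLINT x|std_normal_distribution. iexp (t * x))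
    = complex_of_real (exp (- (1/2) * t\<^sup>2))"
  using fun_cong[OF char_std_normal_distribution, of t] by (simp add: char_def)

context abstract_wiener_space
begin

lemma space_mu [simp]: "space \<mu> = UNIV"
  using sets_eq_imp_space_eq[OF sets_mu] by simp

lemma measurable_mu [measurable_cong]: "sets \<mu> = sets borel"
  by (fact sets_mu)

lemma measurable_iota [measurable]: "\<iota> \<in> borel_measurable borel"
  using continuous_inj by (rule borel_measurable_continuous_onI)

lemma riesz_unique: "(\<And>h. l (\<iota> h) = r \<bullet> h) \<Longrightarrow> riesz_rep \<iota> l = r"
  unfolding riesz_rep_def
proof (rule the_equality)
  fix r' assume l: "\<And>h. l (\<iota> h) = r \<bullet> h" and "\<forall>h. l (\<iota> h) = r' \<bullet> h"
  then have "r' \<bullet> (r' - r) = r \<bullet> (r' - r)" by metis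
  then have "(r' - r) \<bullet> (r' - r) = 0" by (simp add: inner_diff_left)
  then show "r' = r" by simp
qed auto

lemma riesz_inner: assumes "l \<in> dual" shows "l (\<iota> h) = riesz_rep \<iota> l \<bullet> h"
proof -
  have "linear (l \<circ> \<iota>)" using dual_linear[OF assms] linear_inj by (rule linear_compose[rotated])
  moreover have "continuous_on UNIV (l \<circ> \<iota>)"
    unfolding comp_def by (rule continuous_on_compose2[OF dual_continuous[OF assms] continuous_inj])
        auto
  ultimately obtain r where "\<And>h. (l \<circ> \<iota>) h = r \<bullet> h" using riesz_representation by blast
  then show ?thesis using riesz_unique[of l r] by simp
qed

lemma gaussian_image:
  assumes "prob_space N" and X: "X \<in> measurable N borel"
    and ch: "\<And>l. l \<in> dual \<Longrightarrow> (CLINT x|N. iexp (l (X x)))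
        = complex_of_real (exp (- (1/2) * (norm (riesz_rep \<iota> l))\<^sup>2))"
  shows "distr N borel X = \<mu>"
proof (rule same_char_imp_eq)
  interpret N: prob_space N by fact
  show "finite_measure (distr N borel X)" using X by (rule N.finite_measure_distr)
  show "same_char (distr N borel X) \<mu>"
    unfolding same_char_def
  proof
    fix l :: "'w \<Rightarrow> real" assume l: "l \<in> dual"
    note [measurable] = dual_measurable[OF l]
    show "(CLINT w|distr N borel X. iexp (l w)) = (CLINT w|\<mu>. iexp (l w))"
      using ch[OF l] char_mu[OF l] by (subst integral_distr[OF X]) auto
  qed
qed (auto simp: sets_mu intro: finite_measure_axioms)

text \<open>
The independent sum \<open>Aw + By\<close> has the characteristic functional \<open>exp (- (|A\<^sup>*l|\<^sup>2 + |B\<^sup>*l|\<^sup>2)/2)\<close>.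
\<close>
lemma rotation_image:
  assumes A: "A \<in> borel_measurable borel" "\<And>l. l \<in> dual \<Longrightarrow> (\<lambda>w. l (A w)) \<in> dual"
    and B: "B \<in> borel_measurable borel" "\<And>l. l \<in> dual \<Longrightarrow> (\<lambda>w. l (B w)) \<in> dual"
    and norm: "\<And>l. l \<in> dual \<Longrightarrow>
      (norm (riesz_rep \<iota> (\<lambda>w. l (A w))))\<^sup>2 + (norm (riesz_rep \<iota> (\<lambda>w. l (B w))))\<^sup>2
          = (norm (riesz_rep \<iota> l))\<^sup>2"
  shows "distr (\<mu> \<Otimes>\<^sub>M \<mu>) borel (\<lambda>z. A (fst z) + B (snd z)) = \<mu>"
proof (rule gaussian_image)
  note [measurable] = A(1) B(1)
  interpret P: pair_prob_space \<mu> \<mu> ..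
  show "prob_space (\<mu> \<Otimes>\<^sub>M \<mu>)" by (rule P.prob_space_axioms)
  show "(\<lambda>z. A (fst z) + B (snd z)) \<in> borel_measurable (\<mu> \<Otimes>\<^sub>M \<mu>)" by measurable
  fix l :: "'w \<Rightarrow> real" assume l: "l \<in> dual"
  note [measurable] = dual_measurable[OF l]
  have "(CLINT z|\<mu> \<Otimes>\<^sub>M \<mu>. iexp (l (A (fst z) + B (snd z))))
      = (CLINT z|\<mu> \<Otimes>\<^sub>M \<mu>. iexp (l (A (fst z)) + l (B (snd z))))"
    by (simp add: linear_add[OF dual_linear[OF l]])
  also have "\<dots> = (CLINT x|\<mu>. iexp (l (A x))) * (CLINT y|\<mu>. iexp (l (B y)))"
    by (rule iexp_pair_integral) (auto intro: prob_space_axioms)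
  also have "\<dots> = complex_of_real (exp (- (1/2) * (norm (riesz_rep \<iota> l))\<^sup>2))"
    unfolding char_mu[OF A(2)[OF l]] char_mu[OF B(2)[OF l]] of_real_mult[symmetric]
        exp_add[symmetric] norm[OF l, symmetric]
    by (simp add: field_simps)
  finally show "(CLINT z|\<mu> \<Otimes>\<^sub>M \<mu>. iexp (l (A (fst z) + B (snd z))))
      = complex_of_real (exp (- (1/2) * (norm (riesz_rep \<iota> l))\<^sup>2))" .
qed

text \<open>
Scaling the coordinate \<open>l0\<close> by \<open>\<alpha>\<close> lowers its variance to \<open>\<alpha>\<^sup>2\<close>, and the independent \<open>x\<close> restores the
missing \<open>\<beta>\<^sup>2\<close>. With \<open>\<alpha> = 0\<close>, \<open>\<beta> = 1\<close> this disintegrates \<open>\<mu>\<close> along the direction of \<open>l0\<close>.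
\<close>
lemma line_image:
  assumes l0: "l0 \<in> dual" "norm (riesz_rep \<iota> l0) = 1" and ab: "\<alpha>\<^sup>2 + \<beta>\<^sup>2 = (1::real)"
  shows "distr (\<mu> \<Otimes>\<^sub>M std_normal_distribution) borel
    (\<lambda>z. fst z + ((\<alpha> - 1) * l0 (fst z) + \<beta> * snd z) *\<^sub>R \<iota> (riesz_rep \<iota> l0)) = \<mu>"
    (is "distr ?P borel ?X = \<mu>")
proof (rule gaussian_image)
  interpret S: prob_space std_normal_distribution by (rule std_normal_prob)
  interpret P: pair_prob_space \<mu> std_normal_distribution ..
  define f where "f = riesz_rep \<iota> l0"
  note [measurable] = dual_measurable[OF l0(1)]
  show "prob_space ?P" by (rule P.prob_space_axioms)
  show "?X \<in> borel_measurable ?P" by measurable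
  fix l :: "'w \<Rightarrow> real" assume l: "l \<in> dual"
  note [measurable] = dual_measurable[OF l]
  define c where "c = l (\<iota> f)"
  define r where "r = riesz_rep \<iota> l"
  have c: "c = r \<bullet> f" by (simp add: c_def r_def riesz_inner[OF l])
  \<comment> \<open>The part of the exponent that depends on \<open>w\<close>; its variance is \<open>|r|\<^sup>2 - \<beta>\<^sup>2c\<^sup>2\<close>, and the
  variable \<open>x\<close> supplies the missing \<open>\<beta>\<^sup>2c\<^sup>2\<close>.\<close>
  define m where "m w = l w + ((\<alpha> - 1) * c) * l0 w" for w
  have m: "m \<in> dual" unfolding m_def by (intro dual_add dual_scale l l0)
  have rm: "riesz_rep \<iota> m = r + ((\<alpha> - 1) * c) *\<^sub>R f"
    by (rule riesz_unique) (simp add: m_def riesz_inner[OF l] riesz_inner[OF l0(1)] r_def f_def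
        inner_add_left)
  have "(norm (riesz_rep \<iota> m))\<^sup>2 = (norm r)\<^sup>2 + 2 * ((\<alpha> - 1) * c) * (r \<bullet> f)
      + ((\<alpha> - 1) * c)\<^sup>2 * (norm f)\<^sup>2"
    unfolding rm by (rule norm_add_scaleR_sq)
  also have "\<dots> = (norm r)\<^sup>2 - \<beta>\<^sup>2 * c\<^sup>2"
  proof -
    have b: "\<beta>\<^sup>2 = 1 - \<alpha>\<^sup>2" using ab by simp
    show ?thesis unfolding b c[symmetric] using l0(2)
        by (simp add: f_def power2_eq_square algebra_simps)
  qed
  finally have nm: "(norm (riesz_rep \<iota> m))\<^sup>2 = (norm r)\<^sup>2 - \<beta>\<^sup>2 * c\<^sup>2" .
  have "(CLINT z|?P. iexp (l (?X z))) = (CLINT z|?P. iexp (m (fst z) + (\<beta> * c) * snd z))"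
    by (intro Bochner_Integration.integral_cong refl arg_cong[where f=iexp])
       (unfold linear_add[OF dual_linear[OF l]] linear_cmul[OF dual_linear[OF l]] m_def c_def f_def
           real_scaleR_def,
        simp add: algebra_simps)
  also have "\<dots> = (CLINT x|\<mu>. iexp (m x)) * (CLINT y|std_normal_distribution. iexp ((\<beta> * c) * y))"
    using dual_measurable[OF m] by (intro iexp_pair_integral prob_space_axioms std_normal_prob)
        (auto simp: measurable_cong_sets[OF sets_mu refl])
  also have "\<dots> = complex_of_real (exp (- (1/2) * (norm (riesz_rep \<iota> l))\<^sup>2))"
    unfolding char_mu[OF m] std_normal_iexp of_real_mult[symmetric] exp_add[symmetric] nm r_def
    by (simp add: field_simps power_mult_distrib)
  finally show "(CLINT z|?P. iexp (l (?X z))) = complex_of_real (exp (- (1/2)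
      * (norm (riesz_rep \<iota> l))\<^sup>2))" .
qed

lemma nn_integral_line:
  assumes l0: "l0 \<in> dual" "norm (riesz_rep \<iota> l0) = 1" and ab: "\<alpha>\<^sup>2 + \<beta>\<^sup>2 = (1::real)"
    and F [measurable]: "F \<in> borel_measurable borel"
  shows "(\<integral>\<^sup>+ w. F w \<partial>\<mu>) = (\<integral>\<^sup>+ w. \<integral>\<^sup>+ x. F (w + ((\<alpha> - 1) * l0 w
      + \<beta> * x) *\<^sub>R \<iota> (riesz_rep \<iota> l0)) \<partial>std_normal_distribution \<partial>\<mu>)"
proof -
  interpret S: prob_space std_normal_distribution by (rule std_normal_prob)
  interpret P: pair_prob_space \<mu> std_normal_distribution ..
  note [measurable] = dual_measurable[OF l0(1)]
  have "(\<integral>\<^sup>+ w. F w \<partial>\<mu>) = (\<integral>\<^sup>+ w. F w \<partial>distr (\<mu> \<Otimes>\<^sub>M std_normal_distribution) borel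
    (\<lambda>z. fst z + ((\<alpha> - 1) * l0 (fst z) + \<beta> * snd z) *\<^sub>R \<iota> (riesz_rep \<iota> l0)))"
    by (simp only: line_image[OF l0 ab])
  also have "\<dots> = (\<integral>\<^sup>+ z. F (fst z + ((\<alpha> - 1) * l0 (fst z)
      + \<beta> * snd z) *\<^sub>R \<iota> (riesz_rep \<iota> l0)) \<partial>(\<mu> \<Otimes>\<^sub>M std_normal_distribution))"
    by (rule nn_integral_distr) measurable
  also have "\<dots> = (\<integral>\<^sup>+ w. \<integral>\<^sup>+ x. F (w + ((\<alpha> - 1) * l0 w
      + \<beta> * x) *\<^sub>R \<iota> (riesz_rep \<iota> l0)) \<partial>std_normal_distribution \<partial>\<mu>)"
    by (subst S.nn_integral_fst[symmetric]) auto
  finally show ?thesis .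
qed

text \<open>
Disintegrate along the direction of \<open>l0\<close>; the normal density is positive, so its null sets are
those of Lebesgue measure.
\<close>
lemma AE_line:
  assumes l0: "l0 \<in> dual" "norm (riesz_rep \<iota> l0) = 1"
    and P [measurable]: "Measurable.pred borel P"
  shows "(AE w in \<mu>. P w) \<longleftrightarrow> (AE w in \<mu>. AE x in lborel. P (w + (x - l0 w) *\<^sub>R \<iota> (riesz_rep \<iota> l0)))"
proof -
  interpret S: prob_space std_normal_distribution by (rule std_normal_prob)
  note [measurable] = dual_measurable[OF l0(1)]
  have ac: "(AE x in std_normal_distribution. Q x) \<longleftrightarrow> (AE x in lborel. Q x)" for Q :: "real \<Rightarrow> bool"
    by (subst AE_density) (auto simp: normal_density_pos)
  have "(AE w in \<mu>. P w) \<longleftrightarrow> (\<integral>\<^sup>+ w. indicator {w. \<not> P w} w \<partial>\<mu>) = 0"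
    by (subst nn_integral_0_iff_AE) (auto simp: indicator_def)
  also have "(\<integral>\<^sup>+ w. indicator {w. \<not> P w} w \<partial>\<mu>)
      = (\<integral>\<^sup>+ w. \<integral>\<^sup>+ x. indicator {w. \<not> P w} (w + ((0 - 1) * l0 w
          + 1 * x) *\<^sub>R \<iota> (riesz_rep \<iota> l0)) \<partial>std_normal_distribution \<partial>\<mu>)"
    by (rule nn_integral_line[OF l0]) auto
  also have "\<dots> = (\<integral>\<^sup>+ w. \<integral>\<^sup>+ x. indicator {w. \<not> P w} (w
      + (x - l0 w) *\<^sub>R \<iota> (riesz_rep \<iota> l0)) \<partial>std_normal_distribution \<partial>\<mu>)"
    by simp
  also have "\<dots> = 0 \<longleftrightarrow> (AE w in \<mu>. (\<integral>\<^sup>+ x. indicator {w. \<not> P w} (w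
      + (x - l0 w) *\<^sub>R \<iota> (riesz_rep \<iota> l0)) \<partial>std_normal_distribution) = 0)"
    by (rule nn_integral_0_iff_AE) measurable
  also have "\<dots> \<longleftrightarrow> (AE w in \<mu>. AE x in std_normal_distribution. P (w
      + (x - l0 w) *\<^sub>R \<iota> (riesz_rep \<iota> l0)))"
  proof (intro AE_cong)
    fix w
    show "(\<integral>\<^sup>+ x. indicator {w. \<not> P w} (w + (x - l0 w) *\<^sub>R \<iota>
        (riesz_rep \<iota> l0)) \<partial>std_normal_distribution) = 0
      \<longleftrightarrow> (AE x in std_normal_distribution. P (w + (x - l0 w) *\<^sub>R \<iota> (riesz_rep \<iota> l0)))"
      by (subst nn_integral_0_iff_AE) (auto simp: indicator_def)
  qed
  finally show ?thesis by (simp add: ac)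
qed

end

section \<open>Quasi-invariance under the Cameron--Martin space\<close>

lemma AE_affine:
  fixes P :: "real \<Rightarrow> bool"
  assumes "\<beta> \<noteq> 0" "AE x in lborel. P x" shows "AE x in lborel. P (c + \<beta> * x)"
proof -
  obtain N where N: "{x \<in> space lborel. \<not> P x} \<subseteq> N" "emeasure lborel N = 0" "N \<in> sets lborel"
    using assms(2) by (rule AE_E)
  then have [measurable]: "N \<in> sets borel" by simp
  have "AE x in lborel. x \<notin> N" using N by (intro AE_not_in) auto
  then have "AE x in lborel. c + \<beta> * x \<notin> N" using assms(1) by (intro AE_borel_affine) auto
  then show ?thesis by eventually_elim (use N(1) in auto)
qed

text \<open>
A bound for the change of \<open>\<gamma> B\<close> when \<open>B\<close> is translated by \<open>c\<close>, uniform in \<open>B\<close>, where \<open>\<gamma>\<close> is the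
standard normal law.
\<close>
definition gauss_shift_bound :: "real \<Rightarrow> real" where
  "gauss_shift_bound c = (LINT x|std_normal_distribution. \<bar>c\<bar> * \<bar>x\<bar> + c\<^sup>2 / 2)"

lemma gauss_shift_bound_eq:
  "integrable std_normal_distribution (\<lambda>x. \<bar>c\<bar> * \<bar>x\<bar> + c\<^sup>2 / 2)"
  "gauss_shift_bound c = \<bar>c\<bar> * (LINT x|std_normal_distribution. \<bar>x\<bar>) + c\<^sup>2 / 2"
proof -
  interpret S: prob_space std_normal_distribution by (rule std_normal_prob)
  have i: "integrable std_normal_distribution (\<lambda>x. \<bar>x\<bar>)"
    using integrable_std_normal_distribution_moment[of 1] by simp
  then show "integrable std_normal_distribution (\<lambda>x. \<bar>c\<bar> * \<bar>x\<bar> + c\<^sup>2 / 2)" by simp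
  show "gauss_shift_bound c = \<bar>c\<bar> * (LINT x|std_normal_distribution. \<bar>x\<bar>) + c\<^sup>2 / 2"
    unfolding gauss_shift_bound_def using i S.prob_space by simp
qed

lemma gauss_shift_bound_tendsto: "((\<lambda>c. gauss_shift_bound c) \<longlongrightarrow> 0) (at 0)"
proof -
  have "((\<lambda>c. \<bar>c\<bar> * (LINT x|std_normal_distribution. \<bar>x\<bar>)
      + c\<^sup>2 / 2) \<longlongrightarrow> \<bar>0\<bar> * (LINT x|std_normal_distribution. \<bar>x\<bar>) + 0\<^sup>2 / 2) (at 0)"
    by (intro tendsto_intros) auto
  then show ?thesis by (simp add: gauss_shift_bound_eq(2))
qed

text \<open>
From \<open>exp z \<ge> 1 + z\<close> the density satisfies \<open>\<phi>(x) \<le> \<phi>(x+c) + \<phi>(x) (|c||x| + c\<^sup>2/2)\<close>.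
\<close>
lemma std_normal_shift_le:
  assumes B [measurable]: "B \<in> sets borel"
  shows "(\<integral>\<^sup>+ x. indicator B (x + c) \<partial>std_normal_distribution)
    \<le> (\<integral>\<^sup>+ x. indicator B x \<partial>std_normal_distribution) + ennreal (gauss_shift_bound c)"
proof -
  let ?f = std_normal_density
  have key: "?f x \<le> ?f (x + c) + ?f x * (\<bar>c\<bar> * \<bar>x\<bar> + c\<^sup>2 / 2)" for x
  proof -
    have "?f (x + c) = ?f x * exp (- (c * x + c\<^sup>2 / 2))"
      by (simp add: std_normal_density_def exp_add[symmetric] power2_eq_square field_simps)
    moreover have "1 - (\<bar>c\<bar> * \<bar>x\<bar> + c\<^sup>2 / 2) \<le> exp (- (c * x + c\<^sup>2 / 2))"
      using exp_ge_add_one_self[of "- (c * x + c\<^sup>2 / 2)"] abs_ge_self[of "c * x"] unfolding abs_mult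
          by linarith
    then have "?f x * (1 - (\<bar>c\<bar> * \<bar>x\<bar> + c\<^sup>2 / 2)) \<le> ?f x * exp (- (c * x + c\<^sup>2 / 2))"
      by (intro mult_left_mono) auto
    ultimately show ?thesis by (simp add: algebra_simps)
  qed
  have "(\<integral>\<^sup>+ x. indicator B (x + c) \<partial>std_normal_distribution)
      = (\<integral>\<^sup>+ x. ennreal (?f x) * indicator B (x + c) \<partial>lborel)"
    by (subst nn_integral_density) auto
  also have "\<dots> \<le> (\<integral>\<^sup>+ x. ennreal (?f (x + c)) * indicator B (x + c)
      + ennreal (?f x) * ennreal (\<bar>c\<bar> * \<bar>x\<bar> + c\<^sup>2 / 2) \<partial>lborel)"
  proof (intro nn_integral_mono)
    fix x
    have "ennreal (?f x) \<le> ennreal (?f (x + c)) + ennreal (?f x) * ennreal (\<bar>c\<bar> * \<bar>x\<bar> + c\<^sup>2 / 2)"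
      using key[of x] by (simp add: ennreal_mult[symmetric] ennreal_plus[symmetric] del:
          ennreal_plus)
    then show "ennreal (?f x) * indicator B (x + c)
        \<le> ennreal (?f (x + c)) * indicator B (x + c) + ennreal (?f x) * ennreal (\<bar>c\<bar> * \<bar>x\<bar>
            + c\<^sup>2 / 2)"
      by (auto split: split_indicator)
  qed
  also have "\<dots> = (\<integral>\<^sup>+ x. ennreal (?f (x + c)) * indicator B (x + c) \<partial>lborel)
      + (\<integral>\<^sup>+ x. ennreal (?f x) * ennreal (\<bar>c\<bar> * \<bar>x\<bar> + c\<^sup>2 / 2) \<partial>lborel)"
    by (rule nn_integral_add) auto
  also have "(\<integral>\<^sup>+ x. ennreal (?f (x + c)) * indicator B (x + c) \<partial>lborel)
      = (\<integral>\<^sup>+ x. indicator B x \<partial>std_normal_distribution)"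
  proof -
    have "(\<integral>\<^sup>+ x. ennreal (?f x) * indicator B x \<partial>lborel)
        = (\<integral>\<^sup>+ x. ennreal (?f (c + x)) * indicator B (c + x) \<partial>lborel)"
      using nn_integral_real_affine[where c=1 and t=c and f="\<lambda>x. ennreal (?f x) * indicator B x"]
          by simp
    then show ?thesis by (subst nn_integral_density) (auto simp: add.commute)
  qed
  also have "(\<integral>\<^sup>+ x. ennreal (?f x) * ennreal (\<bar>c\<bar> * \<bar>x\<bar> + c\<^sup>2 / 2) \<partial>lborel)
      = ennreal (gauss_shift_bound c)"
  proof -
    have "(\<integral>\<^sup>+ x. ennreal (?f x) * ennreal (\<bar>c\<bar> * \<bar>x\<bar> + c\<^sup>2 / 2) \<partial>lborel)
        = (\<integral>\<^sup>+ x. ennreal (\<bar>c\<bar> * \<bar>x\<bar> + c\<^sup>2 / 2) \<partial>std_normal_distribution)"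
      by (subst nn_integral_density) auto
    also have "\<dots> = ennreal (gauss_shift_bound c)"
      unfolding gauss_shift_bound_def
      by (intro nn_integral_eq_integral gauss_shift_bound_eq) auto
    finally show ?thesis .
  qed
  finally show ?thesis .
qed

context abstract_wiener_space
begin

lemma dual_shift_unit:
  assumes l: "l \<in> dual"
  obtains l0 c where "l0 \<in> dual" "norm (riesz_rep \<iota> l0) = 1" "riesz_rep \<iota> l = c *\<^sub>R riesz_rep \<iota> l0"
    "\<bar>c\<bar> = norm (riesz_rep \<iota> l)" | "riesz_rep \<iota> l = 0"
proof (cases "riesz_rep \<iota> l = 0")
  case False
  define n where "n = norm (riesz_rep \<iota> l)"
  have n: "0 < n" using False by (simp add: n_def)
  define l0 where "l0 = (\<lambda>w. (1/n) * l w)"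
  have r: "riesz_rep \<iota> l0 = (1/n) *\<^sub>R riesz_rep \<iota> l"
    by (rule riesz_unique) (simp add: l0_def riesz_inner[OF l])
  have "l0 \<in> dual" unfolding l0_def by (rule dual_scale[OF l])
  then show thesis
    by (rule that(1)[of l0 n]) (use n in \<open>auto simp: r n_def[symmetric]\<close>)
qed (use that in auto)

lemma quasi_invariant_dual:
  assumes l: "l \<in> dual" and ae: "AE w in \<mu>. P w" and P [measurable]: "Measurable.pred borel P"
  shows "AE w in \<mu>. P (w + \<iota> (riesz_rep \<iota> l))"
  using l
proof (cases rule: dual_shift_unit)
  case (1 l0 c)
  let ?f = "\<iota> (riesz_rep \<iota> l0)"
  have "AE w in \<mu>. AE x in lborel. P (w + (x - l0 w) *\<^sub>R ?f)"
    using ae AE_line[OF 1(1,2) P] by blast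
  then have "AE w in \<mu>. AE x in lborel. P (w + (x - l0 w) *\<^sub>R ?f + c *\<^sub>R ?f)"
  proof eventually_elim
    case (elim w)
    from AE_affine[OF _ this, of 1 c] show ?case by (simp add: algebra_simps)
  qed
  then have "AE w in \<mu>. P (w + c *\<^sub>R ?f)"
    by (subst AE_line[OF 1(1,2)]) auto
  then show ?thesis by (simp add: 1(3) linear_cmul[OF linear_inj])
qed (use ae in \<open>simp add: linear_0[OF linear_inj]\<close>)

lemma shift_dual_le:
  assumes l: "l \<in> dual" and A [measurable]: "A \<in> sets borel"
  shows "(\<integral>\<^sup>+ w. indicator A (w + \<iota> (riesz_rep \<iota> l)) \<partial>\<mu>)
    \<le> (\<integral>\<^sup>+ w. indicator A w \<partial>\<mu>) + ennreal (gauss_shift_bound (norm (riesz_rep \<iota> l)))"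
  using l
proof (cases rule: dual_shift_unit)
  case (1 l0 c)
  let ?f = "\<iota> (riesz_rep \<iota> l0)"
  note [measurable] = dual_measurable[OF 1(1)]
  have gb: "gauss_shift_bound c = gauss_shift_bound (norm (riesz_rep \<iota> l))"
    unfolding 1(4)[symmetric] gauss_shift_bound_def by simp
  have "(\<integral>\<^sup>+ w. indicator A (w + c *\<^sub>R ?f) \<partial>\<mu>)
      = (\<integral>\<^sup>+ w. \<integral>\<^sup>+ x. indicator A (w + ((0 - 1) * l0 w + 1 * x) *\<^sub>R ?f
          + c *\<^sub>R ?f) \<partial>std_normal_distribution \<partial>\<mu>)"
    by (rule nn_integral_line[OF 1(1,2)]) auto
  also have "\<dots> \<le> (\<integral>\<^sup>+ w. (\<integral>\<^sup>+ x. indicator A (w + ((0 - 1) * l0 w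
      + 1 * x) *\<^sub>R ?f) \<partial>std_normal_distribution) + ennreal (gauss_shift_bound c) \<partial>\<mu>)"
  proof (intro nn_integral_mono)
    fix w
    let ?B = "{x. w + ((0 - 1) * l0 w + 1 * x) *\<^sub>R ?f \<in> A}"
    have "?B \<in> sets borel" by measurable
    from std_normal_shift_le[OF this, of c]
    show "(\<integral>\<^sup>+ x. indicator A (w + ((0 - 1) * l0 w + 1 * x) *\<^sub>R ?f
        + c *\<^sub>R ?f) \<partial>std_normal_distribution)
      \<le> (\<integral>\<^sup>+ x. indicator A (w + ((0 - 1) * l0 w + 1 * x) *\<^sub>R ?f) \<partial>std_normal_distribution)
          + ennreal (gauss_shift_bound c)"
      by (simp add: indicator_def algebra_simps)
  qed
  also have "\<dots> = (\<integral>\<^sup>+ w. \<integral>\<^sup>+ x. indicator A (w + ((0 - 1) * l0 w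
      + 1 * x) *\<^sub>R ?f) \<partial>std_normal_distribution \<partial>\<mu>) + ennreal (gauss_shift_bound c)"
  proof -
    interpret S: prob_space std_normal_distribution by (rule std_normal_prob)
    show ?thesis by (subst nn_integral_add) (auto simp: emeasure_space_1[simplified])
  qed
  also have "(\<integral>\<^sup>+ w. \<integral>\<^sup>+ x. indicator A (w + ((0 - 1) * l0 w
      + 1 * x) *\<^sub>R ?f) \<partial>std_normal_distribution \<partial>\<mu>) = (\<integral>\<^sup>+ w. indicator A w \<partial>\<mu>)"
    by (rule nn_integral_line[OF 1(1,2), symmetric]) auto
  finally show ?thesis by (simp add: 1(3) linear_cmul[OF linear_inj] gb)
qed (simp add: linear_0[OF linear_inj])

text \<open>
A general element of \<open>H\<close> has no disintegration as in \<open>line_image\<close>, so it is approximated by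
representatives \<open>H n\<close> of dual functionals. The bound of \<open>shift_dual_le\<close> depends only on the
distance of two shifts, so a single open set \<open>U\<close> around the null set has small measure under
all shifts \<open>H n\<close> with \<open>n \<ge> n0\<close>, and Fatou's lemma carries this to the limit.
\<close>
lemma shift_null_set:
  assumes dense: "closure (riesz_rep \<iota> ` dual) = UNIV" and N: "N \<in> null_sets \<mu>"
  shows "(\<integral>\<^sup>+ w. indicator N (w + \<iota> h) \<partial>\<mu>) = 0"
proof -
  have NB [measurable]: "N \<in> sets borel" using N by (auto simp: null_sets_def sets_mu)
  have "(\<integral>\<^sup>+ w. indicator N (w + \<iota> h) \<partial>\<mu>) \<le> 0 + ennreal \<epsilon>" if e: "0 < \<epsilon>" for \<epsilon>
  proof -
    have "\<forall>\<^sub>F c in at 0. dist (gauss_shift_bound c) 0 < \<epsilon>/2"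
      using gauss_shift_bound_tendsto e by (intro tendstoD) auto
    then obtain d where d: "0 < d" "\<And>c. c \<noteq> 0 \<Longrightarrow> dist c 0 < d \<Longrightarrow> \<bar>gauss_shift_bound c\<bar> < \<epsilon>/2"
      unfolding eventually_at by auto
    have gb: "gauss_shift_bound c \<le> \<epsilon>/2" if "\<bar>c\<bar> < d" for c
      using d(2)[of c] that e by (cases "c = 0") (auto simp: gauss_shift_bound_eq(2))
    have "h \<in> closure (riesz_rep \<iota> ` dual)" using dense by simp
    then obtain H where H: "\<And>n. H n \<in> riesz_rep \<iota> ` dual" "H \<longlonglongrightarrow> h"
      unfolding closure_sequential by auto
    then obtain L where L: "\<And>n. L n \<in> dual" "\<And>n. H n = riesz_rep \<iota> (L n)"
      by (simp add: image_iff) metis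
    have "\<forall>\<^sub>F n in sequentially. dist (H n) h < d/2" using H(2) d(1) by (intro tendstoD) auto
    then obtain n0 where n0: "\<And>n. n0 \<le> n \<Longrightarrow> dist (H n) h < d/2"
        by (auto simp: eventually_sequentially)
    define \<nu> where "\<nu> = distr \<mu> borel (\<lambda>w. w + \<iota> (H n0))"
    have "AE w in \<mu>. w \<notin> N" using N by (rule AE_not_in)
    then have "AE w in \<mu>. w + \<iota> (H n0) \<notin> N"
      unfolding L(2) by (intro quasi_invariant_dual[OF L(1)]) auto
    then have "AE w in \<nu>. w \<notin> N" unfolding \<nu>_def by (subst AE_distr_iff) auto
    then have "emeasure \<nu> N = 0"
      by (subst AE_iff_measurable[symmetric, where P="\<lambda>w. w \<notin> N"]) (auto simp: \<nu>_def)
    moreover have "emeasure \<nu> N = (INF U\<in>{U. N \<subseteq> U \<and> open U}. emeasure \<nu> U)"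
    proof (rule outer_regular)
      have "finite_measure \<nu>" unfolding \<nu>_def by (rule finite_measure_distr) measurable
      then show "emeasure \<nu> (space \<nu>) \<noteq> \<infinity>" using finite_measure.emeasure_finite by auto
    qed (auto simp: \<nu>_def)
    ultimately have "(INF U\<in>{U. N \<subseteq> U \<and> open U}. emeasure \<nu> U) < ennreal (\<epsilon>/2)" using e by simp
    then obtain U where U: "N \<subseteq> U" "open U" "emeasure \<nu> U < ennreal (\<epsilon>/2)"
      unfolding INF_less_iff by auto
    have [measurable]: "U \<in> sets borel" using U by auto
    have \<nu>U: "emeasure \<nu> U = (\<integral>\<^sup>+ w. indicator U (w + \<iota> (H n0)) \<partial>\<mu>)"
    proof -
      have "emeasure \<nu> U = (\<integral>\<^sup>+ w. indicator U w \<partial>\<nu>)" by (simp add: \<nu>_def)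
      also have "\<dots> = (\<integral>\<^sup>+ w. indicator U (w + \<iota> (H n0)) \<partial>\<mu>)"
        unfolding \<nu>_def by (rule nn_integral_distr) measurable
      finally show ?thesis .
    qed
    have bnd: "(\<integral>\<^sup>+ w. indicator U (w + \<iota> (H n)) \<partial>\<mu>) \<le> ennreal \<epsilon>" if n: "n0 \<le> n" for n
    proof -
      define m where "m w = L n w - L n0 w" for w
      have m: "m \<in> dual" unfolding m_def by (intro dual_diff L)
      have rm: "riesz_rep \<iota> m = H n - H n0"
        by (rule riesz_unique) (simp add: m_def riesz_inner[OF L(1)] L(2) inner_diff_left)
      have "norm (H n - H n0) < d"
        using n0[OF n] n0[of n0] dist_triangle2[of "H n" "H n0" h] by (simp add: dist_norm)
      then have g: "gauss_shift_bound (norm (riesz_rep \<iota> m)) \<le> \<epsilon>/2" using gb rm by simp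
      let ?A = "{w. w + \<iota> (H n0) \<in> U}"
      have "?A \<in> sets borel" by measurable
      from shift_dual_le[OF m this] have "(\<integral>\<^sup>+ w. indicator ?A (w + \<iota> (H n - H n0)) \<partial>\<mu>)
        \<le> emeasure \<nu> U + ennreal (gauss_shift_bound (norm (riesz_rep \<iota> m)))"
        unfolding rm \<nu>U by (simp add: indicator_def)
      also have "\<dots> \<le> ennreal (\<epsilon>/2) + ennreal (\<epsilon>/2)"
        using U(3) g by (intro add_mono ennreal_leI) auto
      also have "\<dots> = ennreal \<epsilon>" using e by (simp flip: ennreal_plus)
      finally show ?thesis
        by (simp add: indicator_def linear_diff[OF linear_inj])
    qed
    have "(\<integral>\<^sup>+ w. indicator N (w + \<iota> h) \<partial>\<mu>) \<le> (\<integral>\<^sup>+ w. liminf (\<lambda>n. indicator U (w + \<iota> (H n))) \<partial>\<mu>)"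
    proof (intro nn_integral_mono)
      fix w
      show "indicator N (w + \<iota> h) \<le> (liminf (\<lambda>n. indicator U (w + \<iota> (H n))) :: ennreal)"
      proof (cases "w + \<iota> h \<in> N")
        case True
        have "isCont \<iota> h" using continuous_inj by (simp add: continuous_on_eq_continuous_at)
        then have "(\<lambda>n. w + \<iota> (H n)) \<longlonglongrightarrow> w + \<iota> h"
          by (intro tendsto_intros isCont_tendsto_compose[OF _ H(2)])
        then have "\<forall>\<^sub>F n in sequentially. w + \<iota> (H n) \<in> U" using U True
            by (intro topological_tendstoD) auto
        then have "\<forall>\<^sub>F n in sequentially. (1::ennreal) \<le> indicator U (w + \<iota> (H n))"
          by eventually_elim auto
        then have "1 \<le> (liminf (\<lambda>n. indicator U (w + \<iota> (H n))) :: ennreal)" by (rule Liminf_bounded)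
        then show ?thesis using True by simp
      qed simp
    qed
    also have "\<dots> \<le> liminf (\<lambda>n. \<integral>\<^sup>+ w. indicator U (w + \<iota> (H n)) \<partial>\<mu>)"
      by (rule nn_integral_liminf) measurable
    also have "\<dots> \<le> liminf (\<lambda>n. ennreal \<epsilon>)"
      using bnd by (intro Liminf_mono) (auto simp: eventually_sequentially)
    also have "\<dots> = ennreal \<epsilon>" by (simp add: Liminf_const)
    finally show ?thesis by simp
  qed
  then have "(\<integral>\<^sup>+ w. indicator N (w + \<iota> h) \<partial>\<mu>) \<le> 0" by (rule ennreal_le_epsilon)
  then show ?thesis unfolding le_zero_eq .
qed

theorem quasi_invariant:
  assumes dense: "closure (riesz_rep \<iota> ` dual) = UNIV" and ae: "AE w in \<mu>. P w"
  shows "AE w in \<mu>. P (w + \<iota> h)"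
proof -
  obtain N where N: "{w \<in> space \<mu>. \<not> P w} \<subseteq> N" "emeasure \<mu> N = 0" "N \<in> sets \<mu>"
    using ae by (rule AE_E)
  then have N: "N \<in> null_sets \<mu>" "{w. \<not> P w} \<subseteq> N" by auto
  have [measurable]: "N \<in> sets borel" using N by (auto simp: null_sets_def sets_mu)
  have "AE w in \<mu>. indicator N (w + \<iota> h) = (0::ennreal)"
    using shift_null_set[OF dense N(1), of h] by (subst (asm) nn_integral_0_iff_AE) auto
  then show ?thesis
  proof eventually_elim
    case (elim w)
    then show ?case using N(2) by (auto simp: indicator_eq_0_iff)
  qed
qed

end

section \<open>Powers in the extended nonnegative reals\<close>

lemma ennreal_powr_zero [simp]: "ennreal_powr x 0 = 1"
  by (simp add: ennreal_powr_def)

lemma ennreal_powr_ennreal: "0 < p \<Longrightarrow> 0 \<le> x \<Longrightarrow> ennreal_powr (ennreal x) p = ennreal (x powr p)"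
  by (simp add: ennreal_powr_def)

lemma ennreal_powr_pos_ennreal: "0 < x \<Longrightarrow> ennreal_powr (ennreal x) p = ennreal (x powr p)"
  by (simp add: ennreal_powr_def)

lemma ennreal_powr_top: "0 < p \<Longrightarrow> ennreal_powr top p = top"
  by (simp add: ennreal_powr_def)

lemma ennreal_powr_0_left: "0 < p \<Longrightarrow> ennreal_powr 0 p = 0"
  by (simp add: ennreal_powr_def)

lemma ennreal_powr_one [simp]: "ennreal_powr x 1 = x"
  by (cases x) (auto simp: ennreal_powr_def)

lemma ennreal_powr_mono:
  assumes "0 \<le> p" "x \<le> y" shows "ennreal_powr x p \<le> ennreal_powr y p"
proof (cases "p = 0")
  case False
  with assms show ?thesis
    by (cases x; cases y) (auto simp: ennreal_powr_ennreal ennreal_powr_top top_unique intro!: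
        ennreal_leI powr_mono2)
qed simp

lemma ennreal_powr_mult_pos:
  assumes "0 \<le> p" "0 < c" shows "ennreal_powr (x * ennreal c) p
      = ennreal_powr x p * ennreal (c powr p)"
proof (cases "p = 0")
  case True then show ?thesis using assms by simp
next
  case False
  with assms show ?thesis
    by (cases x) (auto simp: ennreal_powr_ennreal ennreal_powr_top ennreal_mult[symmetric] powr_mult
        ennreal_top_mult)
qed

lemma ennreal_powr_add:
  assumes "0 \<le> s" "0 \<le> t" "s + t = 1" shows "ennreal_powr x s * ennreal_powr x t = x"
proof (cases "s = 0 \<or> t = 0")
  case True then show ?thesis using assms by auto
next
  case False
  with assms have "0 < s" "0 < t" by auto
  then show ?thesis using assms(3)
    by (cases x) (auto simp: ennreal_powr_ennreal ennreal_powr_top ennreal_mult[symmetric]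
        powr_add[symmetric])
qed

text \<open>
A monotone surjection of a linear continuum is continuous.
\<close>
lemma continuous_on_ennreal_powr:
  assumes "0 \<le> p" shows "continuous_on UNIV (\<lambda>x. ennreal_powr x p)"
proof (cases "p = 0")
  case False
  with assms have p: "0 < p" by simp
  have "\<exists>x. ennreal_powr x p = y" for y
  proof (cases y)
    case (real r)
    then show ?thesis using p by (intro exI[of _ "ennreal (r powr (1/p))"])
        (auto simp: ennreal_powr_ennreal powr_powr)
  next
    case top
    then show ?thesis using p by (intro exI[of _ top]) (auto simp: ennreal_powr_top)
  qed
  then have "range (\<lambda>x. ennreal_powr x p) = UNIV" by (metis surj_def)
  then show ?thesis using assms by (intro continuous_onI_mono) (auto intro: ennreal_powr_mono)
qed simp

lemma tendsto_ennreal_powr: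
  "0 \<le> p \<Longrightarrow> (f \<longlongrightarrow> x) F \<Longrightarrow> ((\<lambda>n. ennreal_powr (f n) p) \<longlongrightarrow> ennreal_powr x p) F"
  using continuous_on_tendsto_compose[OF continuous_on_ennreal_powr, of p f x F] by auto

lemma borel_measurable_ennreal_powr [measurable (raw)]:
  assumes "f \<in> borel_measurable M" "0 \<le> p" shows "(\<lambda>x. ennreal_powr (f x) p) \<in> borel_measurable M"
  using measurable_compose[OF assms(1) borel_measurable_continuous_onI[OF
      continuous_on_ennreal_powr[OF assms(2)]]] .

lemma ennreal_powr_SUP:
  assumes p: "0 \<le> p" and u: "incseq u" shows "ennreal_powr (SUP n. u n) p
      = (SUP n. ennreal_powr (u n) p)"
proof (rule LIMSEQ_unique)
  show "(\<lambda>n. ennreal_powr (u n) p) \<longlonglongrightarrow> ennreal_powr (SUP n. u n) p"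
    using p LIMSEQ_SUP[OF u] by (rule tendsto_ennreal_powr)
  show "(\<lambda>n. ennreal_powr (u n) p) \<longlonglongrightarrow> (SUP n. ennreal_powr (u n) p)"
    using u p by (intro LIMSEQ_SUP) (auto simp: incseq_def intro: ennreal_powr_mono)
qed

text \<open>
Multiplication on the extended half-line is not continuous at \<open>0 \<cdot> \<infinity>\<close>, but it commutes with
increasing suprema.
\<close>
lemma incseq_mult_le_SUP:
  fixes u v :: "nat \<Rightarrow> ennreal"
  assumes "incseq u" "incseq v" "\<And>n. u n * v n \<le> F"
  shows "(SUP n. u n) * (SUP n. v n) \<le> F"
proof -
  have "u m * v n \<le> F" for m n
  proof -
    have "u m * v n \<le> u (max m n) * v (max m n)"
      using assms(1,2) by (intro mult_mono) (auto simp: incseq_def)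
    then show ?thesis using assms(3) order_trans by blast
  qed
  then show ?thesis
    by (simp add: SUP_mult_left_ennreal SUP_mult_right_ennreal SUP_le_iff)
qed

lemma ennreal_powr_SUP_le:
  fixes u v :: "nat \<Rightarrow> ennreal"
  assumes "0 \<le> s" "0 \<le> t" "incseq u" "incseq v" "\<And>n. ennreal_powr (u n) s * ennreal_powr (v n) t
      \<le> F"
  shows "ennreal_powr (SUP n. u n) s * ennreal_powr (SUP n. v n) t \<le> F"
  unfolding ennreal_powr_SUP[OF assms(1,3)] ennreal_powr_SUP[OF assms(2,4)]
  using assms by (intro incseq_mult_le_SUP) (auto simp: incseq_def intro: ennreal_powr_mono)

lemma ennreal_min_nat_SUP: "(SUP n. min x (ennreal (real n))) = x"
proof (rule antisym)
  show "(SUP n. min x (ennreal (real n))) \<le> x" by (intro SUP_least) simp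
  show "x \<le> (SUP n. min x (ennreal (real n)))"
  proof (cases x)
    case (real r)
    obtain n where "r \<le> real n" using real_arch_simple by blast
    then have "x = min x (ennreal (real n))" using real by (simp add: min_def ennreal_leI)
    then show ?thesis by (metis SUP_upper UNIV_I)
  next
    case top
    have "(SUP n. of_nat n) \<le> (SUP n. min x (ennreal (real n)))"
      using top by (intro SUP_mono) (auto simp: ennreal_of_nat_eq_real_of_nat)
    then show ?thesis using top by (simp add: ennreal_SUP_of_nat_eq_top)
  qed
qed

lemma incseq_min_nat: "incseq (\<lambda>n. min x (ennreal (real n)))"
  by (auto simp: incseq_def min_def intro: order_trans ennreal_leI)

section \<open>A Prekopa--Leindler inequality almost everywhere on the line\<close>

text \<open>
The infimum of the essential upper bounds is again one, as the limit of a sequence of them.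
\<close>
lemma essential_supremum:
  fixes u :: "'a \<Rightarrow> real"
  assumes bd: "\<And>x. x \<in> space M \<Longrightarrow> L \<le> u x" "\<And>x. x \<in> space M \<Longrightarrow> u x \<le> R"
    and nontrivial: "\<not> (AE x in M. False)"
  obtains \<alpha> where "L \<le> \<alpha>" "AE x in M. u x \<le> \<alpha>" "\<And>r. r < \<alpha> \<Longrightarrow> \<not> (AE x in M. u x \<le> r)"
proof -
  define S where "S = {r. AE x in M. u x \<le> r}"
  have R: "R \<in> S" using bd(2) by (auto simp: S_def)
  have low: "L \<le> r" if "r \<in> S" for r
  proof (rule ccontr)
    assume "\<not> L \<le> r"
    have "AE x in M. u x \<le> r" using that by (simp add: S_def)
    then have "AE x in M. False" using AE_space
      by eventually_elim (use bd(1) \<open>\<not> L \<le> r\<close> in fastforce)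
    then show False using nontrivial by simp
  qed
  then have bdd: "bdd_below S" by (intro bdd_belowI[of S L])
  show thesis
  proof (rule that[of "Inf S"])
    show "L \<le> Inf S" using R low by (intro cInf_greatest) auto
    have "AE x in M. u x \<le> Inf S + 1 / real (Suc n)" for n
    proof -
      have "Inf S < Inf S + 1 / real (Suc n)" by simp
      then obtain r where "r \<in> S" "r < Inf S + 1 / real (Suc n)"
        using cInf_less_iff[OF _ bdd] R by (metis empty_iff)
      then show ?thesis unfolding S_def by (auto elim: eventually_mono)
    qed
    then have "AE x in M. \<forall>n. u x \<le> Inf S + 1 / real (Suc n)" unfolding AE_all_countable by blast
    then show "AE x in M. u x \<le> Inf S"
    proof eventually_elim
      case (elim x)
      have "(\<lambda>n. Inf S + 1 / real (Suc n)) \<longlonglongrightarrow> Inf S + 0"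
        by (intro tendsto_intros LIMSEQ_Suc lim_1_over_n)
      then show ?case using elim by (intro LIMSEQ_le_const[of _ "Inf S"]) auto
    qed
    show "\<not> (AE x in M. u x \<le> r)" if "r < Inf S" for r
      using cInf_lower[OF _ bdd, of r] that by (auto simp: S_def)
  qed
qed

lemma AE_restrict_lborel:
  assumes "A \<in> sets borel"
  shows "(AE x in restrict_space lborel A. P x) \<longleftrightarrow> (AE x in lborel. x \<in> A \<longrightarrow> P x)"
  using assms by (subst AE_restrict_space_iff) auto

lemma nontrivial_restrict_lborel:
  assumes "A \<in> sets borel" "emeasure lborel A \<noteq> 0" shows "\<not> (AE x
      in restrict_space lborel A. False)"
  unfolding AE_restrict_lborel[OF assms(1)]
  using assms by (simp add: AE_iff_measurable[where N=A])

lemma emeasure_affine_preimage: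
  fixes A :: "real set"
  assumes [measurable]: "A \<in> sets borel" and s: "0 < s"
  shows "emeasure lborel {z. (z - c) / s \<in> A} = ennreal s * emeasure lborel A"
proof -
  have "emeasure lborel {z. (z - c) / s \<in> A} = (\<integral>\<^sup>+ z. indicator {z. (z - c) / s \<in> A} z \<partial>lborel)"
    by (subst nn_integral_indicator) auto
  also have "\<dots> = ennreal \<bar>s\<bar> * (\<integral>\<^sup>+ x. indicator {z. (z - c) / s \<in> A} (c + s * x) \<partial>lborel)"
    using s by (intro nn_integral_real_affine) auto
  also have "(\<integral>\<^sup>+ x. indicator {z. (z - c) / s \<in> A} (c + s * x) \<partial>lborel)
      = (\<integral>\<^sup>+ x. indicator A x \<partial>lborel)"
    using s by (intro nn_integral_cong) (simp add: indicator_def)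
  finally show ?thesis using s by simp
qed

lemma AE_affine_preimage:
  assumes "s \<noteq> 0" "AE x in lborel. P x"
  shows "AE z in lborel. P ((z - c) / s :: real)"
  using AE_affine[of "1/s" P "- c / s"] assms by (simp add: diff_divide_distrib)

text \<open>
Let \<open>\<alpha>\<close> be the essential supremum of \<open>A\<close> and \<open>\<beta>\<close> the essential infimum of \<open>B\<close>. For typical \<open>x0 \<in> A\<close>
near \<open>\<alpha>\<close> and \<open>y0 \<in> B\<close> near \<open>\<beta>\<close>, almost all of \<open>sA + t y0\<close> and of \<open>s x0 + tB\<close> lies in \<open>C\<close>. The first set
lies to the left of \<open>s\<alpha> + t y0\<close> and the second to the right of \<open>s x0 + t\<beta>\<close>, so they overlap in
an interval of length at most \<open>s\<epsilon> + t\<epsilon>\<close>.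
\<close>
lemma brunn_minkowski_AE_bounded:
  fixes A B C :: "real set"
  assumes [measurable]: "A \<in> sets borel" "B \<in> sets borel" "C \<in> sets borel"
    and pos: "emeasure lborel A \<noteq> 0" "emeasure lborel B \<noteq> 0" and st: "0 < s" "0 < t"
    and bd: "\<And>x. x \<in> A \<Longrightarrow> \<bar>x\<bar> \<le> R" "\<And>x. x \<in> B \<Longrightarrow> \<bar>x\<bar> \<le> R"
    and ae: "AE x in lborel. AE y in lborel. x \<in> A \<longrightarrow> y \<in> B \<longrightarrow> s * x + t * y \<in> C"
  shows "ennreal s * emeasure lborel A + ennreal t * emeasure lborel B \<le> emeasure lborel C"
proof (rule ennreal_le_epsilon)
  fix \<epsilon>' :: real assume "0 < \<epsilon>'"
  \<comment> \<open>Chosen so that the overlap of the two sets below has length at most \<open>s\<epsilon> + t\<epsilon> = \<epsilon>'\<close>.\<close>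
  define \<epsilon> where "\<epsilon> = \<epsilon>' / (s + t)"
  have "(s + t) * \<epsilon> = \<epsilon>'" using st by (simp add: \<epsilon>_def)
  then have e: "s * \<epsilon> + t * \<epsilon> = \<epsilon>'" by (simp only: distrib_right)
  have e: "0 < \<epsilon>" "s * \<epsilon> + t * \<epsilon> = \<epsilon>'" using \<open>0 < \<epsilon>'\<close> st e by (simp_all add: \<epsilon>_def)
  obtain \<alpha> where al: "AE x in lborel. x \<in> A \<longrightarrow> x \<le> \<alpha>" "\<not> (AE x in lborel. x \<in> A \<longrightarrow> x \<le> \<alpha> - \<epsilon>)"
  proof (rule essential_supremum[OF _ _ nontrivial_restrict_lborel[OF assms(1) pos(1)], of "- R"
      "\<lambda>x. x" R])
    fix \<alpha> assume "AE x in restrict_space lborel A. x \<le> \<alpha>"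
      "\<And>r. r < \<alpha> \<Longrightarrow> \<not> (AE x in restrict_space lborel A. x \<le> r)"
    then show thesis using that[of \<alpha>] e(1) unfolding AE_restrict_lborel[OF assms(1)] by auto
  qed (use bd(1) in \<open>force simp: space_restrict_space abs_le_iff\<close>)+
  obtain \<beta> where be: "AE y in lborel. y \<in> B \<longrightarrow> - \<beta> \<ge> - y" "\<not> (AE y in lborel. y \<in> B \<longrightarrow> - y \<le> - \<beta> - \<epsilon>)"
  proof (rule essential_supremum[OF _ _ nontrivial_restrict_lborel[OF assms(2) pos(2)], of "- R"
      uminus R])
    fix \<beta> assume "AE x in restrict_space lborel B. - x \<le> \<beta>"
      "\<And>r. r < \<beta> \<Longrightarrow> \<not> (AE x in restrict_space lborel B. - x \<le> r)"
    then show thesis using that[of "- \<beta>"] e(1) unfolding AE_restrict_lborel[OF assms(2)] by auto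
  qed (use bd(2) in \<open>force simp: space_restrict_space abs_le_iff\<close>)+
  have ae': "AE y in lborel. AE x in lborel. x \<in> A \<longrightarrow> y \<in> B \<longrightarrow> s * x + t * y \<in> C"
    by (rule lborel_pair.AE_commute[THEN iffD1, OF _ ae]) measurable
  obtain x0 where x0: "x0 \<in> A" "\<alpha> - \<epsilon> < x0" "AE y in lborel. y \<in> B \<longrightarrow> s * x0 + t * y \<in> C"
  proof (rule ccontr)
    assume "\<not> thesis"
    then have no: "\<not> (x \<in> A \<and> \<alpha> - \<epsilon> < x \<and> (AE y in lborel. y \<in> B \<longrightarrow> s * x + t * y \<in> C))" for x
      using that by blast
    from ae have "AE x in lborel. x \<in> A \<longrightarrow> x \<le> \<alpha> - \<epsilon>"
    proof eventually_elim
      case (elim x) then show ?case using no[of x] by (cases "x \<in> A") auto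
    qed
    then show False using al(2) by simp
  qed
  obtain y0 where y0: "y0 \<in> B" "y0 < \<beta> + \<epsilon>" "AE x in lborel. x \<in> A \<longrightarrow> s * x + t * y0 \<in> C"
  proof (rule ccontr)
    assume "\<not> thesis"
    then have no: "\<not> (y \<in> B \<and> y < \<beta> + \<epsilon> \<and> (AE x in lborel. x \<in> A \<longrightarrow> s * x + t * y \<in> C))" for y
      using that by blast
    from ae' have "AE y in lborel. y \<in> B \<longrightarrow> - y \<le> - \<beta> - \<epsilon>"
    proof eventually_elim
      case (elim y) then show ?case using no[of y] by (cases "y \<in> B") auto
    qed
    then show False using be(2) by simp
  qed
  define A' where "A' = {z. (z - t * y0) / s \<in> A}"
  define B'' where "B'' = {z. (z - s * x0) / t \<in> B}"
  have [measurable]: "A' \<in> sets borel" "B'' \<in> sets borel" unfolding A'_def B''_def by measurable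
  have 1: "AE z in lborel. z \<in> A' \<longrightarrow> z \<in> C \<and> z \<le> s * \<alpha> + t * y0"
  proof -
    have "AE x in lborel. x \<in> A \<longrightarrow> s * x + t * y0 \<in> C \<and> x \<le> \<alpha>" using y0(3) al(1)
        by eventually_elim auto
    then have "AE z in lborel. (z - t * y0) / s \<in> A
        \<longrightarrow> s * ((z - t * y0) / s) + t * y0 \<in> C \<and> (z - t * y0) / s \<le> \<alpha>"
      using st by (intro AE_affine_preimage) auto
    then show ?thesis by eventually_elim (use st in \<open>auto simp: A'_def field_simps\<close>)
  qed
  have 2: "AE z in lborel. z \<in> B'' \<longrightarrow> z \<in> C \<and> s * x0 + t * \<beta> \<le> z"
  proof -
    have "AE x in lborel. x \<in> B \<longrightarrow> s * x0 + t * x \<in> C \<and> \<beta> \<le> x" using x0(3) be(1)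
        by eventually_elim auto
    then have "AE z in lborel. (z - s * x0) / t \<in> B
        \<longrightarrow> s * x0 + t * ((z - s * x0) / t) \<in> C \<and> \<beta> \<le> (z - s * x0) / t"
      using st by (intro AE_affine_preimage) auto
    then show ?thesis by eventually_elim (use st in \<open>auto simp: B''_def field_simps\<close>)
  qed
  have "ennreal s * emeasure lborel A + ennreal t * emeasure lborel B
      = emeasure lborel A' + emeasure lborel B''"
    unfolding A'_def B''_def using st by (simp add: emeasure_affine_preimage)
  also have "\<dots> = emeasure lborel (A' \<union> B'') + emeasure lborel (A' \<inter> B'')"
    by (rule emeasure_Un_Int) auto
  also have "\<dots> \<le> emeasure lborel C + emeasure lborel {s * x0 + t * \<beta> .. s * \<alpha> + t * y0}"
    using 1 2 by (intro add_mono emeasure_mono_AE) (auto elim: eventually_elim2)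
  also have "emeasure lborel {s * x0 + t * \<beta> .. s * \<alpha> + t * y0} \<le> ennreal \<epsilon>'"
  proof -
    have "s * \<alpha> + t * y0 - (s * x0 + t * \<beta>) = s * (\<alpha> - x0) + t * (y0 - \<beta>)"
        by (simp add: algebra_simps)
    also have "\<dots> \<le> s * \<epsilon> + t * \<epsilon>" using x0(2) y0(2) st by (intro add_mono mult_left_mono) auto
    finally show ?thesis using e \<open>0 < \<epsilon>'\<close>
      by (cases "s * x0 + t * \<beta> \<le> s * \<alpha> + t * y0") (auto intro: ennreal_leI)
  qed
  finally show "ennreal s * emeasure lborel A + ennreal t * emeasure lborel B
      \<le> emeasure lborel C + ennreal \<epsilon>'"
    by (meson add_left_mono order_trans)
qed

lemma brunn_minkowski_AE:
  fixes A B C :: "real set"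
  assumes [measurable]: "A \<in> sets borel" "B \<in> sets borel" "C \<in> sets borel"
    and pos: "emeasure lborel A \<noteq> 0" "emeasure lborel B \<noteq> 0" and st: "0 < s" "0 < t"
    and ae: "AE x in lborel. AE y in lborel. x \<in> A \<longrightarrow> y \<in> B \<longrightarrow> s * x + t * y \<in> C"
  shows "ennreal s * emeasure lborel A + ennreal t * emeasure lborel B \<le> emeasure lborel C"
proof -
  define J where "J n = {- real n .. real n}" for n
  have lim: "(\<lambda>n. emeasure lborel (S \<inter> J n)) \<longlonglongrightarrow> emeasure lborel S" if [measurable]: "S \<in> sets borel"
      for S
  proof -
    have "(\<lambda>n. emeasure lborel (S \<inter> J n)) \<longlonglongrightarrow> emeasure lborel (\<Union>n. S \<inter> J n)"
      by (rule Lim_emeasure_incseq) (auto simp: J_def incseq_def)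
    moreover have "(\<Union>n. S \<inter> J n) = S"
    proof -
      have "\<exists>n. x \<in> J n" for x
      proof -
        obtain n where "\<bar>x\<bar> \<le> real n" using real_arch_simple by blast
        then have "x \<in> J n" by (auto simp: J_def)
        then show ?thesis ..
      qed
      then show ?thesis by auto
    qed
    ultimately show ?thesis by simp
  qed
  have evpos: "\<forall>\<^sub>F n in sequentially. emeasure lborel (S \<inter> J n) \<noteq> 0" if "S \<in> sets borel"
      "emeasure lborel S \<noteq> 0" for S
    using order_tendstoD(1)[OF lim[OF that(1)], of 0] that(2) by (auto simp: zero_less_iff_neq_zero)
  have "\<forall>\<^sub>F n in sequentially. ennreal s * emeasure lborel (A \<inter> J n)
      + ennreal t * emeasure lborel (B \<inter> J n) \<le> emeasure lborel C"
    using evpos[OF assms(1) pos(1)] evpos[OF assms(2) pos(2)]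
  proof eventually_elim
    case (elim n)
    show ?case
    proof (rule brunn_minkowski_AE_bounded[where R="real n"])
      show "AE x in lborel. AE y in lborel. x \<in> A \<inter> J n \<longrightarrow> y \<in> B \<inter> J n \<longrightarrow> s * x + t * y \<in> C"
        using ae by (auto elim!: eventually_mono)
    qed (use elim st in \<open>auto simp: J_def abs_le_iff\<close>)
  qed
  moreover have "(\<lambda>n. ennreal s * emeasure lborel (A \<inter> J n) + ennreal t * emeasure lborel (B \<inter> J n))
      \<longlonglongrightarrow> ennreal s * emeasure lborel A + ennreal t * emeasure lborel B"
    by (intro tendsto_add ennreal_tendsto_cmult lim) auto
  ultimately show ?thesis by (intro tendsto_upperbound) auto
qed

lemma nn_integral_level_indicator:
  assumes M: "0 < M"
  shows "ennreal M * (\<integral>\<^sup>+ r. indicator {r. 0 < r \<and> r < 1 \<and> ennreal (r * M)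
      \<le> v} r \<partial>lborel) = min v (ennreal M)"
proof (cases "ennreal M \<le> v")
  case True
  have "r * M \<le> M" if "r < 1" for r using that M by simp
  then have "{r. 0 < r \<and> r < 1 \<and> ennreal (r * M) \<le> v} = {0<..<1}"
    using order_trans[OF ennreal_leI True] by auto
  then show ?thesis using True by (simp add: min_def)
next
  case False
  then obtain u where u: "v = ennreal u" "0 \<le> u" by (cases v) auto
  with False M have "u < M" by (simp add: not_le ennreal_less_iff)
  have "r < 1" if "r * M \<le> u" for r
  proof -
    have "r * M < 1 * M" using that \<open>u < M\<close> by simp
    then show ?thesis using M by (simp only: mult_less_cancel_right_pos)
  qed
  then have "{r. 0 < r \<and> r < 1 \<and> ennreal (r * M) \<le> v} = {0<..u/M}"
    using M u by (auto simp: pos_le_divide_eq)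
  then have "ennreal M * (\<integral>\<^sup>+ r. indicator {r. 0 < r \<and> r < 1 \<and> ennreal (r * M)
      \<le> v} r \<partial>lborel) = ennreal M * ennreal (u / M)"
    using M u by simp
  also have "\<dots> = min v (ennreal M)" using M u False
      by (simp add: ennreal_mult[symmetric] min_absorb1)
  finally show ?thesis .
qed

text \<open>
The layer-cake formula up to height \<open>M\<close>.
\<close>
lemma nn_integral_level_sets:
  assumes [measurable]: "g \<in> borel_measurable borel" and M: "0 < M"
  shows "ennreal M * (\<integral>\<^sup>+ r. indicator {0<..<1} r * emeasure lborel {x. ennreal (r * M)
      \<le> g x} \<partial>lborel)
    = (\<integral>\<^sup>+ x. min (g x) (ennreal M) \<partial>lborel)"
proof -
  let ?I = "\<lambda>r x. indicator {r. 0 < r \<and> r < 1 \<and> ennreal (r * M) \<le> g x} r :: ennreal"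
  have I: "(\<lambda>(r, x). ?I r x) = indicator {z. 0 < fst z \<and> fst z < 1 \<and> ennreal (fst z * M)
      \<le> g (snd z)}"
    by (auto simp: indicator_def)
  have [measurable]: "(\<lambda>(r, x). ?I r x) \<in> borel_measurable (lborel \<Otimes>\<^sub>M lborel)" unfolding I
      by measurable
  have "(\<integral>\<^sup>+ r. indicator {0<..<1} r * emeasure lborel {x. ennreal (r * M) \<le> g x} \<partial>lborel)
      = (\<integral>\<^sup>+ r. \<integral>\<^sup>+ x. ?I r x \<partial>lborel \<partial>lborel)"
  proof (intro nn_integral_cong)
    fix r :: real
    have "(\<integral>\<^sup>+ x. ?I r x \<partial>lborel) = (\<integral>\<^sup>+ x. indicator {0<..<1} r * indicator {x. ennreal (r * M)
        \<le> g x} x \<partial>lborel)"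
      by (intro nn_integral_cong) (auto simp: indicator_def)
    then show "indicator {0<..<1} r * emeasure lborel {x. ennreal (r * M)
        \<le> g x} = (\<integral>\<^sup>+ x. ?I r x \<partial>lborel)"
      by (simp add: nn_integral_cmult)
  qed
  also have "\<dots> = (\<integral>\<^sup>+ x. \<integral>\<^sup>+ r. ?I r x \<partial>lborel \<partial>lborel)"
    by (rule lborel_pair.Fubini'[symmetric]) measurable
  finally have "ennreal M * (\<integral>\<^sup>+ r. indicator {0<..<1} r * emeasure lborel {x. ennreal (r * M)
      \<le> g x} \<partial>lborel)
      = (\<integral>\<^sup>+ x. ennreal M * (\<integral>\<^sup>+ r. ?I r x \<partial>lborel) \<partial>lborel)"
    by (simp only:) (rule nn_integral_cmult[symmetric], measurable)
  also have "\<dots> = (\<integral>\<^sup>+ x. min (g x) (ennreal M) \<partial>lborel)"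
    unfolding nn_integral_level_indicator[OF M] ..
  finally show ?thesis .
qed

lemma essential_supremum_fun:
  fixes g :: "real \<Rightarrow> ennreal"
  assumes [measurable]: "g \<in> borel_measurable borel" and bd: "\<And>x. g x
      \<le> ennreal N" and pos: "(\<integral>\<^sup>+ x. g x \<partial>lborel) \<noteq> 0"
  obtains M where "0 < M" "AE x in lborel. g x \<le> ennreal M"
    "\<And>r. 0 < r \<Longrightarrow> r < M \<Longrightarrow> emeasure lborel {x. ennreal r \<le> g x} \<noteq> 0"
proof -
  define u where "u x = enn2real (g x)" for x
  have g: "g x = ennreal (u x)" for x
    unfolding u_def using bd[of x] by (intro ennreal_enn2real[symmetric])
        (auto intro: le_less_trans)
  have u0: "0 \<le> u x" for x by (simp add: u_def)
  have u: "0 \<le> u x" "u x \<le> max N 0" for x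
    using bd[of x] u0[of x] by (auto simp: g ennreal_le_iff2 le_max_iff_disj)
  have "\<not> (AE x in (lborel :: real measure). False)" by (simp add: AE_iff_measurable[where N=UNIV])
  with u obtain M where M: "0 \<le> M" "AE x in lborel. u x \<le> M" "\<And>r. r < M
      \<Longrightarrow> \<not> (AE x in lborel. u x \<le> r)"
    using essential_supremum[of lborel 0 u "max N 0"] by metis
  show thesis
  proof (rule that[of M])
    show "0 < M"
    proof (rule ccontr)
      assume "\<not> 0 < M"
      with M(2) have "AE x in lborel. g x = 0" by (auto elim!: eventually_mono simp: g ennreal_neg)
      then have "(\<integral>\<^sup>+ x. g x \<partial>lborel) = 0" by (subst nn_integral_0_iff_AE) auto
      with pos show False by simp
    qed
    show "AE x in lborel. g x \<le> ennreal M" using M(2) unfolding g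
        by (auto elim!: eventually_mono intro: ennreal_leI)
    show "emeasure lborel {x. ennreal r \<le> g x} \<noteq> 0" if "0 < r" "r < M" for r
    proof
      assume "emeasure lborel {x. ennreal r \<le> g x} = 0"
      then have "AE x in lborel. \<not> ennreal r \<le> g x"
        by (subst AE_iff_measurable[where N="{x. ennreal r \<le> g x}"]) auto
      then have "AE x in lborel. u x \<le> r" by eventually_elim (use that u in \<open>auto simp: g\<close>)
      with M(3)[OF that(2)] show False by simp
    qed
  qed
qed

lemma ennreal_arith_geo_mean:
  assumes "0 < s" "0 < t" "s + t = 1"
  shows "ennreal_powr a s * ennreal_powr b t \<le> ennreal s * a + ennreal t * b"
proof (cases a; cases b)
  fix x y assume xy: "a = ennreal x" "b = ennreal y" "0 \<le> x" "0 \<le> y"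
  have "x powr s * y powr t \<le> s * x + t * y"
  proof (cases "x = 0 \<or> y = 0")
    case True then show ?thesis using assms xy by auto
  next
    case False then show ?thesis using Youngs_inequality_0[of s t x y] assms xy by simp
  qed
  then show ?thesis using assms xy
    by (simp add: ennreal_powr_ennreal ennreal_mult[symmetric] ennreal_plus[symmetric] del:
        ennreal_plus)
qed (use assms in \<open>auto simp: ennreal_mult_top\<close>)

text \<open>
Scaled by their essential suprema \<open>M1\<close>, \<open>M2\<close>, the functions \<open>g\<close> and \<open>k\<close> have non-null level sets at
exactly the same heights \<open>r \<in> (0,1)\<close>. Brunn--Minkowski holds at each of these heights;
integrating over \<open>r\<close> gives the arithmetic mean, which dominates the geometric one.
\<close>
lemma prekopa_leindler_AE_bounded:
  fixes f g k :: "real \<Rightarrow> ennreal"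
  assumes [measurable]: "f \<in> borel_measurable borel" "g \<in> borel_measurable borel"
      "k \<in> borel_measurable borel"
    and st: "0 < s" "0 < t" "s + t = 1" and bd: "\<And>x. g x \<le> ennreal N" "\<And>x. k x \<le> ennreal N"
    and ae: "AE x in lborel. AE y in lborel. ennreal_powr (g x) s * ennreal_powr (k y) t
        \<le> f (s * x + t * y)"
  shows "ennreal_powr (\<integral>\<^sup>+ x. g x \<partial>lborel) s * ennreal_powr (\<integral>\<^sup>+ x. k x \<partial>lborel) t
      \<le> (\<integral>\<^sup>+ x. f x \<partial>lborel)"
proof (cases "(\<integral>\<^sup>+ x. g x \<partial>lborel) = 0 \<or> (\<integral>\<^sup>+ x. k x \<partial>lborel) = 0")
  case True
  then show ?thesis using st by (auto simp: ennreal_powr_0_left)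
next
  case False
  then obtain M1 where M1: "0 < M1" "AE x in lborel. g x \<le> ennreal M1"
    "\<And>r. 0 < r \<Longrightarrow> r < M1 \<Longrightarrow> emeasure lborel {x. ennreal r \<le> g x} \<noteq> 0"
    using essential_supremum_fun[OF assms(2) bd(1)] by metis
  from False obtain M2 where M2: "0 < M2" "AE x in lborel. k x \<le> ennreal M2"
    "\<And>r. 0 < r \<Longrightarrow> r < M2 \<Longrightarrow> emeasure lborel {x. ennreal r \<le> k x} \<noteq> 0"
    using essential_supremum_fun[OF assms(3) bd(2)] by metis
  define M where "M = M1 powr s * M2 powr t"
  have M: "0 < M" using M1 M2 by (simp add: M_def)
  \<comment> \<open>By the layer-cake formula \<open>L * vol u L\<close> is the integral of \<open>min u L\<close>, and the minimum may be
  dropped when \<open>L\<close> bounds \<open>u\<close>.\<close>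
  define vol where "vol u L = (\<integral>\<^sup>+ r. indicator {0<..<1} r * emeasure lborel {x. ennreal (r * L)
      \<le> u x} \<partial>lborel)"
    for u :: "real \<Rightarrow> ennreal" and L
  have meas: "(\<lambda>r. indicator {0<..<1} r * emeasure lborel {x. ennreal (r * L)
      \<le> u x}) \<in> borel_measurable borel"
    if [measurable]: "u \<in> borel_measurable borel" for u :: "real \<Rightarrow> ennreal" and L
  proof -
    have "{z \<in> space (borel \<Otimes>\<^sub>M lborel). ennreal (fst z * L) \<le> u (snd z)} \<in> sets (borel \<Otimes>\<^sub>M lborel)"
        by measurable
    from lborel.measurable_emeasure_Pair[OF this] show ?thesis
        by (simp add: vimage_def space_pair_measure)
  qed
  have full: "(\<integral>\<^sup>+ x. u x \<partial>lborel) = ennreal L * vol u L"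
    if "u \<in> borel_measurable borel" "0 < L" "AE x in lborel. u x \<le> ennreal L" for u L
    unfolding vol_def nn_integral_level_sets[OF that(1,2)]
    using that(3) by (intro nn_integral_cong_AE) (auto elim!: eventually_mono simp: min_def)
  have F: "ennreal M * vol f M \<le> (\<integral>\<^sup>+ x. f x \<partial>lborel)"
    unfolding vol_def nn_integral_level_sets[OF assms(1) M] by (intro nn_integral_mono) simp
  have lev: "ennreal s * emeasure lborel {x. ennreal (r * M1)
      \<le> g x} + ennreal t * emeasure lborel {x. ennreal (r * M2) \<le> k x}
      \<le> emeasure lborel {x. ennreal (r * M) \<le> f x}" if r: "0 < r" "r < 1" for r
  proof (rule brunn_minkowski_AE)
    show "emeasure lborel {x. ennreal (r * M1) \<le> g x} \<noteq> 0" "emeasure lborel {x. ennreal (r * M2)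
        \<le> k x} \<noteq> 0"
      using r M1(1) M2(1) by (intro M1(3) M2(3); simp)+
    have "ennreal (r * M) \<le> ennreal_powr u s * ennreal_powr v t" if "ennreal (r * M1)
        \<le> u" "ennreal (r * M2) \<le> v" for u v
    proof -
      have "r * M = (r * M1) powr s * (r * M2) powr t"
        using r M1(1) M2(1) st by (simp add: M_def powr_mult powr_add[symmetric] algebra_simps)
      moreover have "0 < r * M1" "0 < r * M2" using r M1(1) M2(1) by auto
      ultimately have "ennreal (r * M) = ennreal_powr (ennreal (r * M1)) s
          * ennreal_powr (ennreal (r * M2)) t"
        by (simp only: ennreal_powr_pos_ennreal ennreal_mult powr_ge_zero)
      also have "\<dots> \<le> ennreal_powr u s * ennreal_powr v t"
        using that st by (intro mult_mono ennreal_powr_mono) auto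
      finally show ?thesis .
    qed
    then show "AE x in lborel. AE y in lborel. x \<in> {x. ennreal (r * M1) \<le> g x}
        \<longrightarrow> y \<in> {x. ennreal (r * M2) \<le> k x}
        \<longrightarrow> s * x + t * y \<in> {x. ennreal (r * M) \<le> f x}"
      using ae by (auto elim!: eventually_mono intro: order_trans)
  qed (use st in auto)
  define A where "A r = indicator {0<..<1} r * emeasure lborel {x. ennreal (r * M1) \<le> g x}" for r
  define B where "B r = indicator {0<..<1} r * emeasure lborel {x. ennreal (r * M2) \<le> k x}" for r
  have [measurable]: "A \<in> borel_measurable borel" "B \<in> borel_measurable borel"
    unfolding A_def B_def by (intro meas assms)+
  have "ennreal s * vol g M1 + ennreal t * vol k M2
      = (\<integral>\<^sup>+ r. ennreal s * A r + ennreal t * B r \<partial>lborel)"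
    unfolding vol_def A_def[symmetric] B_def[symmetric]
        by (simp add: nn_integral_add nn_integral_cmult)
  also have "\<dots> \<le> vol f M"
    unfolding vol_def A_def B_def using lev by (intro nn_integral_mono) (auto simp: indicator_def)
  finally have vol: "ennreal s * vol g M1 + ennreal t * vol k M2 \<le> vol f M" .
  have homogeneous: "ennreal_powr (ennreal M1 * a) s * ennreal_powr (ennreal M2 * b) t
      = ennreal M * (ennreal_powr a s * ennreal_powr b t)" for a b
    using M1(1) M2(1) st
    by (simp add: mult.commute[of "ennreal M1"] mult.commute[of "ennreal M2"] ennreal_powr_mult_pos
        M_def ennreal_mult ac_simps)
  have "ennreal_powr (\<integral>\<^sup>+ x. g x \<partial>lborel) s * ennreal_powr (\<integral>\<^sup>+ x. k x \<partial>lborel) t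
      = ennreal M * (ennreal_powr (vol g M1) s * ennreal_powr (vol k M2) t)"
    unfolding full[OF assms(2) M1(1,2)] full[OF assms(3) M2(1,2)] by (rule homogeneous)
  also have "\<dots> \<le> ennreal M * vol f M"
    using ennreal_arith_geo_mean[OF st, of "vol g M1" "vol k M2"] vol by (intro mult_left_mono) auto
  also have "\<dots> \<le> (\<integral>\<^sup>+ x. f x \<partial>lborel)" by (rule F)
  finally show ?thesis .
qed

lemma nn_integral_min_SUP:
  assumes [measurable]: "g \<in> borel_measurable M"
  shows "(SUP n. \<integral>\<^sup>+ x. min (g x) (ennreal (real n)) \<partial>M) = (\<integral>\<^sup>+ x. g x \<partial>M)"
    and "incseq (\<lambda>n. \<integral>\<^sup>+ x. min (g x) (ennreal (real n)) \<partial>M)"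
proof -
  have "(\<integral>\<^sup>+ x. (SUP n. min (g x) (ennreal (real n))) \<partial>M)
      = (SUP n. \<integral>\<^sup>+ x. min (g x) (ennreal (real n)) \<partial>M)"
    using incseq_min_nat by (intro nn_integral_monotone_convergence_SUP)
        (auto simp: incseq_def le_fun_def)
  then show "(SUP n. \<integral>\<^sup>+ x. min (g x) (ennreal (real n)) \<partial>M) = (\<integral>\<^sup>+ x. g x \<partial>M)"
    by (simp add: ennreal_min_nat_SUP)
  show "incseq (\<lambda>n. \<integral>\<^sup>+ x. min (g x) (ennreal (real n)) \<partial>M)"
    using incseq_min_nat by (auto simp: incseq_def intro!: nn_integral_mono)
qed

lemma prekopa_leindler_AE:
  fixes f g k :: "real \<Rightarrow> ennreal"
  assumes [measurable]: "f \<in> borel_measurable borel" "g \<in> borel_measurable borel"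
      "k \<in> borel_measurable borel"
    and st: "0 < s" "0 < t" "s + t = 1"
    and ae: "AE x in lborel. AE y in lborel. ennreal_powr (g x) s * ennreal_powr (k y) t
        \<le> f (s * x + t * y)"
  shows "ennreal_powr (\<integral>\<^sup>+ x. g x \<partial>lborel) s * ennreal_powr (\<integral>\<^sup>+ x. k x \<partial>lborel) t
      \<le> (\<integral>\<^sup>+ x. f x \<partial>lborel)"
proof -
  have "ennreal_powr (SUP n. \<integral>\<^sup>+ x. min (g x) (ennreal (real n)) \<partial>lborel) s
      * ennreal_powr (SUP n. \<integral>\<^sup>+ x. min (k x) (ennreal (real n)) \<partial>lborel) t \<le> (\<integral>\<^sup>+ x. f x \<partial>lborel)"
  proof (rule ennreal_powr_SUP_le)
    fix n
    show "ennreal_powr (\<integral>\<^sup>+ x. min (g x) (ennreal (real n)) \<partial>lborel) s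
      * ennreal_powr (\<integral>\<^sup>+ x. min (k x) (ennreal (real n)) \<partial>lborel) t \<le> (\<integral>\<^sup>+ x. f x \<partial>lborel)"
    proof (rule prekopa_leindler_AE_bounded[where N="real n"])
      have "ennreal_powr (min (g x) (ennreal (real n))) s
          * ennreal_powr (min (k y) (ennreal (real n))) t
          \<le> ennreal_powr (g x) s * ennreal_powr (k y) t" for x y
        using st by (intro mult_mono ennreal_powr_mono) auto
      then show "AE x in lborel. AE y in lborel. ennreal_powr (min (g x) (ennreal (real n))) s
          * ennreal_powr (min (k y) (ennreal (real n))) t \<le> f (s * x + t * y)"
        using ae by (auto elim!: eventually_mono intro: order_trans)
    qed (use st in auto)
  next
    show "incseq (\<lambda>n. \<integral>\<^sup>+ x. min (g x) (ennreal (real n)) \<partial>lborel)"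
      "incseq (\<lambda>n. \<integral>\<^sup>+ x. min (k x) (ennreal (real n)) \<partial>lborel)"
      by (rule nn_integral_min_SUP(2); simp)+
  qed (use st in auto)
  then show ?thesis by (simp add: nn_integral_min_SUP(1))
qed

text \<open>
The Gaussian form follows from the Lebesgue form since
\<open>\<phi>(x)\<^sup>s \<phi>(y)\<^sup>t exp (st(x-y)\<^sup>2/2) = \<phi>(sx+ty)\<close> for the density \<open>\<phi>\<close>. The exponents 0 and 1 are treated
apart, because \<open>x\<^sup>0 = 1\<close> also at \<open>x = 0\<close>.
\<close>
lemma prekopa_leindler_gauss:
  fixes f g k :: "real \<Rightarrow> ennreal"
  assumes [measurable]: "f \<in> borel_measurable borel" "g \<in> borel_measurable borel"
      "k \<in> borel_measurable borel"
    and st: "0 \<le> s" "0 \<le> t" "s + t = 1"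
    and ae: "AE x in lborel. AE y in lborel. ennreal_powr (g x) s * ennreal_powr (k y) t
      \<le> f (s * x + t * y) * ennreal (exp (s * t * (x - y)\<^sup>2 / 2))"
  shows "ennreal_powr (\<integral>\<^sup>+ x. g x \<partial>std_normal_distribution) s
      * ennreal_powr (\<integral>\<^sup>+ x. k x \<partial>std_normal_distribution) t
    \<le> (\<integral>\<^sup>+ x. f x \<partial>std_normal_distribution)"
proof -
  have dens: "(\<integral>\<^sup>+ x. u x \<partial>std_normal_distribution)
      = (\<integral>\<^sup>+ x. u x * ennreal (std_normal_density x) \<partial>lborel)"
    if "u \<in> borel_measurable borel" for u
    using that by (subst nn_integral_density) (auto simp: mult.commute)
  have ae_mono: "(\<integral>\<^sup>+ x. u x \<partial>std_normal_distribution) \<le> (\<integral>\<^sup>+ x. v x \<partial>std_normal_distribution)"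
    if "AE x in lborel. u x \<le> v x" "u \<in> borel_measurable borel" "v \<in> borel_measurable borel" for u v
    unfolding dens[OF that(2)] dens[OF that(3)] using that(1)
    by (intro nn_integral_mono_AE) (auto elim!: eventually_mono intro: mult_right_mono)
  have AE_const: Q if "AE x in (lborel :: real measure). Q" for Q
  proof (rule ccontr)
    assume "\<not> Q"
    with that have "AE x in (lborel :: real measure). False" by simp
    then show False by (simp add: AE_iff_measurable[where N=UNIV])
  qed
  consider "s = 0" | "t = 0" | "0 < s" "0 < t" using st by linarith
  then show ?thesis
  proof cases
    case 1
    then have t: "t = 1" using st by simp
    from ae have "AE x in (lborel :: real measure). AE y in lborel. k y \<le> f y" using 1 t by simp
    then have "AE y in lborel. k y \<le> f y" by (rule AE_const)
    then show ?thesis using 1 t ae_mono by simp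
  next
    case 2
    then have s: "s = 1" using st by simp
    from ae have "AE x in lborel. AE y in (lborel :: real measure). g x \<le> f x" using 2 s by simp
    then have "AE x in lborel. g x \<le> f x" by (auto elim!: eventually_mono intro: AE_const)
    then show ?thesis using 2 s ae_mono by simp
  next
    case 3
    let ?d = std_normal_density
    have "ennreal_powr (\<integral>\<^sup>+ x. g x * ennreal (?d x) \<partial>lborel) s * ennreal_powr (\<integral>\<^sup>+ x. k x
        * ennreal (?d x) \<partial>lborel) t
      \<le> (\<integral>\<^sup>+ x. f x * ennreal (?d x) \<partial>lborel)"
    proof (rule prekopa_leindler_AE[OF _ _ _ 3 st(3)])
      have key: "?d x powr s * ?d y powr t * exp (s * t * (x - y)\<^sup>2 / 2)
          = ?d (s * x + t * y)" for x y
      proof -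
        have t: "t = 1 - s" using st by simp
        define C where "C = 1 / sqrt (2 * pi)"
        have C: "0 < C" by (simp add: C_def)
        have d: "?d z = C * exp (- z\<^sup>2 / 2)" for z by (simp add: std_normal_density_def C_def)
        have "?d x powr s * ?d y powr t = C powr s * C powr t * exp (s * (- x\<^sup>2 / 2)
            + t * (- y\<^sup>2 / 2))"
          using C by (simp add: d powr_mult exp_powr_real mult_exp_exp mult_ac)
        also have "C powr s * C powr t = C" using C st by (simp add: powr_add[symmetric])
        finally have "?d x powr s * ?d y powr t * exp (s * t * (x - y)\<^sup>2 / 2)
            = C * exp (s * (- x\<^sup>2 / 2) + t * (- y\<^sup>2 / 2) + s * t * (x - y)\<^sup>2 / 2)"
                by (simp add: exp_add)
        also have "s * (- x\<^sup>2 / 2) + t * (- y\<^sup>2 / 2) + s * t * (x - y)\<^sup>2 / 2 = - (s * x + t * y)\<^sup>2 / 2"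
          unfolding t by (simp add: power2_eq_square field_simps)
        finally show ?thesis by (simp add: d)
      qed
      have "ennreal_powr (g x * ennreal (?d x)) s * ennreal_powr (k y * ennreal (?d y)) t
          \<le> f (s * x + t * y) * ennreal (?d (s * x + t * y))"
        if "ennreal_powr (g x) s * ennreal_powr (k y) t
            \<le> f (s * x + t * y) * ennreal (exp (s * t * (x - y)\<^sup>2 / 2))" for x y
      proof -
        have "ennreal_powr (g x * ennreal (?d x)) s * ennreal_powr (k y * ennreal (?d y)) t
          = ennreal_powr (g x) s * ennreal_powr (k y) t * ennreal (?d x powr s * ?d y powr t)"
          using st by (simp add: ennreal_powr_mult_pos normal_density_pos ennreal_mult ac_simps)
        also have "\<dots> \<le> f (s * x + t * y) * ennreal (exp (s * t * (x - y)\<^sup>2 / 2))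
            * ennreal (?d x powr s * ?d y powr t)"
          using that by (rule mult_right_mono) simp
        also have "\<dots> = f (s * x + t * y) * ennreal (?d (s * x + t * y))"
          unfolding key[symmetric] by (simp add: ennreal_mult ac_simps)
        finally show ?thesis .
      qed
      then show "AE x in lborel. AE y in lborel. ennreal_powr (g x * ennreal (?d x)) s
          * ennreal_powr (k y * ennreal (?d y)) t
          \<le> f (s * x + t * y) * ennreal (?d (s * x + t * y))"
        using ae by (auto elim!: eventually_mono)
    qed auto
    then show ?thesis by (simp add: dens)
  qed
qed

section \<open>Averaging along coordinates preserves the inequality\<close>

locale wiener_basis = abstract_wiener_space \<mu> \<iota>
  for \<mu> :: "'w::separable_frechet_space measure" and \<iota> :: "'h::{real_inner,polish_space} \<Rightarrow> 'w" +
  fixes I :: "nat set" and e :: "nat \<Rightarrow> 'w \<Rightarrow> real"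
  assumes basis: "dual_basis \<iota> I e"
begin

definition rep :: "nat \<Rightarrow> 'h" where "rep i = riesz_rep \<iota> (e i)"

lemma e_dual: "i \<in> I \<Longrightarrow> e i \<in> dual"
  using basis by (auto simp: dual_basis_def)

lemma measurable_e: "i \<in> I \<Longrightarrow> e i \<in> borel_measurable borel"
  by (intro dual_measurable e_dual)

lemma rep_orthonormal: "i \<in> I \<Longrightarrow> j \<in> I \<Longrightarrow> rep i \<bullet> rep j = (if i = j then 1 else 0)"
  using basis by (auto simp: dual_basis_def rep_def)

lemma norm_rep: "i \<in> I \<Longrightarrow> norm (riesz_rep \<iota> (e i)) = 1"
  using rep_orthonormal[of i i] by (simp add: rep_def norm_eq_sqrt_inner)

lemma e_iota: "i \<in> I \<Longrightarrow> e i (\<iota> h) = rep i \<bullet> h"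
  by (simp add: riesz_inner[OF e_dual] rep_def)

lemma e_iota_rep: "i \<in> I \<Longrightarrow> j \<in> I \<Longrightarrow> e i (\<iota> (rep j)) = (if i = j then 1 else 0)"
  by (simp add: e_iota rep_orthonormal)

lemma e_add: "i \<in> I \<Longrightarrow> e i (x + y) = e i x + e i y"
  and e_scale: "i \<in> I \<Longrightarrow> e i (c *\<^sub>R x) = c * e i x"
  by (auto simp: linear_add[OF dual_linear[OF e_dual]] linear_cmul[OF dual_linear[OF e_dual]])

lemma iota_add: "\<iota> (h + k) = \<iota> h + \<iota> k" and iota_scale: "\<iota> (c *\<^sub>R h) = c *\<^sub>R \<iota> h"
  by (auto simp: linear_add[OF linear_inj] linear_cmul[OF linear_inj])

lemma dense_dual: "closure (riesz_rep \<iota> ` dual) = UNIV"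
proof -
  have "subspace (riesz_rep \<iota> ` dual)"
  proof (rule subspaceI)
    have "riesz_rep \<iota> (\<lambda>_. 0) = 0" by (rule riesz_unique) simp
    then show "0 \<in> riesz_rep \<iota> ` dual" using dual_zero by (metis imageI)
    fix x y c assume "x \<in> riesz_rep \<iota> ` dual" "y \<in> riesz_rep \<iota> ` dual"
    then obtain l m where l: "l \<in> dual" "x = riesz_rep \<iota> l" and m: "m \<in> dual" "y = riesz_rep \<iota> m"
        by auto
    have "riesz_rep \<iota> (\<lambda>w. l w + m w) = x + y"
      by (rule riesz_unique) (simp add: riesz_inner l m inner_add_left)
    then show "x + y \<in> riesz_rep \<iota> ` dual" using dual_add[OF l(1) m(1)] by (metis imageI)
    have "riesz_rep \<iota> (\<lambda>w. c * l w) = c *\<^sub>R x"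
      by (rule riesz_unique) (simp add: riesz_inner l)
    then show "c *\<^sub>R x \<in> riesz_rep \<iota> ` dual" using dual_scale[OF l(1)] by (metis imageI)
  qed
  moreover have "(\<lambda>i. riesz_rep \<iota> (e i)) ` I \<subseteq> riesz_rep \<iota> ` dual" using e_dual by auto
  ultimately have "span ((\<lambda>i. riesz_rep \<iota> (e i)) ` I) \<subseteq> riesz_rep \<iota> ` dual"
      by (rule span_minimal[rotated])
  from closure_mono[OF this] basis show ?thesis by (auto simp: dual_basis_def)
qed

lemmas AE_shift = quasi_invariant[OF dense_dual]

text \<open>
Condition (P) after division by the Gaussian weights, see \<open>gauss_ineq_iff\<close>.
\<close>
definition cond_P :: "real \<Rightarrow> real \<Rightarrow> ('w \<Rightarrow> ennreal) \<Rightarrow> ('w \<Rightarrow> ennreal) \<Rightarrow> ('w \<Rightarrow> ennreal) \<Rightarrow> bool" where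
  "cond_P s t a b c \<longleftrightarrow> (\<forall>h k. AE w in \<mu>. ennreal_powr (b (w + \<iota> h)) s * ennreal_powr (c (w + \<iota> k)) t
      \<le> a (w + \<iota> (s *\<^sub>R h + t *\<^sub>R k)) * ennreal (exp (s * t * (norm (h - k))\<^sup>2 / 2)))"

text \<open>
The Mehler average in the single coordinate \<open>j\<close>: it replaces \<open>e j w\<close> by \<open>\<alpha> e j w + \<beta> x\<close>.
\<close>
definition line_avg :: "real \<Rightarrow> real \<Rightarrow> nat \<Rightarrow> ('w \<Rightarrow> ennreal) \<Rightarrow> 'w \<Rightarrow> ennreal" where
  "line_avg \<alpha> \<beta> j G w = (\<integral>\<^sup>+ x. G (w + ((\<alpha> - 1) * e j w
      + \<beta> * x) *\<^sub>R \<iota> (rep j)) \<partial>std_normal_distribution)"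

text \<open>
Split off the \<open>j\<close>-th coordinates of \<open>h\<close> and \<open>k\<close>. Moving the second shift along the \<open>j\<close>-th line and
using Fubini, (P) becomes an inequality for almost every pair of points of almost every such
line, to which the one-dimensional Prekopa--Leindler inequality applies.
\<close>
lemma cond_P_line_avg:
  assumes st: "0 \<le> s" "0 \<le> t" "s + t = 1" and j: "j \<in> I" and ab: "\<alpha>\<^sup>2 + \<beta>\<^sup>2 = (1::real)" "\<beta> \<noteq> 0"
    and [measurable]: "a \<in> borel_measurable borel" "b \<in> borel_measurable borel"
        "c \<in> borel_measurable borel"
    and cond_P: "cond_P s t a b c"
  shows "cond_P s t (line_avg \<alpha> \<beta> j a) (line_avg \<alpha> \<beta> j b) (line_avg \<alpha> \<beta> j c)"
  unfolding cond_P_def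
proof (intro allI)
  fix h k
  note [measurable] = measurable_e[OF j]
  define g where "g = \<iota> (rep j)"
  define hj where "hj = rep j \<bullet> h"
  define kj where "kj = rep j \<bullet> k"
  define h0 where "h0 = h - hj *\<^sub>R rep j"
  define k0 where "k0 = k - kj *\<^sub>R rep j"
  have ff: "rep j \<bullet> rep j = 1" using rep_orthonormal[OF j j] by simp
  have h: "h = h0 + hj *\<^sub>R rep j" and k: "k = k0 + kj *\<^sub>R rep j" by (simp_all add: h0_def k0_def)
  have orth: "(h0 - k0) \<bullet> rep j = 0"
    by (simp add: h0_def k0_def hj_def kj_def inner_diff_left ff inner_commute[of "rep j" h]
        inner_commute[of "rep j" k])
  have pyth: "(norm (h0 - k0 + r *\<^sub>R rep j))\<^sup>2 = (norm (h0 - k0))\<^sup>2 + r\<^sup>2" for r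
    unfolding norm_add_scaleR_sq orth using ff by (simp add: power2_norm_eq_inner)
  have hk: "(norm (h - k))\<^sup>2 = (norm (h0 - k0))\<^sup>2 + (hj - kj)\<^sup>2"
    using pyth[of "hj - kj"] by (simp add: h k algebra_simps)
  \<comment> \<open>Only the second shift is moved along the line: as \<open>w\<close> itself varies along the line, this
  reaches every pair of points.\<close>
  define R where "R w v \<longleftrightarrow> ennreal_powr (b (w + \<iota> h0)) s * ennreal_powr (c (w + \<iota> k0 + v *\<^sub>R g)) t
      \<le> a (w + \<iota> (s *\<^sub>R h0 + t *\<^sub>R k0) + (t * v) *\<^sub>R g) * ennreal (exp (s * t * ((norm (h0 - k0))\<^sup>2
          + v\<^sup>2) / 2))" for w v
  have R1: "AE w in \<mu>. R w v" for v
  proof -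
    have "AE w in \<mu>. ennreal_powr (b (w + \<iota> h0)) s * ennreal_powr (c (w + \<iota> (k0 + v *\<^sub>R rep j))) t
      \<le> a (w + \<iota> (s *\<^sub>R h0 + t *\<^sub>R (k0 + v *\<^sub>R rep j))) * ennreal (exp (s * t * (norm (h0 - (k0
          + v *\<^sub>R rep j)))\<^sup>2 / 2))"
      using cond_P unfolding cond_P_def by blast
    moreover have "(norm (h0 - (k0 + v *\<^sub>R rep j)))\<^sup>2 = (norm (h0 - k0))\<^sup>2 + v\<^sup>2"
      using pyth[of "- v"] by (simp add: algebra_simps)
    moreover have "w + \<iota> (k0 + v *\<^sub>R rep j) = w + \<iota> k0 + v *\<^sub>R g"
      "w + \<iota> (s *\<^sub>R h0 + t *\<^sub>R (k0 + v *\<^sub>R rep j)) = w + \<iota> (s *\<^sub>R h0 + t *\<^sub>R k0) + (t * v) *\<^sub>R g" for w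
      by (simp_all add: g_def iota_add iota_scale scaleR_add_right add.assoc)
    ultimately show ?thesis unfolding R_def by (simp only:)
  qed
  have Rm [measurable]: "Measurable.pred (borel \<Otimes>\<^sub>M borel) (\<lambda>z. R (fst z) (snd z))"
  proof -
    have [measurable]: "g \<in> space borel" by simp
    have 1: "(\<lambda>z. b (fst z + \<iota> h0)) \<in> borel_measurable (borel \<Otimes>\<^sub>M borel)"
      "(\<lambda>z. c (fst z + \<iota> k0 + snd z *\<^sub>R g)) \<in> borel_measurable (borel \<Otimes>\<^sub>M borel)"
      "(\<lambda>z. a (fst z + \<iota> (s *\<^sub>R h0 + t *\<^sub>R k0) + (t * snd z) *\<^sub>R g))
          \<in> borel_measurable (borel \<Otimes>\<^sub>M borel)"
      "(\<lambda>z. ennreal (exp (s * t * ((norm (h0 - k0))\<^sup>2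
          + (snd z)\<^sup>2) / 2))) \<in> borel_measurable (borel \<Otimes>\<^sub>M borel)"
      by measurable
    show ?thesis unfolding R_def pred_def
      by (intro borel_measurable_le borel_measurable_times_ennreal borel_measurable_ennreal_powr st
          1)
  qed
  have Rmv: "Measurable.pred borel (\<lambda>w. R w v)" for v
    using measurable_compose[OF _ Rm, of "\<lambda>w. (w, v)" borel] by simp
  interpret P: pair_sigma_finite \<mu> lborel ..
  interpret PQ: pair_sigma_finite "lborel :: real measure" "\<mu> \<Otimes>\<^sub>M lborel" ..
  have Rz: "AE z in \<mu> \<Otimes>\<^sub>M lborel. R (fst z + (snd z - e j (fst z)) *\<^sub>R g) v" for v
  proof (rule P.AE_pair_measure)
    have "(\<lambda>z. (fst z + (snd z - e j (fst z)) *\<^sub>R g, v)) \<in> \<mu> \<Otimes>\<^sub>M lborel \<rightarrow>\<^sub>M borel \<Otimes>\<^sub>M borel"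
        by measurable
    from measurable_compose[OF this Rm]
    show "{z \<in> space (\<mu> \<Otimes>\<^sub>M lborel). R (fst z + (snd z - e j (fst z)) *\<^sub>R g) v} \<in> sets (\<mu> \<Otimes>\<^sub>M lborel)"
      by (simp add: pred_def)
    show "AE w in \<mu>. AE x in lborel. R (fst (w, x) + (snd (w, x) - e j (fst (w, x))) *\<^sub>R g) v"
      using R1[of v] AE_line[OF e_dual[OF j] norm_rep[OF j] Rmv[of v]] by (simp add: g_def rep_def)
  qed
  have "AE z in \<mu> \<Otimes>\<^sub>M lborel. AE v in lborel. R (fst z + (snd z - e j (fst z)) *\<^sub>R g) v"
  proof (rule PQ.AE_commute[THEN iffD1])
    have "(\<lambda>z. (fst (snd z) + (snd (snd z) - e j (fst (snd z))) *\<^sub>R g, fst z))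
        \<in> lborel \<Otimes>\<^sub>M (\<mu> \<Otimes>\<^sub>M lborel) \<rightarrow>\<^sub>M borel \<Otimes>\<^sub>M borel" by measurable
    from measurable_compose[OF this Rm]
    show "{x \<in> space (lborel \<Otimes>\<^sub>M (\<mu> \<Otimes>\<^sub>M lborel)). R (fst (snd x)
        + (snd (snd x) - e j (fst (snd x))) *\<^sub>R g) (fst x)}
       \<in> sets (lborel \<Otimes>\<^sub>M (\<mu> \<Otimes>\<^sub>M lborel))" by (simp add: pred_def)
    show "AE v in lborel. AE z in \<mu> \<Otimes>\<^sub>M lborel. R (fst z + (snd z - e j (fst z)) *\<^sub>R g) v"
      using Rz by simp
  qed
  then have "AE w in \<mu>. AE y in lborel. AE v in lborel. R (w + (y - e j w) *\<^sub>R g) v"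
    using P.AE_pair by fastforce
  then show "AE w in \<mu>. ennreal_powr (line_avg \<alpha> \<beta> j b (w
      + \<iota> h)) s * ennreal_powr (line_avg \<alpha> \<beta> j c (w + \<iota> k)) t
      \<le> line_avg \<alpha> \<beta> j a (w + \<iota> (s *\<^sub>R h + t *\<^sub>R k)) * ennreal (exp (s * t * (norm (h - k))\<^sup>2 / 2))"
  proof eventually_elim
    case (elim w)
    define w' where "w' = w + (- e j w) *\<^sub>R g"
    have avg: "line_avg \<alpha> \<beta> j G (w + \<iota> (m + r *\<^sub>R rep j))
        = (\<integral>\<^sup>+ x. G (w' + \<iota> m + (\<alpha> * (e j w + r) + \<beta> * x) *\<^sub>R g) \<partial>std_normal_distribution)"
      if m: "rep j \<bullet> m = 0" for G m r
    proof -
      have "e j (w + \<iota> (m + r *\<^sub>R rep j)) = e j w + r"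
        using m by (simp add: e_add[OF j] e_iota[OF j] inner_add_right ff)
      then show ?thesis
        unfolding line_avg_def
        by (intro nn_integral_cong arg_cong[where f=G])
           (simp add: w'_def iota_add iota_scale g_def algebra_simps)
    qed
    have o1: "rep j \<bullet> h0 = 0" "rep j \<bullet> k0 = 0" by (simp_all add: h0_def k0_def hj_def kj_def
        inner_diff_right ff)
    then have o2: "rep j \<bullet> (s *\<^sub>R h0 + t *\<^sub>R k0) = 0" by (simp add: inner_add_right)
    have shk: "s *\<^sub>R h + t *\<^sub>R k = (s *\<^sub>R h0 + t *\<^sub>R k0) + (s * hj + t * kj) *\<^sub>R rep j"
      by (simp add: h k algebra_simps)
    define Fb where "Fb x = b (w' + \<iota> h0 + (\<alpha> * (e j w + hj) + \<beta> * x) *\<^sub>R g)" for x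
    define Fc where "Fc x = c (w' + \<iota> k0 + (\<alpha> * (e j w + kj) + \<beta> * x) *\<^sub>R g)" for x
    define Fa where "Fa x = a (w' + \<iota> (s *\<^sub>R h0 + t *\<^sub>R k0) + (\<alpha> * (e j w + (s * hj + t * kj))
        + \<beta> * x) *\<^sub>R g)" for x
    define E where "E = ennreal (exp (s * t * (norm (h - k))\<^sup>2 / 2))"
    have [measurable]: "Fa \<in> borel_measurable borel" "Fb \<in> borel_measurable borel"
        "Fc \<in> borel_measurable borel"
      unfolding Fa_def Fb_def Fc_def by measurable
    have "AE x in lborel. AE v in lborel. R (w + ((\<alpha> * (e j w + hj) + \<beta> * x) - e j w) *\<^sub>R g) v"
      using AE_affine[OF ab(2) elim] .
    then have "AE x in lborel. AE x' in lborel. ennreal_powr (Fb x) s * ennreal_powr (Fc x') t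
        \<le> (Fa (s * x + t * x') * E) * ennreal (exp (s * t * (x - x')\<^sup>2 / 2))"
    proof (rule eventually_mono)
      fix x
      define y where "y = \<alpha> * (e j w + hj) + \<beta> * x"
      assume "AE v in lborel. R (w + ((\<alpha> * (e j w + hj) + \<beta> * x) - e j w) *\<^sub>R g) v"
      moreover have "w + ((\<alpha> * (e j w + hj) + \<beta> * x) - e j w) *\<^sub>R g = w' + y *\<^sub>R g"
        by (simp add: w'_def y_def algebra_simps)
      ultimately have "AE v in lborel. R (w' + y *\<^sub>R g) v" by (simp only:)
      then have "AE x' in lborel. R (w' + y *\<^sub>R g) ((\<alpha> * (e j w + kj) - y) + \<beta> * x')"
        by (rule AE_affine[OF ab(2)])
      then show "AE x' in lborel. ennreal_powr (Fb x) s * ennreal_powr (Fc x') t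
        \<le> (Fa (s * x + t * x') * E) * ennreal (exp (s * t * (x - x')\<^sup>2 / 2))"
      proof eventually_elim
        case (elim x')
        define v where "v = (\<alpha> * (e j w + kj) - y) + \<beta> * x'"
        have v: "v = - (\<alpha> * (hj - kj) + \<beta> * (x - x'))" by (simp add: v_def y_def algebra_simps)
        \<comment> \<open>Cauchy--Schwarz for the unit vector \<open>(\<alpha>, \<beta>)\<close>.\<close>
        have v2: "v\<^sup>2 \<le> (hj - kj)\<^sup>2 + (x - x')\<^sup>2"
        proof -
          have "(hj - kj)\<^sup>2 + (x - x')\<^sup>2 - v\<^sup>2 = (\<beta> * (hj - kj) - \<alpha> * (x - x'))\<^sup>2 + (1 - (\<alpha>\<^sup>2
              + \<beta>\<^sup>2)) * ((hj - kj)\<^sup>2 + (x - x')\<^sup>2)"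
            unfolding v by (simp add: power2_eq_square algebra_simps)
          also have "\<dots> \<ge> 0" using ab(1) by simp
          finally show ?thesis by (simp only: diff_ge_0_iff_ge)
        qed
        have b1: "b (w' + y *\<^sub>R g + \<iota> h0) = Fb x" by (simp add: Fb_def y_def algebra_simps)
        have c1: "c (w' + y *\<^sub>R g + \<iota> k0 + v *\<^sub>R g) = Fc x'"
          unfolding Fc_def by (rule arg_cong[where f=c]) (simp add: v_def algebra_simps)
        have a1: "a (w' + y *\<^sub>R g + \<iota> (s *\<^sub>R h0 + t *\<^sub>R k0) + (t * v) *\<^sub>R g) = Fa (s * x + t * x')"
        proof -
          have s: "s = 1 - t" using st by simp
          have "y + t * v = \<alpha> * (e j w + (s * hj + t * kj)) + \<beta> * (s * x + t * x')"
            unfolding s by (simp add: v_def y_def algebra_simps)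
          from this[symmetric] show ?thesis
            unfolding Fa_def by (simp only: scaleR_add_left add_ac)
        qed
        have "ennreal_powr (Fb x) s * ennreal_powr (Fc x') t
            \<le> Fa (s * x + t * x') * ennreal (exp (s * t * ((norm (h0 - k0))\<^sup>2 + v\<^sup>2) / 2))"
          using elim unfolding R_def v_def[symmetric] b1 c1 a1 .
        also have "\<dots> \<le> Fa (s * x + t * x') * ennreal (exp (s * t * (norm (h - k))\<^sup>2 / 2) * exp (s * t
            * (x - x')\<^sup>2 / 2))"
        proof -
          have "s * t * ((norm (h0 - k0))\<^sup>2 + v\<^sup>2) / 2
              \<le> s * t * (norm (h - k))\<^sup>2 / 2 + s * t * (x - x')\<^sup>2 / 2"
            unfolding hk add_divide_distrib[symmetric] distrib_left[symmetric]
            using v2 st by (intro divide_right_mono mult_left_mono) auto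
          then show ?thesis unfolding exp_add[symmetric] by (intro mult_left_mono ennreal_leI) auto
        qed
        also have "\<dots> = (Fa (s * x + t * x') * E) * ennreal (exp (s * t * (x - x')\<^sup>2 / 2))"
          by (simp add: E_def ennreal_mult mult.assoc)
        finally show ?case .
      qed
    qed
    then have "ennreal_powr (\<integral>\<^sup>+ x. Fb x \<partial>std_normal_distribution) s
        * ennreal_powr (\<integral>\<^sup>+ x. Fc x \<partial>std_normal_distribution) t
        \<le> (\<integral>\<^sup>+ x. Fa x * E \<partial>std_normal_distribution)"
      using st by (intro prekopa_leindler_gauss) auto
    also have "\<dots> = (\<integral>\<^sup>+ x. Fa x \<partial>std_normal_distribution) * E"
      by (rule nn_integral_multc) measurable
    also have "(\<integral>\<^sup>+ x. Fb x \<partial>std_normal_distribution) = line_avg \<alpha> \<beta> j b (w + \<iota> h)"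
      unfolding h avg[OF o1(1)] Fb_def ..
    also have "(\<integral>\<^sup>+ x. Fc x \<partial>std_normal_distribution) = line_avg \<alpha> \<beta> j c (w + \<iota> k)"
      unfolding k avg[OF o1(2)] Fc_def ..
    also have "(\<integral>\<^sup>+ x. Fa x \<partial>std_normal_distribution) = line_avg \<alpha> \<beta> j a (w + \<iota> (s *\<^sub>R h + t *\<^sub>R k))"
      unfolding shk avg[OF o2] Fa_def ..
    finally show ?case unfolding E_def .
  qed
qed

text \<open>
The extension to \<open>W\<close> of the orthogonal projection onto the span of the \<open>rep i\<close>, \<open>i \<in> J\<close>.
\<close>
definition projW :: "nat set \<Rightarrow> 'w \<Rightarrow> 'w" where
  "projW J w = (\<Sum>i\<in>J. e i w *\<^sub>R \<iota> (rep i))"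

lemma measurable_projW: "J \<subseteq> I \<Longrightarrow> projW J \<in> borel_measurable borel"
  unfolding projW_def using measurable_e
  by (intro borel_measurable_sum borel_measurable_scaleR_frechet) auto

lemma projW_add: "J \<subseteq> I \<Longrightarrow> projW J (x + y) = projW J x + projW J y"
  unfolding projW_def sum.distrib[symmetric] by (intro sum.cong) (auto simp: e_add scaleR_add_left)

lemma projW_scale: "J \<subseteq> I \<Longrightarrow> projW J (c *\<^sub>R x) = c *\<^sub>R projW J x"
  unfolding projW_def scaleR_sum_right by (intro sum.cong) (auto simp: e_scale)

lemma projW_rep: "J \<subseteq> I \<Longrightarrow> finite J \<Longrightarrow> j \<in> I \<Longrightarrow> projW J (\<iota> (rep j)) = (if j \<in> J then \<iota> (rep j) else 0)"
proof -
  assume J: "J \<subseteq> I" "finite J" and j: "j \<in> I"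
  have "projW J (\<iota> (rep j)) = (\<Sum>i\<in>J. if j = i then \<iota> (rep j) else 0)"
    unfolding projW_def using J j by (intro sum.cong) (auto simp: e_iota_rep)
  then show ?thesis using J by (simp add: sum.delta)
qed

lemma e_projW: "J \<subseteq> I \<Longrightarrow> finite J \<Longrightarrow> i \<in> I \<Longrightarrow> e i (projW J w) = (if i \<in> J then e i w else 0)"
proof -
  assume J: "J \<subseteq> I" "finite J" and i: "i \<in> I"
  have "e i (projW J w) = (\<Sum>j\<in>J. e i (e j w *\<^sub>R \<iota> (rep j)))"
    unfolding projW_def by (rule linear_sum[OF dual_linear[OF e_dual[OF i]]])
  also have "\<dots> = (\<Sum>j\<in>J. if i = j then e i w else 0)"
    using J i by (intro sum.cong) (auto simp: e_scale e_iota_rep)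
  finally show ?thesis using J by (simp add: sum.delta)
qed

definition coord_avg :: "real \<Rightarrow> real \<Rightarrow> nat set \<Rightarrow> ('w \<Rightarrow> ennreal) \<Rightarrow> 'w \<Rightarrow> ennreal" where
  "coord_avg \<alpha> \<beta> J G w = (\<integral>\<^sup>+ y. G (w + (\<alpha> - 1) *\<^sub>R projW J w + \<beta> *\<^sub>R projW J y) \<partial>\<mu>)"

lemma measurable_coord_avg:
  assumes J: "J \<subseteq> I" and G [measurable]: "G \<in> borel_measurable borel"
  shows "coord_avg \<alpha> \<beta> J G \<in> borel_measurable borel"
proof -
  note [measurable] = measurable_projW[OF J]
  show ?thesis unfolding coord_avg_def by measurable
qed

text \<open>
By \<open>line_image\<close> with \<open>\<alpha> = 0\<close>, the \<open>j\<close>-th coordinate of the integration variable may be replaced by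
an independent standard normal one.
\<close>
lemma coord_avg_insert:
  assumes J: "J \<subseteq> I" "finite J" and j: "j \<in> I" "j \<notin> J"
      and G [measurable]: "G \<in> borel_measurable borel"
  shows "coord_avg \<alpha> \<beta> (insert j J) G = line_avg \<alpha> \<beta> j (coord_avg \<alpha> \<beta> J G)"
proof
  fix w
  interpret S: prob_space std_normal_distribution by (rule std_normal_prob)
  interpret P: pair_prob_space \<mu> std_normal_distribution ..
  have iJ: "insert j J \<subseteq> I" using J j by auto
  note [measurable] = measurable_projW[OF J(1)] measurable_projW[OF iJ] measurable_e[OF j(1)]
  have ins: "projW (insert j J) x = e j x *\<^sub>R \<iota> (rep j) + projW J x" for x
    unfolding projW_def using J j by simp
  have PWf: "projW J (c *\<^sub>R \<iota> (rep j)) = 0" for c using J j by (simp add: projW_scale projW_rep)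
  define w0 where "w0 = w + (\<alpha> - 1) *\<^sub>R projW (insert j J) w"
  have "coord_avg \<alpha> \<beta> (insert j J) G w = (\<integral>\<^sup>+ y. G (w0 + \<beta> *\<^sub>R projW (insert j J) y) \<partial>\<mu>)"
    by (simp add: coord_avg_def w0_def)
  also have "\<dots> = (\<integral>\<^sup>+ y. \<integral>\<^sup>+ x. G (w0 + \<beta> *\<^sub>R projW (insert j J) (y + ((0 - 1) * e j y
      + 1 * x) *\<^sub>R \<iota> (riesz_rep \<iota> (e j)))) \<partial>std_normal_distribution \<partial>\<mu>)"
    by (rule nn_integral_line[OF e_dual[OF j(1)] norm_rep[OF j(1)]]) auto
  also have "\<dots> = (\<integral>\<^sup>+ y. \<integral>\<^sup>+ x. G (w0 + \<beta> *\<^sub>R (x *\<^sub>R \<iota> (rep j)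
      + projW J y)) \<partial>std_normal_distribution \<partial>\<mu>)"
  proof (intro nn_integral_cong arg_cong[where f=G] arg_cong[where f="\<lambda>z. w0 + \<beta> *\<^sub>R z"])
    fix x y
    show "projW (insert j J) (y + ((0 - 1) * e j y + 1 * x) *\<^sub>R \<iota> (riesz_rep \<iota> (e j)))
        = x *\<^sub>R \<iota> (rep j) + projW J y"
      unfolding rep_def[symmetric] ins e_add[OF j(1)] e_scale[OF j(1)] projW_add[OF J(1)] PWf
          e_iota_rep[OF j(1) j(1)] by simp
  qed
  also have "\<dots> = (\<integral>\<^sup>+ x. \<integral>\<^sup>+ y. G (w0 + \<beta> *\<^sub>R (x *\<^sub>R \<iota> (rep j)
      + projW J y)) \<partial>\<mu> \<partial>std_normal_distribution)"
    by (rule P.Fubini'[symmetric]) measurable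
  also have "\<dots> = line_avg \<alpha> \<beta> j (coord_avg \<alpha> \<beta> J G) w"
    unfolding line_avg_def coord_avg_def
  proof (intro nn_integral_cong arg_cong[where f=G])
    fix x y
    have "projW J (w + ((\<alpha> - 1) * e j w + \<beta> * x) *\<^sub>R \<iota> (rep j)) = projW J w"
      by (simp add: projW_add[OF J(1)] PWf)
    then show "w0 + \<beta> *\<^sub>R (x *\<^sub>R \<iota> (rep j) + projW J y) =
        w + ((\<alpha> - 1) * e j w + \<beta> * x) *\<^sub>R \<iota> (rep j) + (\<alpha> - 1) *\<^sub>R projW J (w + ((\<alpha> - 1) * e j w
            + \<beta> * x) *\<^sub>R \<iota> (rep j)) + \<beta> *\<^sub>R projW J y"
      by (simp add: w0_def ins algebra_simps)
  qed
  finally show "coord_avg \<alpha> \<beta> (insert j J) G w = line_avg \<alpha> \<beta> j (coord_avg \<alpha> \<beta> J G) w" .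
qed

lemma coord_avg_empty: "coord_avg \<alpha> \<beta> {} G = G"
  by (rule ext) (simp add: coord_avg_def projW_def emeasure_space_1[simplified])

lemma cond_P_coord_avg:
  assumes st: "0 \<le> s" "0 \<le> t" "s + t = 1" and ab: "\<alpha>\<^sup>2 + \<beta>\<^sup>2 = (1::real)" "\<beta> \<noteq> 0"
    and m: "a \<in> borel_measurable borel" "b \<in> borel_measurable borel" "c \<in> borel_measurable borel"
    and cond_P: "cond_P s t a b c" and J: "finite J" "J \<subseteq> I"
  shows "cond_P s t (coord_avg \<alpha> \<beta> J a) (coord_avg \<alpha> \<beta> J b) (coord_avg \<alpha> \<beta> J c)"
  using J
proof (induction J)
  case empty
  then show ?case using cond_P by (simp add: coord_avg_empty)
next
  case (insert j J)
  then have J: "J \<subseteq> I" "finite J" "j \<in> I" "j \<notin> J" by auto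
  show ?case
    unfolding coord_avg_insert[OF J m(1)] coord_avg_insert[OF J m(2)] coord_avg_insert[OF J m(3)]
    using insert J m by (intro cond_P_line_avg st ab measurable_coord_avg) auto
qed

end

section \<open>Approximation by functions of finitely many coordinates\<close>

text \<open>
A countable union is first replaced by a finite one, whose members are then approximated.
\<close>
lemma (in finite_measure) approximable_sets_sigma_algebra:
  assumes C: "C \<subseteq> sets M" "algebra (space M) C"
  defines "\<A> \<equiv> {B \<in> sets M. \<forall>\<epsilon>>0. \<exists>A\<in>C. measure M ((B - A) \<union> (A - B)) < \<epsilon>}"
  shows "sigma_algebra (space M) \<A>"
  unfolding sigma_algebra_iff2
proof (intro conjI ballI allI impI)
  interpret C: algebra "space M" C by fact
  show "\<A> \<subseteq> Pow (space M)" using sets.sets_into_space by (auto simp: \<A>_def)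
  show "{} \<in> \<A>" by (auto simp: \<A>_def intro!: bexI[of _ "{}"])
  show "space M - B \<in> \<A>" if B: "B \<in> \<A>" for B
    unfolding \<A>_def
  proof (intro CollectI conjI allI impI)
    show "space M - B \<in> sets M" using B by (auto simp: \<A>_def)
    fix \<epsilon> :: real assume "0 < \<epsilon>"
    then obtain A where A: "A \<in> C" "measure M ((B - A) \<union> (A - B)) < \<epsilon>" using B by (auto simp: \<A>_def)
    have "A \<subseteq> space M" "B \<subseteq> space M" using A B C sets.sets_into_space by (auto simp: \<A>_def)
    then have "(space M - B - (space M - A)) \<union> (space M - A - (space M - B)) = (B - A) \<union> (A - B)"
        by auto
    then show "\<exists>A\<in>C. measure M ((space M - B - A) \<union> (A - (space M - B))) < \<epsilon>"
      using A by (intro bexI[of _ "space M - A"]) auto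
  qed
  fix B :: "nat \<Rightarrow> 'a set" assume B: "range B \<subseteq> \<A>"
  have Bm: "B i \<in> sets M" for i using B by (auto simp: \<A>_def)
  show "(\<Union>i. B i) \<in> \<A>"
    unfolding \<A>_def
  proof (intro CollectI conjI allI impI)
    show "(\<Union>i. B i) \<in> sets M" using Bm by auto
    fix \<epsilon> :: real assume e: "0 < \<epsilon>"
    have "(\<lambda>n. measure M (\<Union>i<n. B i)) \<longlonglongrightarrow> measure M (\<Union>n. \<Union>i<n. B i)"
    proof (rule finite_Lim_measure_incseq)
      show "incseq (\<lambda>n. \<Union>i<n. B i)" by (intro incseq_SucI UN_mono) auto
    qed (use Bm in auto)
    moreover have "(\<Union>n. \<Union>i<n. B i) = (\<Union>i. B i)" by auto
    ultimately have "\<forall>\<^sub>F n in sequentially. dist (measure M (\<Union>i<n. B i)) (measure M (\<Union>i. B i)) < \<epsilon>/2"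
      using e by (intro tendstoD) auto
    then obtain n where n: "dist (measure M (\<Union>i<n. B i)) (measure M (\<Union>i. B i)) < \<epsilon>/2"
      by (auto simp: eventually_sequentially)
    have tail: "measure M ((\<Union>i. B i) - (\<Union>i<n. B i)) < \<epsilon>/2"
    proof -
      have "measure M ((\<Union>i. B i) - (\<Union>i<n. B i)) = measure M (\<Union>i. B i) - measure M (\<Union>i<n. B i)"
        using Bm by (intro finite_measure_Diff) auto
      then show ?thesis using n unfolding dist_real_def by linarith
    qed
    \<comment> \<open>The errors of the \<open>n\<close> approximating sets add up to at most \<open>\<epsilon>/2\<close>; the tail takes the other
    half.\<close>
    define \<delta> where "\<delta> = \<epsilon> / (2 * (real n + 1))"
    have d: "0 < \<delta>" using e by (simp add: \<delta>_def)
    have "\<forall>i. \<exists>A\<in>C. measure M ((B i - A) \<union> (A - B i)) < \<delta>" using B d by (auto simp: \<A>_def)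
    then obtain A where A: "\<And>i. A i \<in> C" "\<And>i. measure M ((B i - A i) \<union> (A i - B i)) < \<delta>" by metis
    have Am: "A i \<in> sets M" for i using A C by auto
    have "measure M (((\<Union>i. B i) - (\<Union>i<n. A i)) \<union> ((\<Union>i<n. A i) - (\<Union>i. B i)))
        \<le> measure M (((\<Union>i. B i) - (\<Union>i<n. B i)) \<union> (\<Union>i<n. (B i - A i) \<union> (A i - B i)))"
      using Am Bm by (intro finite_measure_mono) (blast, auto)
    also have "\<dots> \<le> measure M ((\<Union>i. B i) - (\<Union>i<n. B i))
        + measure M (\<Union>i<n. (B i - A i) \<union> (A i - B i))"
      using Am Bm by (intro measure_Un_le) auto
    also have "\<dots> \<le> measure M ((\<Union>i. B i) - (\<Union>i<n. B i))
        + (\<Sum>i<n. measure M ((B i - A i) \<union> (A i - B i)))"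
      using Am Bm by (intro add_left_mono measure_UNION_le) auto
    also have "(\<Sum>i<n. measure M ((B i - A i) \<union> (A i - B i))) \<le> (\<Sum>i<n. \<delta>)"
      using A(2) by (intro sum_mono) (auto intro: less_imp_le)
    also have "(\<Sum>i<n. \<delta>) \<le> \<epsilon>/2"
    proof -
      have "real n * \<delta> \<le> (real n + 1) * \<delta>" using d by simp
      also have "\<dots> = \<epsilon>/2" by (simp add: \<delta>_def field_simps)
      finally show ?thesis by simp
    qed
    finally have "measure M (((\<Union>i. B i) - (\<Union>i<n. A i)) \<union> ((\<Union>i<n. A i) - (\<Union>i. B i))) < \<epsilon>"
      using tail by simp
    moreover have "(\<Union>i<n. A i) \<in> C" using A(1) by (intro C.finite_UN) auto
    ultimately show "\<exists>A\<in>C. measure M (((\<Union>i. B i) - A) \<union> (A - (\<Union>i. B i))) < \<epsilon>" by blast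
  qed
qed

subsection \<open>A distance on the extended nonnegative reals\<close>

text \<open>
The distance on the extended half-line, with value 0 at \<open>(\<infinity>, \<infinity>)\<close>, where \<open>\<infinity> - \<infinity> = \<infinity>\<close> would spoil
the inequality \<open>ediff_nn_integral\<close>.
\<close>
definition ediff :: "ennreal \<Rightarrow> ennreal \<Rightarrow> ennreal" where
  "ediff x y = (if x = y then 0 else (x - y) + (y - x))"

text \<open>
This characterization makes the triangle inequality and the monotonicity of integrals
immediate.
\<close>
lemma ediff_le_iff: "ediff x y \<le> c \<longleftrightarrow> x \<le> y + c \<and> y \<le> x + c"
proof (cases "x = y")
  case False
  show ?thesis
  proof (cases "x \<le> y")
    case True
    have "x \<noteq> top" using True False by (auto simp: top_unique)
    moreover from this have "x - y = 0" using True
        by (intro diff_eq_0_ennreal) (auto simp: less_top)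
    ultimately show ?thesis using False True
      by (auto simp: ediff_def ennreal_minus_le_iff add_increasing2)
  next
    case ge: False
    then have "y \<noteq> top" by auto
    moreover from this have "y - x = 0" using ge by (intro diff_eq_0_ennreal) (auto simp: less_top)
    ultimately show ?thesis using False ge
      by (auto simp: ediff_def ennreal_minus_le_iff add_increasing2)
  qed
qed (auto simp: ediff_def)

lemma ediff_le1: "x \<le> y + ediff x y" and ediff_le2: "y \<le> x + ediff x y"
  using ediff_le_iff[of x y "ediff x y"] by auto

lemma ediff_commute: "ediff x y = ediff y x"
  by (rule antisym) (auto simp: ediff_le_iff ediff_le1 ediff_le2)

lemma ediff_self [simp]: "ediff x x = 0" by (simp add: ediff_def)

lemma ediff_triangle: "ediff x z \<le> ediff x y + ediff y z"
proof -
  have "x \<le> y + ediff x y" by (rule ediff_le1)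
  also have "\<dots> \<le> (z + ediff y z) + ediff x y" by (intro add_right_mono ediff_le1)
  finally have 1: "x \<le> z + (ediff x y + ediff y z)" by (simp add: ac_simps)
  have "z \<le> y + ediff y z" by (rule ediff_le2)
  also have "\<dots> \<le> (x + ediff x y) + ediff y z" by (intro add_right_mono ediff_le2)
  finally show ?thesis using 1 by (simp add: ediff_le_iff ac_simps)
qed

lemma ediff_add: "ediff (x + y) (x' + y') \<le> ediff x x' + ediff y y'"
proof -
  have "x + y \<le> (x' + ediff x x') + (y' + ediff y y')" by (intro add_mono ediff_le1)
  moreover have "x' + y' \<le> (x + ediff x x') + (y + ediff y y')" by (intro add_mono ediff_le2)
  ultimately show ?thesis by (simp add: ediff_le_iff ac_simps)
qed

lemma ediff_cmult: "ediff (c * x) (c * y) \<le> c * ediff x y"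
  unfolding ediff_le_iff distrib_left[symmetric]
  by (intro conjI mult_left_mono ediff_le1 ediff_le2) auto

lemma borel_measurable_ediff [measurable (raw)]:
  assumes [measurable]: "F \<in> borel_measurable M" "G \<in> borel_measurable M"
  shows "(\<lambda>x. ediff (F x) (G x)) \<in> borel_measurable M"
  unfolding ediff_def by measurable

lemma ediff_nn_integral:
  assumes [measurable]: "F \<in> borel_measurable M" "G \<in> borel_measurable M"
  shows "ediff (\<integral>\<^sup>+ x. F x \<partial>M) (\<integral>\<^sup>+ x. G x \<partial>M) \<le> (\<integral>\<^sup>+ x. ediff (F x) (G x) \<partial>M)"
  unfolding ediff_le_iff
  by (simp flip: nn_integral_add add: nn_integral_mono ediff_le1 ediff_le2)

lemma ediff_tendsto:
  assumes "(\<lambda>n. ediff (X n) x) \<longlonglongrightarrow> 0" shows "X \<longlonglongrightarrow> x"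
proof (cases "x = top")
  case True
  have "\<forall>\<^sub>F n in sequentially. ediff (X n) x < top" using assms by (intro order_tendstoD) auto
  then have "\<forall>\<^sub>F n in sequentially. X n = x"
  proof eventually_elim
    case (elim n)
    then show ?case using ediff_le2[of x "X n"] True by (auto simp: top_unique)
  qed
  then show ?thesis by (rule tendsto_eventually)
next
  case False
  show ?thesis
  proof (rule tendsto_sandwich)
    show "(\<lambda>n. x - ediff (X n) x) \<longlonglongrightarrow> x" using tendsto_diff_ennreal[OF tendsto_const assms False]
        by simp
    show "(\<lambda>n. x + ediff (X n) x) \<longlonglongrightarrow> x" using tendsto_add[OF tendsto_const assms, of x] by simp
    show "\<forall>\<^sub>F n in sequentially. x - ediff (X n) x \<le> X n"
      using ediff_le2[of x "X _"] False by (intro always_eventually allI)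
          (auto simp: ennreal_minus_le_iff add.commute)
    show "\<forall>\<^sub>F n in sequentially. X n \<le> x + ediff (X n) x"
      by (intro always_eventually allI ediff_le1)
  qed
qed

lemma nn_integral_tendsto_0_AE_subseq:
  fixes D :: "nat \<Rightarrow> 'a \<Rightarrow> ennreal"
  assumes "finite_measure M" and [measurable]: "\<And>n. D n \<in> borel_measurable M"
    and lim: "(\<lambda>n. \<integral>\<^sup>+ x. D n x \<partial>M) \<longlonglongrightarrow> 0"
  obtains r where "strict_mono r" "AE x in M. (\<lambda>n. D (r n) x) \<longlonglongrightarrow> 0"
proof -
  interpret finite_measure M by fact
  \<comment> \<open>Cut off at 1, the functions are real and integrable, and \<open>u n x \<longlonglongrightarrow> 0\<close> still forces
  \<open>D n x \<longlonglongrightarrow> 0\<close>.\<close>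
  define u where "u n x = enn2real (min (D n x) 1)" for n x
  have eu: "ennreal (u n x) = min (D n x) 1" for n x
    unfolding u_def by (rule ennreal_enn2real) (auto simp: min_def less_top intro: le_less_trans[of
        _ 1])
  have um [measurable]: "u n \<in> borel_measurable M" for n unfolding u_def by measurable
  have u0: "0 \<le> u n x" for n x by (simp add: u_def)
  have u1: "u n x \<le> 1" for n x
  proof -
    have "ennreal (u n x) \<le> ennreal 1" unfolding eu by simp
    then show ?thesis by (subst (asm) ennreal_le_iff) auto
  qed
  have int: "integrable M (u n)" for n
    using u0 u1 by (intro integrable_const_bound[where B=1]) auto
  have "(\<lambda>n. ennreal (\<integral>x. norm (u n x) \<partial>M)) \<longlonglongrightarrow> 0"
  proof (rule tendsto_sandwich[OF _ _ tendsto_const lim])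
    have "ennreal (\<integral>x. norm (u n x) \<partial>M) \<le> (\<integral>\<^sup>+ x. D n x \<partial>M)" for n
    proof -
      have "ennreal (\<integral>x. norm (u n x) \<partial>M) = (\<integral>\<^sup>+ x. ennreal (u n x) \<partial>M)"
        using int u0 by (subst nn_integral_eq_integral) auto
      also have "\<dots> \<le> (\<integral>\<^sup>+ x. D n x \<partial>M)" unfolding eu by (intro nn_integral_mono) simp
      finally show ?thesis .
    qed
    then show "\<forall>\<^sub>F n in sequentially. ennreal (\<integral>x. norm (u n x) \<partial>M) \<le> (\<integral>\<^sup>+ x. D n x \<partial>M)" by simp
  qed simp
  then have "(\<lambda>n. \<integral>x. norm (u n x) \<partial>M) \<longlonglongrightarrow> 0"
    by (subst (asm) ennreal_0[symmetric], subst (asm) tendsto_ennreal_iff) auto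
  from tendsto_L1_AE_subseq[OF int this] obtain r where r: "strict_mono r"
      "AE x in M. (\<lambda>n. u (r n) x) \<longlonglongrightarrow> 0" by auto
  show thesis
  proof (rule that[OF r(1)])
    show "AE x in M. (\<lambda>n. D (r n) x) \<longlonglongrightarrow> 0"
      using r(2)
    proof eventually_elim
      case (elim x)
      then have "(\<lambda>n. ennreal (u (r n) x)) \<longlonglongrightarrow> ennreal 0" by (rule tendsto_ennrealI)
      then have l: "(\<lambda>n. min (D (r n) x) 1) \<longlonglongrightarrow> 0" by (simp add: eu)
      then have "\<forall>\<^sub>F n in sequentially. min (D (r n) x) 1 < 1" by (intro order_tendstoD) auto
      then have "\<forall>\<^sub>F n in sequentially. D (r n) x = min (D (r n) x) 1"
          by eventually_elim (auto simp: min_def split: if_splits)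
      then show ?case using l by (simp add: tendsto_cong)
    qed
  qed
qed

context abstract_wiener_space
begin

lemma nn_integral_dual_unit:
  assumes l0: "l0 \<in> dual" "norm (riesz_rep \<iota> l0) = 1" and [measurable]: "\<phi> \<in> borel_measurable borel"
  shows "(\<integral>\<^sup>+ w. \<phi> (l0 w) \<partial>\<mu>) = (\<integral>\<^sup>+ x. \<phi> x \<partial>std_normal_distribution)"
proof -
  note [measurable] = dual_measurable[OF l0(1)]
  have 1: "l0 (\<iota> (riesz_rep \<iota> l0)) = 1"
    using l0(2) by (simp add: riesz_inner[OF l0(1)] norm_eq_sqrt_inner)
  have "(\<integral>\<^sup>+ w. \<phi> (l0 w) \<partial>\<mu>)
    = (\<integral>\<^sup>+ w. \<integral>\<^sup>+ x. \<phi> (l0 (w + ((0 - 1) * l0 w + 1 * x) *\<^sub>R \<iota>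
        (riesz_rep \<iota> l0))) \<partial>std_normal_distribution \<partial>\<mu>)"
    by (rule nn_integral_line[OF l0]) auto
  also have "\<dots> = (\<integral>\<^sup>+ w. \<integral>\<^sup>+ x. \<phi> x \<partial>std_normal_distribution \<partial>\<mu>)"
    by (simp add: linear_add[OF dual_linear[OF l0(1)]] linear_cmul[OF dual_linear[OF l0(1)]] 1)
  finally show ?thesis by (simp add: emeasure_space_1[simplified])
qed

text \<open>
A functional that vanishes on \<open>H\<close> vanishes on its closure, which is \<open>W\<close>.
\<close>
lemma dual_eq_0:
  assumes l: "l \<in> dual" and "riesz_rep \<iota> l = 0" shows "l w = 0"
proof -
  have "l x = 0" if "x \<in> range \<iota>" for x using that assms by (auto simp: riesz_inner)
  moreover have "continuous_on (closure (range \<iota>)) l" using dual_continuous[OF l]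
      by (rule continuous_on_subset) auto
  ultimately show ?thesis using continuous_constant_on_closure[of "range \<iota>" l 0 w] dense_inj by auto
qed

text \<open>
A functional \<open>l\<close> is normal with variance \<open>|l|\<^sup>2\<close>, so convergence in \<open>H\<close> implies convergence in
\<open>L\<^sup>1(\<mu>)\<close>.
\<close>
lemma nn_integral_abs_dual:
  assumes l: "l \<in> dual"
  shows "(\<integral>\<^sup>+ w. ennreal \<bar>l w\<bar> \<partial>\<mu>) = ennreal (norm (riesz_rep \<iota> l))
      * (\<integral>\<^sup>+ x. ennreal \<bar>x\<bar> \<partial>std_normal_distribution)"
proof (cases "riesz_rep \<iota> l = 0")
  case True
  then show ?thesis using dual_eq_0[OF l True] by simp
next
  case False
  define n where "n = norm (riesz_rep \<iota> l)"
  have n: "0 < n" using False by (simp add: n_def)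
  define l0 where "l0 = (\<lambda>w. (1/n) * l w)"
  have l0: "l0 \<in> dual" unfolding l0_def by (rule dual_scale[OF l])
  have "riesz_rep \<iota> l0 = (1/n) *\<^sub>R riesz_rep \<iota> l"
    by (rule riesz_unique) (simp add: l0_def riesz_inner[OF l])
  then have n0: "norm (riesz_rep \<iota> l0) = 1" using n by (simp add: n_def)
  note [measurable] = dual_measurable[OF l0]
  have "(\<integral>\<^sup>+ w. ennreal \<bar>l w\<bar> \<partial>\<mu>) = (\<integral>\<^sup>+ w. ennreal n * ennreal \<bar>l0 w\<bar> \<partial>\<mu>)"
    using n by (intro nn_integral_cong) (simp add: l0_def ennreal_mult[symmetric])
  also have "\<dots> = ennreal n * (\<integral>\<^sup>+ w. ennreal \<bar>l0 w\<bar> \<partial>\<mu>)" by (rule nn_integral_cmult) measurable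
  also have "(\<integral>\<^sup>+ w. ennreal \<bar>l0 w\<bar> \<partial>\<mu>) = (\<integral>\<^sup>+ x. ennreal \<bar>x\<bar> \<partial>std_normal_distribution)"
    by (rule nn_integral_dual_unit[OF l0 n0]) measurable
  finally show ?thesis by (simp add: n_def)
qed

end

context wiener_basis
begin

definition first :: "nat \<Rightarrow> nat set" where "first n = I \<inter> {1..n}"

lemma first_subset: "first n \<subseteq> I" and finite_first: "finite (first n)"
  by (auto simp: first_def)

lemma first_mono: "m \<le> n \<Longrightarrow> first m \<subseteq> first n" by (auto simp: first_def)

lemma mem_first: "i \<in> I \<Longrightarrow> i \<in> first n \<longleftrightarrow> i \<le> n"
  using basis by (auto simp: first_def dual_basis_def)

text \<open>
Dependence on the coordinates in \<open>J\<close> alone, as a pointwise property: averages that move only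
other coordinates then leave the function unchanged at every point.
\<close>
definition depends :: "nat set \<Rightarrow> ('w \<Rightarrow> 'b) \<Rightarrow> bool" where
  "depends J F \<longleftrightarrow> (\<forall>w w'. (\<forall>i\<in>J. e i w = e i w') \<longrightarrow> F w = F w')"

lemma dependsD: "depends J F \<Longrightarrow> (\<And>i. i \<in> J \<Longrightarrow> e i w = e i w') \<Longrightarrow> F w = F w'"
  by (auto simp: depends_def)

lemma depends_mono: "depends J F \<Longrightarrow> J \<subseteq> K \<Longrightarrow> depends K F"
  unfolding depends_def by blast

definition cylinder_sets :: "'w set set" where
  "cylinder_sets = {B \<in> sets borel. \<exists>n. depends (first n) (\<lambda>w. w \<in> B)}"

lemma algebra_cylinder_sets: "algebra UNIV cylinder_sets"
  unfolding algebra_iff_Un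
proof (intro conjI ballI)
  show "cylinder_sets \<subseteq> Pow UNIV" by auto
  show "{} \<in> cylinder_sets" by (auto simp: cylinder_sets_def depends_def)
  show "UNIV - A \<in> cylinder_sets" if "A \<in> cylinder_sets" for A
    using that by (auto simp: cylinder_sets_def depends_def)
  show "A \<union> B \<in> cylinder_sets" if AB: "A \<in> cylinder_sets" "B \<in> cylinder_sets" for A B
  proof -
    from AB obtain m n where mn: "depends (first m) (\<lambda>w. w \<in> A)" "depends (first n) (\<lambda>w. w \<in> B)"
      by (auto simp: cylinder_sets_def)
    have "depends (first (max m n)) (\<lambda>w. w \<in> A)" by (rule depends_mono[OF mn(1) first_mono]) simp
    moreover have "depends (first (max m n)) (\<lambda>w. w \<in> B)"
        by (rule depends_mono[OF mn(2) first_mono]) simp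
    ultimately have "depends (first (max m n)) (\<lambda>w. w \<in> A \<union> B)" unfolding depends_def Un_iff
        by blast
    then show ?thesis using AB unfolding cylinder_sets_def by blast
  qed
qed

text \<open>
These sets form a sigma-algebra that contains the null sets and all the sets \<open>{e i \<in> A}\<close>; the
aim is to see that it contains every half-space, hence every Borel set.
\<close>
definition approx_sets :: "'w set set" where
  "approx_sets = {B \<in> sets \<mu>. \<forall>\<epsilon>>0. \<exists>A\<in>cylinder_sets. measure \<mu> ((B - A) \<union> (A - B)) < \<epsilon>}"

lemma sigma_algebra_approx: "sigma_algebra UNIV approx_sets"
  using approximable_sets_sigma_algebra[of cylinder_sets] algebra_cylinder_sets
  by (auto simp: approx_sets_def cylinder_sets_def sets_mu)

lemma cylinder_approx: "B \<in> cylinder_sets \<Longrightarrow> B \<in> approx_sets"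
  by (auto simp: approx_sets_def cylinder_sets_def sets_mu intro!: bexI[of _ B])

lemma approx_AE_eq:
  assumes B: "B \<in> approx_sets" and B': "B' \<in> sets borel" and eq: "AE w in \<mu>. w \<in> B \<longleftrightarrow> w \<in> B'"
  shows "B' \<in> approx_sets"
  unfolding approx_sets_def
proof (intro CollectI conjI allI impI)
  show "B' \<in> sets \<mu>" using B' by (simp add: sets_mu)
  fix \<epsilon> :: real assume "0 < \<epsilon>"
  then obtain A where A: "A \<in> cylinder_sets" "measure \<mu> ((B - A) \<union> (A - B)) < \<epsilon>"
    using B by (auto simp: approx_sets_def)
  have "measure \<mu> ((B - A) \<union> (A - B)) = measure \<mu> ((B' - A) \<union> (A - B'))"
    using A(1) B B' eq
    by (intro finite_measure_eq_AE) (auto simp: approx_sets_def cylinder_sets_def sets_mu elim: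
        eventually_mono)
  then show "\<exists>A\<in>cylinder_sets. measure \<mu> ((B' - A) \<union> (A - B')) < \<epsilon>" using A by auto
qed

definition approx_alg :: "'w measure" where "approx_alg = sigma UNIV approx_sets"

lemma sets_approx_alg: "sets approx_alg = approx_sets" and space_approx_alg: "space approx_alg
    = UNIV"
  using sigma_algebra.sets_measure_of_eq[OF sigma_algebra_approx] by (auto simp: approx_alg_def)

lemma measurable_e_approx: assumes i: "i \<in> I" shows "e i \<in> borel_measurable approx_alg"
proof (rule measurableI)
  fix A :: "real set" assume A: "A \<in> sets borel"
  have "depends (first i) (\<lambda>w. w \<in> e i -` A)"
    unfolding depends_def using i mem_first[OF i, of i] by auto
  moreover have "e i -` A \<in> sets borel" using measurable_sets[OF measurable_e[OF i] A] by simp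
  ultimately have "e i -` A \<in> approx_sets" by (intro cylinder_approx) (auto simp: cylinder_sets_def)
  then show "e i -` A \<inter> space approx_alg \<in> sets approx_alg"
      by (simp add: sets_approx_alg space_approx_alg)
qed simp

text \<open>
The Riesz representative of \<open>l\<close> is a limit in \<open>H\<close> of combinations of the \<open>e i\<close>, so \<open>l\<close> is almost
surely the limit of a sequence of such combinations.
\<close>
lemma dual_sublevel_approx:
  assumes l: "l \<in> dual" shows "{w. l w \<le> c} \<in> approx_sets"
proof -
  \<comment> \<open>The representatives of functionals measurable for the approximable sets form a subspace that contains the basis.\<close>
  define D where "D = {r. \<exists>m\<in>dual. riesz_rep \<iota> m = r \<and> m \<in> borel_measurable approx_alg}"
  have "subspace D"
  proof (rule subspaceI)
    have "riesz_rep \<iota> (\<lambda>_. 0) = 0" by (rule riesz_unique) simp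
    then show "0 \<in> D" unfolding D_def using dual_zero by (auto intro!: bexI[of _ "\<lambda>_. 0"])
    fix x y c assume "x \<in> D" "y \<in> D"
    then obtain m m' where m: "m \<in> dual" "riesz_rep \<iota> m = x" "m \<in> borel_measurable approx_alg"
      and m': "m' \<in> dual" "riesz_rep \<iota> m' = y" "m' \<in> borel_measurable approx_alg"
          by (auto simp: D_def)
    have "riesz_rep \<iota> (\<lambda>w. m w + m' w) = x + y"
      by (rule riesz_unique) (simp add: riesz_inner m(1) m'(1) m(2)[symmetric] m'(2)[symmetric]
          inner_add_left)
    then show "x + y \<in> D" unfolding D_def using m m'
        by (auto intro!: bexI[of _ "\<lambda>w. m w + m' w"] dual_add)
    have "riesz_rep \<iota> (\<lambda>w. c * m w) = c *\<^sub>R x"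
      by (rule riesz_unique) (simp add: riesz_inner m(1) m(2)[symmetric])
    then show "c *\<^sub>R x \<in> D" unfolding D_def using m
        by (auto intro!: bexI[of _ "\<lambda>w. c * m w"] dual_scale)
  qed
  moreover have "(\<lambda>i. riesz_rep \<iota> (e i)) ` I \<subseteq> D" using e_dual measurable_e_approx
      by (auto simp: D_def)
  ultimately have "span ((\<lambda>i. riesz_rep \<iota> (e i)) ` I) \<subseteq> D" by (rule span_minimal[rotated])
  from closure_mono[OF this] basis have "closure D = UNIV" by (auto simp: dual_basis_def)
  then have "riesz_rep \<iota> l \<in> closure D" by simp
  then obtain X where X: "\<And>n. X n \<in> D" "X \<longlonglongrightarrow> riesz_rep \<iota> l" unfolding closure_sequential by auto
  then have "\<forall>n. \<exists>m\<in>dual. riesz_rep \<iota> m = X n \<and> m \<in> borel_measurable approx_alg"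
      by (auto simp: D_def)
  then obtain m where m: "\<And>n. m n \<in> dual" "\<And>n. riesz_rep \<iota> (m n)
      = X n" "\<And>n. m n \<in> borel_measurable approx_alg" by metis
  note [measurable] = dual_measurable[OF l] dual_measurable[OF m(1)]
  let ?\<kappa> = "\<integral>\<^sup>+ x. ennreal \<bar>x\<bar> \<partial>std_normal_distribution"
  have "integrable std_normal_distribution (\<lambda>x. \<bar>x\<bar>)"
    using integrable_std_normal_distribution_moment[of 1] by simp
  then have \<kappa>: "?\<kappa> < top" by (subst nn_integral_eq_integral) auto
  have eq: "(\<integral>\<^sup>+ w. ennreal \<bar>m n w - l w\<bar> \<partial>\<mu>) = ennreal (norm (X n - riesz_rep \<iota> l)) * ?\<kappa>" for n
  proof -
    have "riesz_rep \<iota> (\<lambda>w. m n w - l w) = X n - riesz_rep \<iota> l"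
      by (rule riesz_unique) (simp add: riesz_inner m(1) l m(2)[symmetric] inner_diff_left)
    then show ?thesis using nn_integral_abs_dual[OF dual_diff[OF m(1)[of n] l]] by simp
  qed
  have "(\<lambda>n. ennreal (norm (X n - riesz_rep \<iota> l)) * ?\<kappa>) \<longlonglongrightarrow> ennreal 0 * ?\<kappa>"
  proof (intro tendsto_mult_ennreal tendsto_ennrealI tendsto_const)
    have "(\<lambda>n. norm (X n - riesz_rep \<iota> l)) \<longlonglongrightarrow> norm (riesz_rep \<iota> l - riesz_rep \<iota> l)"
      by (intro tendsto_intros X)
    then show "(\<lambda>n. norm (X n - riesz_rep \<iota> l)) \<longlonglongrightarrow> 0" by simp
  qed (use \<kappa> in auto)
  then have "(\<lambda>n. \<integral>\<^sup>+ w. ennreal \<bar>m n w - l w\<bar> \<partial>\<mu>) \<longlonglongrightarrow> 0" by (simp add: eq)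
  then obtain r where r: "strict_mono r" "AE w in \<mu>. (\<lambda>n. ennreal \<bar>m (r n) w - l w\<bar>) \<longlonglongrightarrow> 0"
    using nn_integral_tendsto_0_AE_subseq[OF finite_measure_axioms, of "\<lambda>n w. ennreal \<bar>m n w - l
        w\<bar>"] by auto
  define l' where "l' w = lim (\<lambda>n. m (r n) w)" for w
  have "AE w in \<mu>. l' w = l w"
    using r(2)
  proof eventually_elim
    case (elim w)
    then have "(\<lambda>n. \<bar>m (r n) w - l w\<bar>) \<longlonglongrightarrow> 0"
      by (subst (asm) ennreal_0[symmetric], subst (asm) tendsto_ennreal_iff) auto
    then have "(\<lambda>n. m (r n) w - l w) \<longlonglongrightarrow> 0" by (rule tendsto_rabs_zero_cancel)
    then have "(\<lambda>n. m (r n) w) \<longlonglongrightarrow> l w" by (rule LIM_zero_cancel)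
    then show ?case unfolding l'_def by (rule limI)
  qed
  then have ae: "AE w in \<mu>. w \<in> {w. l' w \<le> c} \<longleftrightarrow> w \<in> {w. l w \<le> c}" by eventually_elim auto
  have "l' \<in> borel_measurable approx_alg" unfolding l'_def using m(3) by measurable
  then have "{w \<in> space approx_alg. l' w \<le> c} \<in> sets approx_alg" by measurable
  then have "{w. l' w \<le> c} \<in> approx_sets" by (simp add: sets_approx_alg space_approx_alg)
  then show ?thesis by (rule approx_AE_eq[OF _ _ ae]) measurable
qed

lemma borel_subset_approx: "sets borel \<subseteq> approx_sets"
proof -
  interpret sigma_algebra UNIV approx_sets by (rule sigma_algebra_approx)
  show ?thesis unfolding borel_eq_sigma_dual using dual_sublevel_approx
      by (intro sigma_sets_subset) auto
qed

definition approximable :: "('w \<Rightarrow> ennreal) \<Rightarrow> bool" where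
  "approximable G \<longleftrightarrow> (\<forall>\<epsilon>>0. \<exists>n G'. G' \<in> borel_measurable borel \<and> depends (first n) G'
      \<and> (\<integral>\<^sup>+ w. ediff (G w) (G' w) \<partial>\<mu>) \<le> ennreal \<epsilon>)"

lemma approximableD:
  assumes "approximable G" "0 < \<epsilon>"
  obtains n G' where "G' \<in> borel_measurable borel" "depends (first n) G'"
      "(\<integral>\<^sup>+ w. ediff (G w) (G' w) \<partial>\<mu>) \<le> ennreal \<epsilon>"
  using assms unfolding approximable_def by blast

lemma approximable_indicator:
  assumes B [measurable]: "B \<in> sets borel" shows "approximable (indicator B)"
  unfolding approximable_def
proof (intro allI impI)
  fix \<epsilon> :: real assume "0 < \<epsilon>"
  moreover have "B \<in> approx_sets" using borel_subset_approx B by blast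
  ultimately obtain A where A: "A \<in> cylinder_sets" "measure \<mu> ((B - A) \<union> (A - B)) < \<epsilon>"
    unfolding approx_sets_def by blast
  then obtain n where n: "depends (first n) (\<lambda>w. w \<in> A)" and [measurable]: "A \<in> sets borel"
    by (auto simp: cylinder_sets_def)
  have "(\<integral>\<^sup>+ w. ediff (indicator B w) (indicator A w) \<partial>\<mu>)
      = (\<integral>\<^sup>+ w. indicator ((B - A) \<union> (A - B)) w \<partial>\<mu>)"
    by (intro nn_integral_cong) (auto simp: ediff_def split: split_indicator)
  also have "\<dots> = emeasure \<mu> ((B - A) \<union> (A - B))" by (rule nn_integral_indicator) (simp add: sets_mu)
  also have "\<dots> \<le> ennreal \<epsilon>" using A(2) by (simp add: emeasure_eq_measure ennreal_leI)
  finally have "(\<integral>\<^sup>+ w. ediff (indicator B w) (indicator A w) \<partial>\<mu>) \<le> ennreal \<epsilon>" .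
  moreover have "depends (first n) (indicator A :: 'w \<Rightarrow> ennreal)"
    using n by (auto simp: depends_def indicator_def)
  ultimately show "\<exists>n G'. G' \<in> borel_measurable borel \<and> depends (first n) G'
      \<and> (\<integral>\<^sup>+ w. ediff (indicator B w) (G' w) \<partial>\<mu>) \<le> ennreal \<epsilon>"
    by (intro exI[of _ n] exI[of _ "indicator A"]) auto
qed

lemma approximable_integrable:
  assumes "G \<in> borel_measurable borel" "(\<integral>\<^sup>+ w. G w \<partial>\<mu>) < top"
  shows "approximable G"
  using assms
proof (induction rule: borel_measurable_induct)
  case (cong F G)
  then have "F = G" by auto
  then show ?case using cong by simp
next
  case (set A)
  then show ?case by (intro approximable_indicator)
next
  case (mult u c)
  note [measurable] = mult(2)
  show ?case
  proof (cases "c = 0")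
    case True
    have "(indicator {} :: 'w \<Rightarrow> ennreal) = (\<lambda>_. 0)" by auto
    then show ?thesis using approximable_indicator[of "{}"] True by simp
  next
    case False
    have "(\<integral>\<^sup>+ w. c * u w \<partial>\<mu>) = c * (\<integral>\<^sup>+ w. u w \<partial>\<mu>)" by (rule nn_integral_cmult) measurable
    with mult(5) False have "(\<integral>\<^sup>+ w. u w \<partial>\<mu>) < top" by (auto simp: ennreal_mult_less_top)
    then have ap: "approximable u" by (rule mult(4))
    obtain r where r: "c = ennreal r" "0 \<le> r" using mult(1) by (cases c) auto
    then have r0: "0 < r" using False by (cases "r = 0") auto
    show ?thesis
      unfolding approximable_def
    proof (intro allI impI)
      fix \<epsilon> :: real assume e: "0 < \<epsilon>"
      then have er: "0 < \<epsilon>/r" using r0 by simp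
      obtain n G' where G: "G' \<in> borel_measurable borel" "depends (first n) G'"
          "(\<integral>\<^sup>+ w. ediff (u w) (G' w) \<partial>\<mu>) \<le> ennreal (\<epsilon>/r)"
        by (rule approximableD[OF ap er])
      note [measurable] = G(1)
      have "(\<integral>\<^sup>+ w. ediff (c * u w) (c * G' w) \<partial>\<mu>) \<le> (\<integral>\<^sup>+ w. c * ediff (u w) (G' w) \<partial>\<mu>)"
        by (intro nn_integral_mono ediff_cmult)
      also have "\<dots> = c * (\<integral>\<^sup>+ w. ediff (u w) (G' w) \<partial>\<mu>)" by (rule nn_integral_cmult) measurable
      also have "\<dots> \<le> ennreal r * ennreal (\<epsilon>/r)" unfolding r(1) using G(3)
          by (rule mult_left_mono) simp
      also have "\<dots> = ennreal \<epsilon>" using r0 e by (simp add: ennreal_mult[symmetric])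
      finally have "(\<integral>\<^sup>+ w. ediff (c * u w) (c * G' w) \<partial>\<mu>) \<le> ennreal \<epsilon>" .
      moreover have "depends (first n) (\<lambda>w. c * G' w)"
        using G(2) unfolding depends_def by metis
      ultimately show "\<exists>n G'. G' \<in> borel_measurable borel \<and> depends (first n) G'
          \<and> (\<integral>\<^sup>+ w. ediff (c * u w) (G' w) \<partial>\<mu>) \<le> ennreal \<epsilon>"
        by (intro exI[of _ n] exI[of _ "\<lambda>w. c * G' w"]) auto
    qed
  qed
next
  case (add u v)
  have [measurable]: "u \<in> borel_measurable borel" "v \<in> borel_measurable borel" using add by auto
  have le: "(\<integral>\<^sup>+ w. u w \<partial>\<mu>) \<le> (\<integral>\<^sup>+ w. v w + u w \<partial>\<mu>)" "(\<integral>\<^sup>+ w. v w \<partial>\<mu>) \<le> (\<integral>\<^sup>+ w. v w + u w \<partial>\<mu>)"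
    by (intro nn_integral_mono; simp add: add_increasing add_increasing2)+
  then have ap: "approximable u" "approximable v" using add by (auto intro: le_less_trans)
  show ?case
    unfolding approximable_def
  proof (intro allI impI)
    fix \<epsilon> :: real assume e: "0 < \<epsilon>"
    obtain n U where U: "U \<in> borel_measurable borel" "depends (first n) U"
        "(\<integral>\<^sup>+ w. ediff (u w) (U w) \<partial>\<mu>) \<le> ennreal (\<epsilon>/2)"
      by (rule approximableD[OF ap(1) half_gt_zero[OF e]])
    obtain m V where V: "V \<in> borel_measurable borel" "depends (first m) V"
        "(\<integral>\<^sup>+ w. ediff (v w) (V w) \<partial>\<mu>) \<le> ennreal (\<epsilon>/2)"
      by (rule approximableD[OF ap(2) half_gt_zero[OF e]])
    note [measurable] = U(1) V(1)
    have "(\<integral>\<^sup>+ w. ediff (v w + u w) (V w + U w) \<partial>\<mu>)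
        \<le> (\<integral>\<^sup>+ w. ediff (v w) (V w) + ediff (u w) (U w) \<partial>\<mu>)"
      by (intro nn_integral_mono ediff_add)
    also have "\<dots> = (\<integral>\<^sup>+ w. ediff (v w) (V w) \<partial>\<mu>) + (\<integral>\<^sup>+ w. ediff (u w) (U w) \<partial>\<mu>)"
        by (rule nn_integral_add) measurable
    also have "\<dots> \<le> ennreal (\<epsilon>/2) + ennreal (\<epsilon>/2)" using U(3) V(3) by (intro add_mono)
    also have "\<dots> = ennreal \<epsilon>" using e by (simp flip: ennreal_plus)
    finally have "(\<integral>\<^sup>+ w. ediff (v w + u w) (V w + U w) \<partial>\<mu>) \<le> ennreal \<epsilon>" .
    moreover have "depends (first (max m n)) (\<lambda>w. V w + U w)"
    proof -
      have "depends (first (max m n)) V" by (rule depends_mono[OF V(2) first_mono]) simp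
      moreover have "depends (first (max m n)) U" by (rule depends_mono[OF U(2) first_mono]) simp
      ultimately show ?thesis unfolding depends_def by metis
    qed
    ultimately show "\<exists>n G'. G' \<in> borel_measurable borel \<and> depends (first n) G'
        \<and> (\<integral>\<^sup>+ w. ediff (v w + u w) (G' w) \<partial>\<mu>) \<le> ennreal \<epsilon>"
      by (intro exI[of _ "max m n"] exI[of _ "\<lambda>w. V w + U w"]) auto
  qed
next
  case (seq U)
  have Um [measurable]: "\<And>i. U i \<in> borel_measurable borel" and Ufin: "\<And>i w. U i w < top"
    and IH: "\<And>i. (\<integral>\<^sup>+ w. U i w \<partial>\<mu>) < top \<Longrightarrow> approximable (U i)" and inc: "incseq U"
    using seq by auto
  let ?S = "\<lambda>w. SUP i. U i w"
  have SUP: "(SUP i. U i) = ?S" by (auto simp: fun_eq_iff image_comp)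
  have fin: "(\<integral>\<^sup>+ w. ?S w \<partial>\<mu>) < top" using seq.prems by (simp add: SUP)
  have le: "U i w \<le> ?S w" for i w by (auto intro: SUP_upper)
  have conv: "(\<integral>\<^sup>+ w. ?S w \<partial>\<mu>) = (SUP i. \<integral>\<^sup>+ w. U i w \<partial>\<mu>)"
    by (rule nn_integral_monotone_convergence_SUP[OF inc]) measurable
  show ?case
    unfolding approximable_def SUP
  proof (intro allI impI)
    fix \<epsilon> :: real assume e: "0 < \<epsilon>"
    have fi: "(\<integral>\<^sup>+ w. U i w \<partial>\<mu>) < top" for i
      by (rule le_less_trans[OF _ fin]) (intro nn_integral_mono le)
    obtain i where i: "(\<integral>\<^sup>+ w. ?S w \<partial>\<mu>) \<le> (\<integral>\<^sup>+ w. U i w \<partial>\<mu>) + ennreal (\<epsilon>/2)"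
      using SUP_approx_ennreal[OF half_gt_zero[OF e] UNIV_not_empty conv] fin
          by (auto simp: less_top dest: less_imp_le)
    have "(\<integral>\<^sup>+ w. ediff (?S w) (U i w) \<partial>\<mu>) \<le> (\<integral>\<^sup>+ w. ?S w - U i w \<partial>\<mu>)"
    proof (intro nn_integral_mono)
      fix w
      show "ediff (?S w) (U i w) \<le> ?S w - U i w"
        using le[of i w] ennreal_minus_le_iff[of "?S w" "U i w" "?S w - U i w"]
        by (simp add: ediff_le_iff add_increasing2)
    qed
    also have "\<dots> = (\<integral>\<^sup>+ w. ?S w \<partial>\<mu>) - (\<integral>\<^sup>+ w. U i w \<partial>\<mu>)"
      using fi[of i] le by (intro nn_integral_diff) auto
    also have "\<dots> \<le> ennreal (\<epsilon>/2)" using i fi[of i] by (auto simp: ennreal_minus_le_iff)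
    finally have 1: "(\<integral>\<^sup>+ w. ediff (?S w) (U i w) \<partial>\<mu>) \<le> ennreal (\<epsilon>/2)" .
    obtain n G where G: "G \<in> borel_measurable borel" "depends (first n) G"
        "(\<integral>\<^sup>+ w. ediff (U i w) (G w) \<partial>\<mu>) \<le> ennreal (\<epsilon>/2)"
      by (rule approximableD[OF IH[OF fi[of i]] half_gt_zero[OF e]])
    note [measurable] = G(1)
    have "(\<integral>\<^sup>+ w. ediff (?S w) (G w) \<partial>\<mu>) \<le> (\<integral>\<^sup>+ w. ediff (?S w) (U i w) + ediff (U i w) (G w) \<partial>\<mu>)"
      by (intro nn_integral_mono ediff_triangle)
    also have "\<dots> = (\<integral>\<^sup>+ w. ediff (?S w) (U i w) \<partial>\<mu>) + (\<integral>\<^sup>+ w. ediff (U i w) (G w) \<partial>\<mu>)"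
        by (rule nn_integral_add) measurable
    also have "\<dots> \<le> ennreal (\<epsilon>/2) + ennreal (\<epsilon>/2)" using 1 G(3) by (intro add_mono)
    also have "\<dots> = ennreal \<epsilon>" using e by (simp flip: ennreal_plus)
    finally show "\<exists>n G'. G' \<in> borel_measurable borel \<and> depends (first n) G'
        \<and> (\<integral>\<^sup>+ w. ediff (?S w) (G' w) \<partial>\<mu>) \<le> ennreal \<epsilon>"
      using G by blast
  qed
qed

end

section \<open>Averages over Gaussian rotations\<close>

lemma ennreal_tendsto_0I:
  fixes X :: "nat \<Rightarrow> ennreal"
  assumes "\<And>\<epsilon>. 0 < \<epsilon> \<Longrightarrow> \<exists>n. \<forall>m\<ge>n. X m \<le> ennreal \<epsilon>"
  shows "X \<longlonglongrightarrow> 0"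
proof (rule order_tendstoI)
  fix a :: ennreal assume "0 < a"
  then obtain x where x: "0 < x" "x < a" using dense by blast
  then obtain r where r: "x = ennreal r" "0 < r" by (cases x) (auto simp: top.not_eq_extremum)
  obtain n where "\<forall>m\<ge>n. X m \<le> ennreal r" using assms[OF r(2)] by blast
  then show "\<forall>\<^sub>F m in sequentially. X m < a"
    using x(2) unfolding r(1) by (auto simp: eventually_sequentially intro: le_less_trans)
qed simp

definition (in abstract_wiener_space) avg :: "('w \<Rightarrow> 'w) \<Rightarrow> ('w \<Rightarrow> 'w) \<Rightarrow>
    ('w \<Rightarrow> ennreal) \<Rightarrow> 'w \<Rightarrow> ennreal" where
  "avg A B G w = (\<integral>\<^sup>+ y. G (A w + B y) \<partial>\<mu>)"

text \<open>
The invariance of \<open>\<mu>\<close> on which all properties of \<open>avg\<close> rest.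
\<close>
definition (in abstract_wiener_space) rotation :: "('w \<Rightarrow> 'w) \<Rightarrow> ('w \<Rightarrow> 'w) \<Rightarrow> bool" where
  "rotation A B \<longleftrightarrow> A \<in> borel_measurable borel \<and> B \<in> borel_measurable borel \<and>
    distr (\<mu> \<Otimes>\<^sub>M \<mu>) borel (\<lambda>z. A (fst z) + B (snd z)) = \<mu>"

context abstract_wiener_space
begin

lemma measurable_avg:
  assumes "rotation A B" and [measurable]: "G \<in> borel_measurable borel"
  shows "avg A B G \<in> borel_measurable borel"
proof -
  have [measurable]: "A \<in> borel_measurable borel" "B \<in> borel_measurable borel" using assms
      by (auto simp: rotation_def)
  show ?thesis unfolding avg_def by measurable
qed

lemma nn_integral_avg:
  assumes r: "rotation A B" and G [measurable]: "G \<in> borel_measurable borel"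
  shows "(\<integral>\<^sup>+ w. avg A B G w \<partial>\<mu>) = (\<integral>\<^sup>+ w. G w \<partial>\<mu>)"
proof -
  have [measurable]: "A \<in> borel_measurable borel" "B \<in> borel_measurable borel" using r
      by (auto simp: rotation_def)
  have "(\<integral>\<^sup>+ w. G w \<partial>\<mu>) = (\<integral>\<^sup>+ w. G w \<partial>distr (\<mu> \<Otimes>\<^sub>M \<mu>) borel (\<lambda>z. A (fst z) + B (snd z)))"
    using r by (simp add: rotation_def)
  also have "\<dots> = (\<integral>\<^sup>+ z. G (A (fst z) + B (snd z)) \<partial>(\<mu> \<Otimes>\<^sub>M \<mu>))" by (rule nn_integral_distr) measurable
  also have "\<dots> = (\<integral>\<^sup>+ w. avg A B G w \<partial>\<mu>)"
    unfolding avg_def by (subst nn_integral_fst[symmetric]) auto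
  finally show ?thesis ..
qed

lemma AE_rotation:
  assumes r: "rotation A B" and ae: "AE w in \<mu>. P w"
  shows "AE w in \<mu>. AE y in \<mu>. P (A w + B y)"
proof -
  have [measurable]: "A \<in> borel_measurable borel" "B \<in> borel_measurable borel" using r
      by (auto simp: rotation_def)
  obtain N where N: "{w \<in> space \<mu>. \<not> P w} \<subseteq> N" "emeasure \<mu> N = 0" "N \<in> sets \<mu>"
    using ae by (rule AE_E)
  then have [measurable]: "N \<in> sets borel" by (simp add: sets_mu)
  have "(\<integral>\<^sup>+ w. avg A B (indicator N) w \<partial>\<mu>) = (\<integral>\<^sup>+ w. indicator N w \<partial>\<mu>)"
    by (rule nn_integral_avg[OF r]) measurable
  also have "\<dots> = 0" using N by simp
  finally have "AE w in \<mu>. avg A B (indicator N) w = 0"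
    using measurable_avg[OF r, of "indicator N"]
    by (subst (asm) nn_integral_0_iff_AE) (auto simp: measurable_cong_sets[OF sets_mu refl])
  then show ?thesis
  proof eventually_elim
    case (elim w)
    then have "AE y in \<mu>. indicator N (A w + B y) = (0::ennreal)"
      unfolding avg_def by (subst (asm) nn_integral_0_iff_AE) auto
    then show ?case by eventually_elim (use N(1) in \<open>auto simp: indicator_eq_0_iff\<close>)
  qed
qed

lemma avg_AE_cong:
  assumes r: "rotation A B" and ae: "AE w in \<mu>. F w = G w"
  shows "AE w in \<mu>. avg A B F w = avg A B G w"
  using AE_rotation[OF r ae] by eventually_elim (auto simp: avg_def intro: nn_integral_cong_AE)

lemma avg_mono: "(\<And>w. F w \<le> G w) \<Longrightarrow> avg A B F w \<le> avg A B G w"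
  unfolding avg_def by (intro nn_integral_mono)

lemma avg_le_const: "(\<And>w. F w \<le> c) \<Longrightarrow> avg A B F w \<le> c"
proof -
  assume "\<And>w. F w \<le> c"
  then have "avg A B F w \<le> (\<integral>\<^sup>+ y. c \<partial>\<mu>)" unfolding avg_def by (intro nn_integral_mono)
  also have "\<dots> = c" using emeasure_space_1 by simp
  finally show ?thesis .
qed

lemma nn_integral_min_less_top: "(\<integral>\<^sup>+ w. min (G w) (ennreal N) \<partial>\<mu>) < top"
proof -
  have "(\<integral>\<^sup>+ w. min (G w) (ennreal N) \<partial>\<mu>) \<le> (\<integral>\<^sup>+ w. ennreal N \<partial>\<mu>)" by (intro nn_integral_mono) simp
  also have "\<dots> < top" using emeasure_space_1 by simp
  finally show ?thesis .
qed

lemma avg_ediff: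
  assumes r: "rotation A B" and G: "G \<in> borel_measurable borel" "G' \<in> borel_measurable borel"
  shows "(\<integral>\<^sup>+ w. ediff (avg A B G w) (avg A B G' w) \<partial>\<mu>) \<le> (\<integral>\<^sup>+ w. ediff (G w) (G' w) \<partial>\<mu>)"
proof -
  note [measurable] = G
  have [measurable]: "A \<in> borel_measurable borel" "B \<in> borel_measurable borel" using r
      by (auto simp: rotation_def)
  have "(\<integral>\<^sup>+ w. ediff (avg A B G w) (avg A B G' w) \<partial>\<mu>)
      \<le> (\<integral>\<^sup>+ w. avg A B (\<lambda>w. ediff (G w) (G' w)) w \<partial>\<mu>)"
    unfolding avg_def by (intro nn_integral_mono ediff_nn_integral) measurable
  also have "\<dots> = (\<integral>\<^sup>+ w. ediff (G w) (G' w) \<partial>\<mu>)" by (rule nn_integral_avg[OF r]) measurable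
  finally show ?thesis .
qed

end

context wiener_basis
begin

text \<open>
On a function of the first \<open>n\<close> coordinates the averages agree with their limit from \<open>m = n\<close> on.
The general case follows since all averages are contractions of \<open>L\<^sup>1(\<mu>)\<close>.
\<close>
lemma avg_tendsto:
  assumes rm: "\<And>m. rotation (A' m) (B' m)" and r: "rotation A B"
    and comp: "\<And>m i w y. i \<in> first m \<Longrightarrow> e i (A' m w + B' m y) = e i (A w + B y)"
    and G [measurable]: "G \<in> borel_measurable borel" and fin: "(\<integral>\<^sup>+ w. G w \<partial>\<mu>) < top"
  shows "(\<lambda>m. \<integral>\<^sup>+ w. ediff (avg (A' m) (B' m) G w) (avg A B G w) \<partial>\<mu>) \<longlonglongrightarrow> 0"
proof (rule ennreal_tendsto_0I)
  fix \<epsilon> :: real assume e: "0 < \<epsilon>"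
  obtain n G' where G': "G' \<in> borel_measurable borel" "depends (first n) G'"
      "(\<integral>\<^sup>+ w. ediff (G w) (G' w) \<partial>\<mu>) \<le> ennreal (\<epsilon>/2)"
    by (rule approximableD[OF approximable_integrable[OF G fin] half_gt_zero[OF e]])
  show "\<exists>n. \<forall>m\<ge>n. (\<integral>\<^sup>+ w. ediff (avg (A' m) (B' m) G w) (avg A B G w) \<partial>\<mu>) \<le> ennreal \<epsilon>"
  proof (intro exI[of _ n] allI impI)
    fix m assume "n \<le> m"
    then have eq: "avg (A' m) (B' m) G' w = avg A B G' w" for w
      unfolding avg_def using first_mono[of n m] comp
      by (intro nn_integral_cong dependsD[OF G'(2)]) auto
    note [measurable] = measurable_avg[OF rm G, of m] measurable_avg[OF rm G'(1), of m]
        measurable_avg[OF r G] measurable_avg[OF r G'(1)]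
    have "(\<integral>\<^sup>+ w. ediff (avg (A' m) (B' m) G w) (avg A B G w) \<partial>\<mu>)
      \<le> (\<integral>\<^sup>+ w. ediff (avg (A' m) (B' m) G w) (avg (A' m) (B' m) G' w)
          + ediff (avg A B G' w) (avg A B G w) \<partial>\<mu>)"
      using eq by (intro nn_integral_mono) (simp add: ediff_triangle)
    also have "\<dots> = (\<integral>\<^sup>+ w. ediff (avg (A' m) (B' m) G w) (avg (A' m) (B' m) G' w) \<partial>\<mu>)
        + (\<integral>\<^sup>+ w. ediff (avg A B G' w) (avg A B G w) \<partial>\<mu>)"
      by (rule nn_integral_add) measurable
    also have "\<dots> \<le> ennreal (\<epsilon>/2) + ennreal (\<epsilon>/2)"
      using avg_ediff[OF rm G G'(1), of m] avg_ediff[OF r G'(1) G] G'(3)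
      by (intro add_mono) (auto simp: ediff_commute[of "G' _"] intro: order_trans)
    also have "\<dots> = ennreal \<epsilon>" using e by (simp flip: ennreal_plus)
    finally show "(\<integral>\<^sup>+ w. ediff (avg (A' m) (B' m) G w) (avg A B G w) \<partial>\<mu>) \<le> ennreal \<epsilon>" .
  qed
qed

abbreviation ineq_P :: "real \<Rightarrow> real \<Rightarrow> ('w \<Rightarrow> ennreal) \<Rightarrow> ('w \<Rightarrow> ennreal) \<Rightarrow>
    ('w \<Rightarrow> ennreal) \<Rightarrow> 'h \<Rightarrow> 'h \<Rightarrow> 'w \<Rightarrow> bool" where
  "ineq_P s t a b c h k w \<equiv> ennreal_powr (b (w + \<iota> h)) s * ennreal_powr (c (w + \<iota> k)) t
      \<le> a (w + \<iota> (s *\<^sub>R h + t *\<^sub>R k)) * ennreal (exp (s * t * (norm (h - k))\<^sup>2 / 2))"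

lemma ennreal_powr_less_top: "0 \<le> p \<Longrightarrow> x < top \<Longrightarrow> ennreal_powr x p < top"
  by (auto simp: ennreal_powr_def)

text \<open>
Pass to an almost surely convergent subsequence; by quasi-invariance it converges at the
shifted points as well. Finiteness of \<open>b\<close> and \<open>c\<close> keeps the product away from \<open>0 \<cdot> \<infinity>\<close>. The event \<open>Q\<close>
allows the inequality to be localized.
\<close>
lemma ineq_P_L1_limit:
  assumes st: "0 \<le> s" "0 \<le> t"
    and m: "\<And>n. a' n \<in> borel_measurable borel" "\<And>n. b' n \<in> borel_measurable borel"
        "\<And>n. c' n \<in> borel_measurable borel"
      "a \<in> borel_measurable borel" "b \<in> borel_measurable borel" "c \<in> borel_measurable borel"
    and lim: "(\<lambda>n. \<integral>\<^sup>+ w. ediff (a' n w) (a w) \<partial>\<mu>) \<longlonglongrightarrow> 0"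
      "(\<lambda>n. \<integral>\<^sup>+ w. ediff (b' n w) (b w) \<partial>\<mu>) \<longlonglongrightarrow> 0" "(\<lambda>n. \<integral>\<^sup>+ w. ediff (c' n w) (c w) \<partial>\<mu>) \<longlonglongrightarrow> 0"
    and fin: "\<And>w. b w < top" "\<And>w. c w < top"
    and ineq_P: "\<And>n. AE w in \<mu>. Q w \<longrightarrow> ineq_P s t (a' n) (b' n) (c' n) h k w"
  shows "AE w in \<mu>. Q w \<longrightarrow> ineq_P s t a b c h k w"
proof -
  note [measurable] = m
  define D where "D n w = ediff (a' n w) (a w) + ediff (b' n w) (b w)
      + ediff (c' n w) (c w)" for n w
  have Dm: "D n \<in> borel_measurable \<mu>" for n unfolding D_def by measurable
  have "(\<integral>\<^sup>+ w. D n w \<partial>\<mu>) = (\<integral>\<^sup>+ w. ediff (a' n w) (a w) \<partial>\<mu>) + (\<integral>\<^sup>+ w. ediff (b' n w) (b w) \<partial>\<mu>)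
      + (\<integral>\<^sup>+ w. ediff (c' n w) (c w) \<partial>\<mu>)" for n
    unfolding D_def by (simp add: nn_integral_add)
  then have "(\<lambda>n. \<integral>\<^sup>+ w. D n w \<partial>\<mu>) \<longlonglongrightarrow> 0"
    using tendsto_add[OF tendsto_add[OF lim(1,2)] lim(3)] by simp
  then obtain r where r: "strict_mono r" "AE w in \<mu>. (\<lambda>n. D (r n) w) \<longlonglongrightarrow> 0"
    using nn_integral_tendsto_0_AE_subseq[OF finite_measure_axioms, of D] Dm by blast
  define C where "C w \<longleftrightarrow> (\<lambda>n. a' (r n) w) \<longlonglongrightarrow> a w \<and> (\<lambda>n. b' (r n) w) \<longlonglongrightarrow> b w \<and> (\<lambda>n. c' (r n) w)
      \<longlonglongrightarrow> c w" for w
  have C: "AE w in \<mu>. C w"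
    using r(2)
  proof eventually_elim
    case (elim w)
    have sub: "(\<lambda>n. x n) \<longlonglongrightarrow> 0" if "\<And>n. x n \<le> D (r n) w" for x :: "nat \<Rightarrow> ennreal"
      by (rule tendsto_sandwich[OF _ _ tendsto_const elim]) (use that in auto)
    show ?case unfolding C_def
      by (intro conjI; rule ediff_tendsto; rule sub)
          (auto simp: D_def add_increasing add_increasing2)
  qed
  have "AE w in \<mu>. \<forall>n. Q w \<longrightarrow> ineq_P s t (a' n) (b' n) (c' n) h k w" unfolding AE_all_countable
      using ineq_P by blast
  with AE_shift[OF C, of h] AE_shift[OF C, of k] AE_shift[OF C, of "s *\<^sub>R h + t *\<^sub>R k"]
  show ?thesis
  proof eventually_elim
    case (elim w)
    show ?case
    proof
      assume Q: "Q w"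
      have fp: "ennreal_powr (b (w + \<iota> h)) s < top" "ennreal_powr (c (w + \<iota> k)) t < top"
        using st fin by (auto intro: ennreal_powr_less_top)
      have "(\<lambda>n. ennreal_powr (b' (r n) (w + \<iota> h)) s * ennreal_powr (c' (r n) (w + \<iota> k)) t)
        \<longlonglongrightarrow> ennreal_powr (b (w + \<iota> h)) s * ennreal_powr (c (w + \<iota> k)) t"
        using elim fp unfolding C_def by (intro tendsto_mult_ennreal tendsto_ennreal_powr st) auto
      moreover have "(\<lambda>n. a' (r n) (w + \<iota> (s *\<^sub>R h + t *\<^sub>R k)) * ennreal (exp (s * t
          * (norm (h - k))\<^sup>2 / 2)))
        \<longlonglongrightarrow> a (w + \<iota> (s *\<^sub>R h + t *\<^sub>R k)) * ennreal (exp (s * t * (norm (h - k))\<^sup>2 / 2))"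
        using elim unfolding C_def by (intro tendsto_mult_ennreal tendsto_const) auto
      ultimately show "ineq_P s t a b c h k w"
        using elim(4) Q by (intro LIMSEQ_le) auto
    qed
  qed
qed

text \<open>
Truncation at the common height \<open>N\<close> is harmless: the left side becomes at most \<open>N\<^sup>s N\<^sup>t = N\<close>, and
the exponential factor is at least 1.
\<close>
lemma ineq_P_min:
  assumes st: "0 \<le> s" "0 \<le> t" "s + t = 1" and "ineq_P s t a b c h k w"
  shows "ineq_P s t (\<lambda>w. min (a w) (ennreal N)) (\<lambda>w. min (b w) (ennreal N)) (\<lambda>w. min (c w)
      (ennreal N)) h k w"
proof -
  let ?E = "ennreal (exp (s * t * (norm (h - k))\<^sup>2 / 2))"
  let ?l = "ennreal_powr (min (b (w + \<iota> h)) (ennreal N)) s * ennreal_powr (min (c (w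
      + \<iota> k)) (ennreal N)) t"
  have "?l \<le> ennreal_powr (b (w + \<iota> h)) s * ennreal_powr (c (w + \<iota> k)) t"
    using st by (intro mult_mono ennreal_powr_mono) auto
  then have 1: "?l \<le> a (w + \<iota> (s *\<^sub>R h + t *\<^sub>R k)) * ?E" using assms(4) by (rule order_trans)
  have "?l \<le> ennreal_powr (ennreal N) s * ennreal_powr (ennreal N) t"
    using st by (intro mult_mono ennreal_powr_mono) auto
  also have "\<dots> = ennreal N" by (rule ennreal_powr_add[OF st])
  also have "\<dots> \<le> ennreal N * ?E"
  proof -
    have "ennreal 1 \<le> ?E" using st by (intro ennreal_leI) simp
    then show ?thesis using mult_left_mono[of 1 ?E "ennreal N"] by simp
  qed
  finally show ?thesis using 1 by (simp add: min_def split: if_splits)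
qed

text \<open>
The truncated functions are bounded, so their averages converge in \<open>L\<^sup>1\<close> and \<open>ineq_P_L1_limit\<close>
applies. Monotone convergence then removes the truncation.
\<close>
lemma cond_P_avg_limit:
  assumes st: "0 \<le> s" "0 \<le> t" "s + t = 1"
    and rm: "\<And>m. rotation (A' m) (B' m)" and r: "rotation A B"
    and comp: "\<And>m i w y. i \<in> first m \<Longrightarrow> e i (A' m w + B' m y) = e i (A w + B y)"
    and pres: "\<And>m a b c. a \<in> borel_measurable borel \<Longrightarrow> b \<in> borel_measurable borel
        \<Longrightarrow> c \<in> borel_measurable borel \<Longrightarrow>
      cond_P s t a b c \<Longrightarrow> cond_P s t (avg (A' m) (B' m) a) (avg (A' m) (B' m) b) (avg (A' m)
          (B' m) c)"
    and m: "a \<in> borel_measurable borel" "b \<in> borel_measurable borel" "c \<in> borel_measurable borel"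
    and cond_P: "cond_P s t a b c"
  shows "cond_P s t (avg A B a) (avg A B b) (avg A B c)"
  unfolding cond_P_def
proof (intro allI)
  fix h k
  note [measurable] = m
  have AB [measurable]: "A \<in> borel_measurable borel" "B \<in> borel_measurable borel" using r
      by (auto simp: rotation_def)
  let ?c = "\<lambda>G N w. min (G w) (ennreal (real N))"
  have cm: "?c G N \<in> borel_measurable borel" if "G \<in> borel_measurable borel" for G N using that
      by measurable
  have lt: "avg A B (?c G N) w < top" for G N w
    using avg_le_const[of "?c G N" "ennreal (real N)" A B w] by (rule le_less_trans) auto
  have tr: "AE w in \<mu>. ineq_P s t (avg A B (?c a N)) (avg A B (?c b N)) (avg A B (?c c N)) h k w"
      for N
  proof -
    have PPc: "cond_P s t (?c a N) (?c b N) (?c c N)"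
      unfolding cond_P_def
    proof (intro allI)
      fix h k
      have "AE w in \<mu>. ineq_P s t a b c h k w" using cond_P unfolding cond_P_def by blast
      then show "AE w in \<mu>. ineq_P s t (?c a N) (?c b N) (?c c N) h k w"
        by eventually_elim (rule ineq_P_min[OF st])
    qed
    have "AE w in \<mu>. True \<longrightarrow> ineq_P s t (avg A B (?c a N)) (avg A B (?c b N)) (avg A B
        (?c c N)) h k w"
    proof (rule ineq_P_L1_limit[OF st(1,2)])
      show "AE w in \<mu>. True \<longrightarrow> ineq_P s t (avg (A' n) (B' n) (?c a N)) (avg (A' n) (B' n) (?c b N))
          (avg (A' n) (B' n) (?c c N)) h k w" for n
        using pres[OF cm[OF m(1)] cm[OF m(2)] cm[OF m(3)] PPc] unfolding cond_P_def by simp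
    qed (use lt in \<open>auto intro!: measurable_avg rm r cm m avg_tendsto comp
        nn_integral_min_less_top\<close>)
    then show ?thesis by simp
  qed
  have SUP: "(SUP N. avg A B (?c G N) w) = avg A B G w" and inc: "incseq (\<lambda>N. avg A B (?c G N) w)"
    if "G \<in> borel_measurable borel" for G w
    using that unfolding avg_def by (auto intro!: nn_integral_min_SUP)
  from tr have "AE w in \<mu>. \<forall>N. ineq_P s t (avg A B (?c a N)) (avg A B (?c b N)) (avg A B
      (?c c N)) h k w"
    unfolding AE_all_countable by blast
  then show "AE w in \<mu>. ineq_P s t (avg A B a) (avg A B b) (avg A B c) h k w"
  proof eventually_elim
    case (elim w)
    have "ennreal_powr (SUP N. avg A B (?c b N) (w
        + \<iota> h)) s * ennreal_powr (SUP N. avg A B (?c c N) (w + \<iota> k)) t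
      \<le> avg A B a (w + \<iota> (s *\<^sub>R h + t *\<^sub>R k)) * ennreal (exp (s * t * (norm (h - k))\<^sup>2 / 2))"
    proof (rule ennreal_powr_SUP_le[OF st(1,2) inc[OF m(2)] inc[OF m(3)]])
      fix N
      have "avg A B (?c a N) (w + \<iota> (s *\<^sub>R h + t *\<^sub>R k)) \<le> avg A B a (w + \<iota> (s *\<^sub>R h + t *\<^sub>R k))"
        by (rule avg_mono) simp
      then show "ennreal_powr (avg A B (?c b N) (w + \<iota> h)) s * ennreal_powr (avg A B (?c c N) (w
          + \<iota> k)) t
        \<le> avg A B a (w + \<iota> (s *\<^sub>R h + t *\<^sub>R k)) * ennreal (exp (s * t * (norm (h - k))\<^sup>2 / 2))"
        by (intro order_trans[OF elim[rule_format, of N]] mult_right_mono) auto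
    qed
    then show ?case by (simp only: SUP[OF m(2)] SUP[OF m(3)])
  qed
qed

definition projH :: "nat set \<Rightarrow> 'h \<Rightarrow> 'h" where
  "projH J r = (\<Sum>i\<in>J. (rep i \<bullet> r) *\<^sub>R rep i)"

lemma projH_add: "projH J (x + y) = projH J x + projH J y"
  by (simp add: projH_def inner_add_right scaleR_add_left sum.distrib)

lemma projH_scale: "projH J (c *\<^sub>R x) = c *\<^sub>R projH J x"
  by (simp add: projH_def scaleR_sum_right)

lemma rep_projH: "J \<subseteq> I \<Longrightarrow> finite J \<Longrightarrow> i \<in> I \<Longrightarrow> rep i \<bullet> projH J r = (if i \<in> J then rep i \<bullet> r else 0)"
proof -
  assume J: "J \<subseteq> I" "finite J" and i: "i \<in> I"
  have "rep i \<bullet> projH J r = (\<Sum>j\<in>J. if i = j then rep i \<bullet> r else 0)"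
    unfolding projH_def inner_sum_right using J i by (intro sum.cong) (auto simp: rep_orthonormal)
  then show ?thesis using J by (simp add: sum.delta)
qed

lemma inner_projH: assumes J: "J \<subseteq> I" "finite J" shows "r \<bullet> projH J r = (norm (projH J r))\<^sup>2"
proof -
  have "projH J r \<bullet> projH J r = (\<Sum>i\<in>J. (rep i \<bullet> r) * (rep i \<bullet> projH J r))"
    by (subst (1) projH_def) (simp add: inner_sum_left)
  also have "\<dots> = (\<Sum>i\<in>J. (rep i \<bullet> r) * (rep i \<bullet> r))"
    using J by (intro sum.cong) (auto simp: rep_projH[OF J])
  also have "\<dots> = r \<bullet> projH J r"
    unfolding projH_def inner_sum_right by (simp add: inner_commute[of r])
  finally show ?thesis by (simp add: power2_norm_eq_inner)
qed

lemma norm_projH_le: assumes J: "J \<subseteq> I" "finite J" shows "norm (projH J r) \<le> norm r"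
proof -
  have "norm (projH J r) * norm (projH J r) \<le> norm r * norm (projH J r)"
    using inner_projH[OF J, of r] norm_cauchy_schwarz[of r "projH J r"]
        by (simp add: power2_eq_square)
  then show ?thesis by (cases "projH J r = 0") auto
qed

text \<open>
All the linear maps that occur, on both sides of an average, have this form: coordinate
averages, conditioning and the Ornstein--Uhlenbeck semigroup differ only in the
coefficients.
\<close>
definition lin :: "real \<Rightarrow> real \<Rightarrow> nat set \<Rightarrow> 'w \<Rightarrow> 'w" where
  "lin p q J w = p *\<^sub>R w + q *\<^sub>R projW J w"

lemma measurable_lin: "J \<subseteq> I \<Longrightarrow> lin p q J \<in> borel_measurable borel"
proof -
  assume J: "J \<subseteq> I"
  note [measurable] = measurable_projW[OF J]
  show ?thesis unfolding lin_def by measurable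
qed

lemma lin_dual:
  assumes J: "J \<subseteq> I" "finite J" and l: "l \<in> dual"
  shows "(\<lambda>w. l (lin p q J w)) \<in> dual"
    and "(norm (riesz_rep \<iota> (\<lambda>w. l (lin p q J w))))\<^sup>2
      = p\<^sup>2 * (norm (riesz_rep \<iota> l))\<^sup>2 + (2 * p * q + q\<^sup>2) * (norm (projH J (riesz_rep \<iota> l)))\<^sup>2"
proof -
  define r where "r = riesz_rep \<iota> l"
  have lPW: "l (projW J w) = (\<Sum>i\<in>J. (rep i \<bullet> r) * e i w)" for w
    unfolding projW_def linear_sum[OF dual_linear[OF l]] linear_cmul[OF dual_linear[OF l]]
    by (simp add: riesz_inner[OF l] r_def inner_commute mult.commute)
  have eq: "l (lin p q J w) = p * l w + q * (\<Sum>i\<in>J. (rep i \<bullet> r) * e i w)" for w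
    unfolding lin_def linear_add[OF dual_linear[OF l]] linear_cmul[OF dual_linear[OF l]] lPW by simp
  show "(\<lambda>w. l (lin p q J w)) \<in> dual"
    unfolding eq using J by (intro dual_add dual_scale dual_sum l e_dual) auto
  have "riesz_rep \<iota> (\<lambda>w. l (lin p q J w)) = p *\<^sub>R r + q *\<^sub>R projH J r"
  proof (rule riesz_unique)
    fix h
    have "(\<Sum>i\<in>J. (rep i \<bullet> r) * e i (\<iota> h)) = projH J r \<bullet> h"
      unfolding projH_def inner_sum_left using J by (intro sum.cong) (auto simp: e_iota)
    then show "l (lin p q J (\<iota> h)) = (p *\<^sub>R r + q *\<^sub>R projH J r) \<bullet> h"
      unfolding eq by (simp add: riesz_inner[OF l] r_def inner_add_left)
  qed
  then show "(norm (riesz_rep \<iota> (\<lambda>w. l (lin p q J w))))\<^sup>2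
      = p\<^sup>2 * (norm (riesz_rep \<iota> l))\<^sup>2 + (2 * p * q + q\<^sup>2) * (norm (projH J (riesz_rep \<iota> l)))\<^sup>2"
    unfolding r_def[symmetric]
    by (simp add: norm_add_scaleR_sq inner_projH[OF J] power_mult_distrib algebra_simps)
qed

lemma rotation_lin:
  assumes J: "J \<subseteq> I" "finite J" and "p\<^sup>2 + p'\<^sup>2 = 1" "(2 * p * q + q\<^sup>2) + (2 * p' * q' + q'\<^sup>2) = 0"
  shows "rotation (lin p q J) (lin p' q' J)"
  unfolding rotation_def
proof (intro conjI rotation_image measurable_lin J lin_dual)
  fix l :: "'w \<Rightarrow> real" assume l: "l \<in> dual"
  let ?R = "(norm (riesz_rep \<iota> l))\<^sup>2" and ?P = "(norm (projH J (riesz_rep \<iota> l)))\<^sup>2"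
  have "(p\<^sup>2 * ?R + (2 * p * q + q\<^sup>2) * ?P) + (p'\<^sup>2 * ?R + (2 * p' * q' + q'\<^sup>2) * ?P)
      = (p\<^sup>2 + p'\<^sup>2) * ?R + ((2 * p * q + q\<^sup>2) + (2 * p' * q' + q'\<^sup>2)) * ?P"
    by (simp add: algebra_simps)
  then show "(norm (riesz_rep \<iota> (\<lambda>w. l (lin p q J w))))\<^sup>2
      + (norm (riesz_rep \<iota> (\<lambda>w. l (lin p' q' J w))))\<^sup>2 = ?R"
    unfolding lin_dual(2)[OF J l] using assms(3,4) by simp
qed auto

lemma e_lin: "J \<subseteq> I \<Longrightarrow> finite J \<Longrightarrow> i \<in> I \<Longrightarrow> e i (lin p q J w) = (p + (if i \<in> J then q else 0)) * e i w"
  unfolding lin_def by (simp add: e_add e_scale e_projW algebra_simps)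

lemma coord_avg_eq_avg: "coord_avg \<alpha> \<beta> J = avg (lin 1 (\<alpha> - 1) J) (lin 0 \<beta> J)"
  by (intro ext) (simp add: coord_avg_def avg_def lin_def)

text \<open>
An average that acts on every coordinate either as the Mehler average with coefficients \<open>\<alpha>\<close>, \<open>\<beta>\<close>
or trivially is the limit of averages over the finite sets \<open>J m\<close> of coordinates.
\<close>
theorem cond_P_avg_lin:
  assumes st: "0 \<le> s" "0 \<le> t" "s + t = 1" and ab: "\<alpha>\<^sup>2 + \<beta>\<^sup>2 = (1::real)" "\<beta> \<noteq> 0"
    and r: "rotation A B" and J: "\<And>m. J m \<subseteq> I" "\<And>m. finite (J m)"
    and comp: "\<And>m i w y. i \<in> first m \<Longrightarrow> e i (A w + B y)
        = (if i \<in> J m then \<alpha> * e i w + \<beta> * e i y else e i w)"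
    and m: "a \<in> borel_measurable borel" "b \<in> borel_measurable borel" "c \<in> borel_measurable borel"
    and cond_P: "cond_P s t a b c"
  shows "cond_P s t (avg A B a) (avg A B b) (avg A B c)"
proof (rule cond_P_avg_limit[OF st _ r _ _ m cond_P])
  show "rotation (lin 1 (\<alpha> - 1) (J m)) (lin 0 \<beta> (J m))" for m
    using ab by (intro rotation_lin J) (auto simp: power2_eq_square algebra_simps)
  show "e i (lin 1 (\<alpha> - 1) (J m) w + lin 0 \<beta> (J m) y)
      = e i (A w + B y)" if "i \<in> first m" for m i w y
    using that first_subset[of m] J[of m] comp[OF that, of w y]
    by (auto simp: e_add e_lin)
  show "cond_P s t (avg (lin 1 (\<alpha> - 1) (J m)) (lin 0 \<beta> (J m)) a) (avg (lin 1 (\<alpha> - 1) (J m)) (lin 0 \<beta>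
      (J m)) b)
      (avg (lin 1 (\<alpha> - 1) (J m)) (lin 0 \<beta> (J m)) c)"
    if "a \<in> borel_measurable borel" "b \<in> borel_measurable borel" "c \<in> borel_measurable borel"
        "cond_P s t a b c" for m a b c
    using cond_P_coord_avg[OF st ab that J(2) J(1)] unfolding coord_avg_eq_avg .
qed

end

section \<open>Conditional expectations\<close>

context wiener_basis
begin

text \<open>
The conditional expectation given the first \<open>n\<close> coordinates, as an integral over the others.
Unlike \<open>cond_V\<close> it is defined pointwise.
\<close>
definition cexp :: "nat \<Rightarrow> ('w \<Rightarrow> ennreal) \<Rightarrow> 'w \<Rightarrow> ennreal" where
  "cexp n = avg (lin 0 1 (first n)) (lin 1 (- 1) (first n))"

lemma rotation_cexp: "rotation (lin 0 1 (first n)) (lin 1 (- 1) (first n))"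
  by (rule rotation_lin[OF first_subset finite_first]) auto

lemma measurable_cexp: "G \<in> borel_measurable borel \<Longrightarrow> cexp n G \<in> borel_measurable borel"
  unfolding cexp_def by (rule measurable_avg[OF rotation_cexp])

lemma e_cexp: "i \<in> I \<Longrightarrow> e i (lin 0 1 (first n) w + lin 1 (- 1) (first n) y)
    = (if i \<in> first n then e i w else e i y)"
  by (simp add: e_add e_lin[OF first_subset finite_first])

lemma cexp_depends: "depends (first n) (cexp n G)"
proof -
  have "projW (first n) w = projW (first n) w'" if "\<forall>i\<in>first n. e i w = e i w'" for w w'
    unfolding projW_def using that by (intro sum.cong) auto
  then have "cexp n G w = cexp n G w'" if "\<forall>i\<in>first n. e i w = e i w'" for w w'
    using that unfolding cexp_def avg_def lin_def by (simp only: scaleR_zero_left)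
  then show ?thesis by (simp add: depends_def)
qed

lemma cexp_mult:
  assumes d: "depends (first m) F" and mn: "m \<le> n" shows "cexp n (\<lambda>w. F w * G w) w
      = (\<integral>\<^sup>+ y. F w * G (lin 0 1 (first n) w + lin 1 (- 1) (first n) y) \<partial>\<mu>)"
  unfolding cexp_def avg_def
proof (intro nn_integral_cong)
  fix y
  have "F (lin 0 1 (first n) w + lin 1 (- 1) (first n) y) = F w"
  proof (rule dependsD[OF d])
    fix i assume "i \<in> first m"
    then have "i \<in> I" "i \<in> first n" using first_subset first_mono[OF mn] by auto
    then show "e i (lin 0 1 (first n) w + lin 1 (- 1) (first n) y) = e i w" by (simp add: e_cexp)
  qed
  then show "F (lin 0 1 (first n) w + lin 1 (- 1) (first n) y) * G (lin 0 1 (first n) w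
      + lin 1 (- 1) (first n) y)
     = F w * G (lin 0 1 (first n) w + lin 1 (- 1) (first n) y)" by simp
qed

lemma cexp_indicator:
  assumes d: "depends (first m) (\<lambda>w. w \<in> E)" and mn: "m \<le> n"
  shows "cexp n (\<lambda>w. indicator E w * G w) w = indicator E w * cexp n G w"
proof -
  have "depends (first m) (indicator E :: 'w \<Rightarrow> ennreal)" using d
      by (auto simp: depends_def indicator_def)
  from cexp_mult[OF this mn, of G w] show ?thesis
    by (cases "w \<in> E") (simp_all add: cexp_def avg_def)
qed

text \<open>
The identity is itself an average, with \<open>B = 0\<close>, and \<open>cexp\<close> with index \<open>m\<close> does not move the first
\<open>m\<close> coordinates.
\<close>
lemma cexp_tendsto:
  assumes "G \<in> borel_measurable borel" "(\<integral>\<^sup>+ w. G w \<partial>\<mu>) < top"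
  shows "(\<lambda>n. \<integral>\<^sup>+ w. ediff (cexp n G w) (G w) \<partial>\<mu>) \<longlonglongrightarrow> 0"
proof -
  have "avg (lin 1 0 {}) (lin 0 0 {}) G = G"
    using emeasure_space_1 by (intro ext) (simp add: avg_def lin_def)
  moreover have "rotation (lin 1 0 {}) (lin 0 0 {})" by (rule rotation_lin) auto
  moreover have "e i (lin 0 1 (first m) w + lin 1 (- 1) (first m) y)
      = e i (lin 1 0 {} w + lin 0 0 {} y)"
    if "i \<in> first m" for i m w y
    using that first_subset[of m] e_cexp[of i m w y] by (auto simp: lin_def)
  ultimately show ?thesis
    using avg_tendsto[of "\<lambda>n. lin 0 1 (first n)" "\<lambda>n. lin 1 (- 1) (first n)" "lin 1 0 {}"
        "lin 0 0 {}" G] rotation_cexp assms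
    by (simp add: cexp_def)
qed

lemma space_V: "space (V_alg \<mu> I e n) = UNIV"
  by (simp add: V_alg_def)

lemma sets_V: "sets (V_alg \<mu> I e n) = sigma_sets UNIV
     ({e i -` B | i B. i \<in> first n \<and> B \<in> sets borel} \<union> null_sets (completion \<mu>))"
  by (simp add: V_alg_def first_def)

lemma subalgebra_V: "subalgebra (completion \<mu>) (V_alg \<mu> I e n)"
  unfolding subalgebra_def
proof (intro conjI)
  show "space (V_alg \<mu> I e n) = space (completion \<mu>)" by (simp add: space_V)
  have "{e i -` B | i B. i \<in> first n \<and> B \<in> sets borel} \<subseteq> sets borel"
    using measurable_sets[OF measurable_e] first_subset[of n] by fastforce
  then have "{e i -` B | i B. i \<in> first n \<and> B \<in> sets borel} \<union> null_sets (completion \<mu>) \<subseteq> sets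
      (completion \<mu>)"
    using sets_mu by auto
  then show "sets (V_alg \<mu> I e n) \<subseteq> sets (completion \<mu>)"
    unfolding sets_V using sets.sigma_sets_subset[of _ "completion \<mu>"] by simp
qed

lemma V_set_cylinder:
  assumes "A \<in> sets (V_alg \<mu> I e n)"
  shows "\<exists>A'\<in>sets borel. depends (first n) (\<lambda>w. w \<in> A') \<and> (AE w in \<mu>. w \<in> A \<longleftrightarrow> w \<in> A')"
  using assms unfolding sets_V
proof (induction rule: sigma_sets.induct)
  case (Basic A)
  then consider i B where "i \<in> first n" "B \<in> sets borel" "A
      = e i -` B" | "A \<in> null_sets (completion \<mu>)" by blast
  then show ?case
  proof cases
    case 1
    then have "A \<in> sets borel" using measurable_sets[OF measurable_e] first_subset[of n]
        by fastforce
    moreover have "depends (first n) (\<lambda>w. w \<in> A)" using 1 by (auto simp: depends_def)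
    ultimately show ?thesis by auto
  next
    case 2
    then have "AE w in completion \<mu>. w \<notin> A" by (rule AE_not_in)
    then have "AE w in \<mu>. w \<in> A \<longleftrightarrow> w \<in> {}" by (simp add: AE_completion_iff)
    moreover have "depends (first n) (\<lambda>w. w \<in> {})" by (simp add: depends_def)
    ultimately show ?thesis by (intro bexI[of _ "{}"]) auto
  qed
next
  case Empty
  show ?case by (intro bexI[of _ "{}"]) (auto simp: depends_def)
next
  case (Compl A)
  then obtain A' where A': "A' \<in> sets borel" "depends (first n) (\<lambda>w. w \<in> A')" "AE w in \<mu>. w \<in> A
      \<longleftrightarrow> w \<in> A'" by blast
  have "AE w in \<mu>. w \<in> UNIV - A \<longleftrightarrow> w \<in> UNIV - A'" using A'(3) by eventually_elim auto
  moreover have "depends (first n) (\<lambda>w. w \<in> UNIV - A')" using A'(2) by (auto simp: depends_def)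
  moreover have "UNIV - A' \<in> sets borel" using A'(1) by auto
  ultimately show ?case by blast
next
  case (Union A)
  then have "\<forall>k. \<exists>A'\<in>sets borel. depends (first n) (\<lambda>w. w \<in> A') \<and> (AE w in \<mu>. w \<in> A k
      \<longleftrightarrow> w \<in> A')" by blast
  then obtain A' where A': "\<And>k. A' k \<in> sets borel" "\<And>k. depends (first n) (\<lambda>w. w \<in> A' k)"
      "\<And>k. AE w in \<mu>. w \<in> A k \<longleftrightarrow> w \<in> A' k"
    by metis
  have "AE w in \<mu>. \<forall>k. w \<in> A k \<longleftrightarrow> w \<in> A' k" unfolding AE_all_countable using A'(3) by blast
  then have "AE w in \<mu>. w \<in> (\<Union>k. A k) \<longleftrightarrow> w \<in> (\<Union>k. A' k)" by eventually_elim auto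
  moreover have "depends (first n) (\<lambda>w. w \<in> (\<Union>k. A' k))" using A'(2) unfolding depends_def
      by (metis UN_iff)
  moreover have "(\<Union>k. A' k) \<in> sets borel" using A'(1) by auto
  ultimately show ?case by blast
qed

lemma measurable_cexp_V:
  assumes [measurable]: "G \<in> borel_measurable borel" shows "cexp n G
      \<in> borel_measurable (V_alg \<mu> I e n)"
proof -
  have "e i \<in> borel_measurable (V_alg \<mu> I e n)" if "i \<in> first n" for i
  proof (rule measurableI)
    fix A :: "real set" assume "A \<in> sets borel"
    then show "e i -` A \<inter> space (V_alg \<mu> I e n) \<in> sets (V_alg \<mu> I e n)"
      unfolding sets_V space_V using that by (intro sigma_sets.Basic) auto
  qed simp
  then have PV: "projW (first n) \<in> borel_measurable (V_alg \<mu> I e n)"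
    unfolding projW_def by (intro borel_measurable_sum borel_measurable_scaleR_frechet) auto
  note [measurable] = measurable_lin[OF first_subset[of n]]
  have "(\<lambda>x. \<integral>\<^sup>+ y. G (x + lin 1 (- 1) (first n) y) \<partial>\<mu>) \<in> borel_measurable borel" by measurable
  from measurable_compose[OF PV this] show ?thesis by (simp add: cexp_def avg_def[abs_def] lin_def)
qed

text \<open>
A set of \<open>V_alg\<close> is almost surely a cylinder set, and the indicator of a cylinder set may be
pulled out of \<open>cexp\<close>; hence both sides have the same integrals over these sets.
\<close>
theorem cond_V_eq_cexp:
  assumes a: "a \<in> borel_measurable (completion \<mu>)"
      and a' [measurable]: "a' \<in> borel_measurable borel"
    and ae: "AE w in \<mu>. a w = a' w"
  shows "AE w in \<mu>. cond_V \<mu> I e n a w = cexp n a' w"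
proof -
  have "emeasure (completion \<mu>) (space (completion \<mu>)) = 1" using emeasure_space_1 by simp
  then interpret C: prob_space "completion \<mu>" by (rule prob_spaceI)
  interpret S: finite_measure_subalgebra "completion \<mu>" "V_alg \<mu> I e n"
    by standard (rule subalgebra_V)
  note [measurable] = measurable_cexp[OF a', of n]
  have "AE w in completion \<mu>. cexp n a' w = nn_cond_exp (completion \<mu>) (V_alg \<mu> I e n) a w"
  proof (rule S.nn_cond_exp_charact[OF _ a measurable_cexp_V[OF a']])
    fix A assume "A \<in> sets (V_alg \<mu> I e n)"
    then obtain A' where A': "A' \<in> sets borel" "depends (first n) (\<lambda>w. w \<in> A')" "AE w in \<mu>. w \<in> A
        \<longleftrightarrow> w \<in> A'"
      using V_set_cylinder by blast
    note [measurable] = A'(1)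
    have "(\<integral>\<^sup>+ x \<in> A. a x \<partial>completion \<mu>) = (\<integral>\<^sup>+ x. indicator A' x * a' x \<partial>\<mu>)"
      unfolding nn_integral_completion using ae A'(3)
      by (intro nn_integral_cong_AE) (auto elim!: eventually_elim2 simp: indicator_def)
    also have "\<dots> = (\<integral>\<^sup>+ x. cexp n (\<lambda>x. indicator A' x * a' x) x \<partial>\<mu>)"
      unfolding cexp_def by (rule nn_integral_avg[OF rotation_cexp, symmetric]) measurable
    also have "\<dots> = (\<integral>\<^sup>+ x. indicator A' x * cexp n a' x \<partial>\<mu>)"
      by (simp add: cexp_indicator[OF A'(2) order_refl])
    also have "\<dots> = (\<integral>\<^sup>+ x \<in> A. cexp n a' x \<partial>completion \<mu>)"
      unfolding nn_integral_completion using A'(3)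
      by (intro nn_integral_cong_AE) (auto elim!: eventually_mono simp: indicator_def)
    finally show "(\<integral>\<^sup>+ x \<in> A. a x \<partial>completion \<mu>) = (\<integral>\<^sup>+ x \<in> A. cexp n a' x \<partial>completion \<mu>)" .
  qed
  then show ?thesis unfolding cond_V_def AE_completion_iff by eventually_elim simp
qed

lemma proj_n_eq: "proj_n \<iota> I e n h = projH (first n) h"
  unfolding proj_n_def orthogonal_projection_def first_def[symmetric]
proof (rule the_equality)
  let ?S = "span ((\<lambda>i. riesz_rep \<iota> (e i)) ` first n)"
  have gen: "rep i \<in> ?S" if "i \<in> first n" for i using that by (auto simp: rep_def intro: span_base)
  have inS: "projH (first n) h \<in> ?S"
    unfolding projH_def by (intro span_sum span_scale gen)
  have orth: "(h - projH (first n) h) \<bullet> v = 0" if "v \<in> ?S" for v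
  proof -
    have "subspace {v. (h - projH (first n) h) \<bullet> v = 0}"
        by (rule subspaceI) (auto simp: inner_add_right)
    moreover have "(\<lambda>i. riesz_rep \<iota> (e i)) ` first n \<subseteq> {v. (h - projH (first n) h) \<bullet> v = 0}"
    proof (rule image_subsetI)
      fix i assume i: "i \<in> first n"
      then have "rep i \<bullet> projH (first n) h = rep i \<bullet> h"
        using rep_projH[OF first_subset finite_first, of i n h] first_subset[of n] by auto
      then show "riesz_rep \<iota> (e i) \<in> {v. (h - projH (first n) h) \<bullet> v = 0}"
        by (simp add: rep_def[symmetric] inner_diff_left inner_commute[of _ "rep i"])
    qed
    ultimately have "?S \<subseteq> {v. (h - projH (first n) h) \<bullet> v = 0}" by (rule span_minimal[rotated])
    with that show ?thesis by auto
  qed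
  show "projH (first n) h \<in> ?S \<and> (\<forall>v\<in>?S. (h - projH (first n) h) \<bullet> v = 0)" using inS orth by blast
  fix p assume p: "p \<in> ?S \<and> (\<forall>v\<in>?S. (h - p) \<bullet> v = 0)"
  define v where "v = p - projH (first n) h"
  have "v \<in> ?S" unfolding v_def using p inS by (intro span_diff) auto
  then have "(h - p) \<bullet> v = 0" "(h - projH (first n) h) \<bullet> v = 0" using p orth by auto
  then have "v \<bullet> v = 0" by (simp add: v_def inner_diff_left)
  then show "p = projH (first n) h" by (simp add: v_def)
qed

lemma cexp_proj: "cexp n G (w + \<iota> (proj_n \<iota> I e n h)) = cexp n G (w + \<iota> h)"
proof (rule dependsD[OF cexp_depends])
  fix i assume i: "i \<in> first n"
  then have "i \<in> I" using first_subset by auto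
  then show "e i (w + \<iota> (proj_n \<iota> I e n h)) = e i (w + \<iota> h)"
    using i rep_projH[OF first_subset finite_first, of i n h] by (simp add: e_add e_iota proj_n_eq)
qed

section \<open>Stability and recovery of the inequality\<close>

text \<open>
The Gaussian weights cancel up to \<open>exp (st|h-k|\<^sup>2/2)\<close>, by the identity
\<open>|sh+tk|\<^sup>2 = s|h|\<^sup>2 + t|k|\<^sup>2 - st|h-k|\<^sup>2\<close>.
\<close>
lemma gauss_ineq_iff:
  assumes st: "0 \<le> s" "0 \<le> t" "s + t = 1"
  shows "gauss_ineq \<mu> \<iota> s t a b c h k \<longleftrightarrow> (AE w in \<mu>. ineq_P s t a b c h k w)"
proof -
  define P where "P = s * (norm h)\<^sup>2 + t * (norm k)\<^sup>2"
  define d where "d = s * t * (norm (h - k))\<^sup>2"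
  have id: "(norm (s *\<^sub>R h + t *\<^sub>R k))\<^sup>2 = P - d"
  proof -
    have t: "t = 1 - s" using st by simp
    have A: "(norm (s *\<^sub>R h + t *\<^sub>R k))\<^sup>2 = s\<^sup>2 * (norm h)\<^sup>2 + 2 * t * s * (h \<bullet> k) + t\<^sup>2 * (norm k)\<^sup>2"
      unfolding norm_add_scaleR_sq by (simp add: power_mult_distrib)
    have B: "(norm (h - k))\<^sup>2 = (norm h)\<^sup>2 - 2 * (h \<bullet> k) + (norm k)\<^sup>2"
      using norm_add_scaleR_sq[of h "- 1" k] by simp
    show ?thesis unfolding A B P_def d_def unfolding t by (simp add: power2_eq_square algebra_simps)
  qed
  have e: "exp (- (1/2) * (norm h)\<^sup>2) powr s * exp (- (1/2) * (norm k)\<^sup>2) powr t = exp (- P / 2)"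
    by (simp add: exp_powr_real mult_exp_exp P_def field_simps)
  have "(y * ennreal (exp (- (1/2) * (P - d))) \<ge> ennreal_powr (u * ennreal (exp (- (1/2)
      * (norm h)\<^sup>2))) s
      * ennreal_powr (v * ennreal (exp (- (1/2) * (norm k)\<^sup>2))) t)
      \<longleftrightarrow> (ennreal_powr u s * ennreal_powr v t \<le> y * ennreal (exp (d / 2)))" for u v y
  proof -
    have "ennreal_powr (u * ennreal (exp (- (1/2) * (norm h)\<^sup>2))) s * ennreal_powr (v
        * ennreal (exp (- (1/2) * (norm k)\<^sup>2))) t
        = (ennreal_powr u s * ennreal_powr v t) * ennreal (exp (- P / 2))"
      unfolding e[symmetric] by (simp add: ennreal_powr_mult_pos st ennreal_mult ac_simps)
    moreover have "y * ennreal (exp (- (1/2) * (P - d)))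
        = (y * ennreal (exp (d / 2))) * ennreal (exp (- P / 2))"
    proof -
      have "- (1/2) * (P - d) = d / 2 + - P / 2" by (simp add: field_simps)
      then show ?thesis
        by (simp only: mult.assoc ennreal_mult[OF exp_ge_zero exp_ge_zero, symmetric]
            exp_add[symmetric])
    qed
    moreover have "x * ennreal r \<le> z * ennreal r \<longleftrightarrow> x \<le> z" if "0 < r" for x z r
    proof
      assume "x * ennreal r \<le> z * ennreal r"
      then have "x * ennreal r * ennreal (1/r) \<le> z * ennreal r * ennreal (1/r)"
          by (rule mult_right_mono) simp
      then show "x \<le> z" using that by (simp add: mult.assoc ennreal_mult[symmetric])
    qed (auto intro: mult_right_mono)
    ultimately show ?thesis by simp
  qed
  then show ?thesis unfolding gauss_ineq_def id by (simp add: d_def)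
qed

lemma gauss_ineq_cond_P:
  assumes "0 \<le> s" "0 \<le> t" "s + t = 1"
  shows "(\<forall>h k. gauss_ineq \<mu> \<iota> s t a b c h k) \<longleftrightarrow> cond_P s t a b c"
  by (simp add: gauss_ineq_iff[OF assms] cond_P_def)

lemma gauss_ineq_cong:
  assumes "AE w in \<mu>. a w = a' w" "AE w in \<mu>. b w = b' w" "AE w in \<mu>. c w = c' w"
  shows "gauss_ineq \<mu> \<iota> s t a b c h k \<longleftrightarrow> gauss_ineq \<mu> \<iota> s t a' b' c' h k"
proof -
  have "AE w in \<mu>. a (w + \<iota> (s *\<^sub>R h + t *\<^sub>R k)) = a' (w + \<iota> (s *\<^sub>R h + t *\<^sub>R k)) \<and> b (w + \<iota> h)
      = b' (w + \<iota> h) \<and> c (w + \<iota> k) = c' (w + \<iota> k)"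
    using AE_shift[OF assms(1), of "s *\<^sub>R h + t *\<^sub>R k"] AE_shift[OF assms(2), of h] AE_shift[OF
        assms(3), of k]
    by eventually_elim auto
  then show ?thesis unfolding gauss_ineq_def
    by (intro iffI) (auto elim!: eventually_elim2)
qed

lemma cond_P_cexp:
  assumes st: "0 \<le> s" "0 \<le> t" "s + t = 1"
    and m: "a \<in> borel_measurable borel" "b \<in> borel_measurable borel" "c \<in> borel_measurable borel"
    and cond_P: "cond_P s t a b c"
  shows "cond_P s t (cexp n a) (cexp n b) (cexp n c)"
  unfolding cexp_def
proof (rule cond_P_avg_lin[OF st, where \<alpha>=0 and \<beta>=1 and J="\<lambda>m. first m - first n"])
  show "e i (lin 0 1 (first n) w + lin 1 (- 1) (first n) y)
      = (if i \<in> first m - first n then 0 * e i w + 1 * e i y else e i w)"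
    if "i \<in> first m" for m i w y
    using that first_subset[of m] e_cexp[of i n w y] by auto
qed (use first_subset finite_first rotation_cexp m cond_P in auto)

lemma OU_eq_avg: "OU_semigroup \<mu> \<tau> G = avg (lin (exp (- \<tau>)) 0 {}) (lin (sqrt (1 - exp (- 2
    * \<tau>))) 0 {}) G"
  by (intro ext) (simp add: OU_semigroup_def avg_def lin_def)

lemma OU_squares: "0 \<le> \<tau> \<Longrightarrow> (exp (- \<tau>))\<^sup>2 + (sqrt (1 - exp (- 2 * \<tau>)))\<^sup>2 = 1"
  by (simp add: power2_eq_square exp_add[symmetric])

lemma rotation_OU: "0 \<le> \<tau> \<Longrightarrow> rotation (lin (exp (- \<tau>)) 0 {}) (lin (sqrt (1 - exp (- 2 * \<tau>))) 0 {})"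
  by (rule rotation_lin) (use OU_squares in auto)

lemma cond_P_OU:
  assumes st: "0 \<le> s" "0 \<le> t" "s + t = 1" and \<tau>: "0 < \<tau>"
    and m: "a \<in> borel_measurable borel" "b \<in> borel_measurable borel" "c \<in> borel_measurable borel"
    and cond_P: "cond_P s t a b c"
  shows "cond_P s t (OU_semigroup \<mu> \<tau> a) (OU_semigroup \<mu> \<tau> b) (OU_semigroup \<mu> \<tau> c)"
  unfolding OU_eq_avg
proof (rule cond_P_avg_lin[OF st OU_squares _ rotation_OU, where J=first])
  show "sqrt (1 - exp (- 2 * \<tau>)) \<noteq> 0" using \<tau> by simp
  show "e i (lin (exp (- \<tau>)) 0 {} w + lin (sqrt (1 - exp (- 2 * \<tau>))) 0 {} y)
      = (if i \<in> first n then exp (- \<tau>) * e i w + sqrt (1 - exp (- 2 * \<tau>)) * e i y else e i w)"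
    if "i \<in> first n" for n i w y
    using that first_subset[of n] by (auto simp: lin_def e_add e_scale)
qed (use first_subset finite_first m cond_P \<tau> in auto)

lemma OU_0: "OU_semigroup \<mu> 0 G = G"
  using emeasure_space_1 by (intro ext) (simp add: OU_semigroup_def)

text \<open>
Projecting \<open>h\<close> and \<open>k\<close> does not change the shifted conditional expectations and only decreases
\<open>|h - k|\<close>, so the conditional expectations satisfy the inequality for the unprojected shifts.
On the event \<open>E[a|V\<^sub>n\<^sub>0] \<le> K\<close>, which depends on the first \<open>n0\<close> coordinates, the function \<open>a\<close> is
integrable; there the conditional expectations of \<open>a\<close> and of the truncations of \<open>b\<close> and \<open>c\<close>
converge in \<open>L\<^sup>1\<close>. These events exhaust the space by the finiteness assumption.
\<close>
lemma cond_P_of_cexp: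
  assumes st: "0 \<le> s" "0 \<le> t" "s + t = 1"
    and m: "a \<in> borel_measurable borel" "b \<in> borel_measurable borel" "c \<in> borel_measurable borel"
    and fin: "AE w in \<mu>. \<exists>n\<ge>1. cexp n a w < top"
    and cexp: "\<And>n h k. 1 \<le> n \<Longrightarrow> gauss_ineq \<mu> \<iota> s t (cexp n a) (cexp n b) (cexp n c)
        (proj_n \<iota> I e n h) (proj_n \<iota> I e n k)"
  shows "cond_P s t a b c"
  unfolding cond_P_def
proof (intro allI)
  fix h k :: 'h
  note [measurable] = m
  let ?E = "ennreal (exp (s * t * (norm (h - k))\<^sup>2 / 2))"
  let ?c = "\<lambda>G N w. min (G w) (ennreal (real N))"
  have Tn: "AE w in \<mu>. ineq_P s t (cexp n a) (cexp n b) (cexp n c) h k w" if n: "1 \<le> n" for n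
  proof -
    let ?h = "proj_n \<iota> I e n h" and ?k = "proj_n \<iota> I e n k"
    have pr: "s *\<^sub>R ?h + t *\<^sub>R ?k = proj_n \<iota> I e n (s *\<^sub>R h + t *\<^sub>R k)"
      by (simp add: proj_n_eq projH_add projH_scale)
    have "?h - ?k = projH (first n) (h - k)"
      using projH_add[of "first n" "h - k" k] by (simp add: proj_n_eq)
    then have "norm (?h - ?k) \<le> norm (h - k)" using norm_projH_le[OF first_subset finite_first]
        by simp
    then have le: "ennreal (exp (s * t * (norm (?h - ?k))\<^sup>2 / 2)) \<le> ?E"
      using st by (auto intro!: ennreal_leI divide_right_mono mult_left_mono power_mono)
    have "AE w in \<mu>. ineq_P s t (cexp n a) (cexp n b) (cexp n c) ?h ?k w"
        using cexp[OF n] gauss_ineq_iff[OF st] by blast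
    then show ?thesis
    proof eventually_elim
      case (elim w)
      then show ?case unfolding pr cexp_proj by (rule order_trans) (intro mult_left_mono le, simp)
    qed
  qed
  have tr: "AE w in \<mu>. cexp n0 a (w + \<iota> (s *\<^sub>R h + t *\<^sub>R k)) \<le> ennreal (real K)
      \<longrightarrow> ineq_P s t a (?c b N) (?c c N) h k w"
    if n0: "1 \<le> n0" for n0 K N
  proof -
    define E where "E = {w. cexp n0 a w \<le> ennreal (real K)}"
    note [measurable] = measurable_cexp[OF m(1), of n0]
    have [measurable]: "E \<in> sets borel" unfolding E_def by measurable
    have dE: "depends (first n0) (\<lambda>w. w \<in> E)" using cexp_depends[of n0 a]
        unfolding E_def depends_def mem_Collect_eq by metis
    define aE where "aE w = indicator E w * a w" for w
    have aE [measurable]: "aE \<in> borel_measurable borel" unfolding aE_def by measurable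
    have "(\<integral>\<^sup>+ w. aE w \<partial>\<mu>) = (\<integral>\<^sup>+ w. cexp n0 aE w \<partial>\<mu>)"
      unfolding cexp_def by (rule nn_integral_avg[OF rotation_cexp aE, symmetric])
    also have "\<dots> \<le> (\<integral>\<^sup>+ w. ennreal (real K) \<partial>\<mu>)"
      unfolding aE_def cexp_indicator[OF dE order_refl]
          by (intro nn_integral_mono) (auto simp: E_def indicator_def)
    also have "\<dots> = ennreal (real K)" using emeasure_space_1 by simp
    finally have finE: "(\<integral>\<^sup>+ w. aE w \<partial>\<mu>) < top" by (rule le_less_trans) simp
    have cm: "?c G N \<in> borel_measurable borel" if "G \<in> borel_measurable borel" for G using that
        by measurable
    have lt: "?c G N w < top" for G and w :: 'w by (rule le_less_trans[of _ "ennreal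
        (real N)"]) auto
    \<comment> \<open>The sequences start at \<open>n0\<close>, from where on the indicator of \<open>E\<close> can be pulled out of the
    conditional expectation.\<close>
    have "AE w in \<mu>. w + \<iota> (s *\<^sub>R h + t *\<^sub>R k) \<in> E \<longrightarrow> ineq_P s t aE (?c b N) (?c c N) h k w"
    proof (rule ineq_P_L1_limit[OF st(1,2)])
      show "(\<lambda>n. \<integral>\<^sup>+ w. ediff (cexp (n + n0) aE w) (aE w) \<partial>\<mu>) \<longlonglongrightarrow> 0"
        using cexp_tendsto[OF aE finE] by (rule LIMSEQ_ignore_initial_segment)
      show "(\<lambda>n. \<integral>\<^sup>+ w. ediff (cexp (n + n0) (?c b N) w) (?c b N w) \<partial>\<mu>) \<longlonglongrightarrow> 0"
        using cexp_tendsto[OF cm[OF m(2)] nn_integral_min_less_top]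
            by (rule LIMSEQ_ignore_initial_segment)
      show "(\<lambda>n. \<integral>\<^sup>+ w. ediff (cexp (n + n0) (?c c N) w) (?c c N w) \<partial>\<mu>) \<longlonglongrightarrow> 0"
        using cexp_tendsto[OF cm[OF m(3)] nn_integral_min_less_top]
            by (rule LIMSEQ_ignore_initial_segment)
      fix n
      have "AE w in \<mu>. ineq_P s t (cexp (n + n0) a) (cexp (n + n0) b) (cexp (n
          + n0) c) h k w" using n0 by (intro Tn) simp
      then show "AE w in \<mu>. w + \<iota> (s *\<^sub>R h + t *\<^sub>R k) \<in> E \<longrightarrow>
        ineq_P s t (cexp (n + n0) aE) (cexp (n + n0) (?c b N)) (cexp (n + n0) (?c c N)) h k w"
      proof eventually_elim
        case (elim w)
        show ?case
        proof
          assume wE: "w + \<iota> (s *\<^sub>R h + t *\<^sub>R k) \<in> E"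
          have "ennreal_powr (cexp (n + n0) (?c b N) (w + \<iota> h)) s * ennreal_powr (cexp (n
              + n0) (?c c N) (w + \<iota> k)) t
              \<le> ennreal_powr (cexp (n + n0) b (w + \<iota> h)) s * ennreal_powr (cexp (n + n0) c (w
                  + \<iota> k)) t"
            unfolding cexp_def using st by (intro mult_mono ennreal_powr_mono avg_mono) auto
          also have "\<dots> \<le> cexp (n + n0) a (w + \<iota> (s *\<^sub>R h + t *\<^sub>R k)) * ?E" by (rule elim)
          also have "cexp (n + n0) a (w + \<iota> (s *\<^sub>R h + t *\<^sub>R k))
              = cexp (n + n0) aE (w + \<iota> (s *\<^sub>R h + t *\<^sub>R k))"
            unfolding aE_def using cexp_indicator[OF dE, of "n + n0" a "w + \<iota> (s *\<^sub>R h + t *\<^sub>R k)"] wE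
                by simp
          finally show "ineq_P s t (cexp (n + n0) aE) (cexp (n + n0) (?c b N)) (cexp (n
              + n0) (?c c N)) h k w" .
        qed
      qed
    qed (use lt in \<open>auto intro!: measurable_cexp aE cm m\<close>)
    then show ?thesis by eventually_elim (simp add: E_def aE_def)
  qed
  have "AE w in \<mu>. \<forall>n0 K N. 1 \<le> n0 \<longrightarrow> cexp n0 a (w + \<iota> (s *\<^sub>R h + t *\<^sub>R k)) \<le> ennreal (real K)
      \<longrightarrow> ineq_P s t a (?c b N) (?c c N) h k w"
    unfolding AE_all_countable using tr by (intro allI, case_tac "1 \<le> n0") auto
  with AE_shift[OF fin, of "s *\<^sub>R h + t *\<^sub>R k"]
  show "AE w in \<mu>. ineq_P s t a b c h k w"
  proof eventually_elim
    case (elim w)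
    from elim(1) obtain n0 where n0: "1 \<le> n0" "cexp n0 a (w + \<iota> (s *\<^sub>R h + t *\<^sub>R k)) < top" by auto
    then obtain r where r: "cexp n0 a (w + \<iota> (s *\<^sub>R h + t *\<^sub>R k)) = ennreal r"
      by (cases "cexp n0 a (w + \<iota> (s *\<^sub>R h + t *\<^sub>R k))") auto
    obtain K where "r \<le> real K" using real_arch_simple by blast
    then have "cexp n0 a (w + \<iota> (s *\<^sub>R h + t *\<^sub>R k)) \<le> ennreal (real K)" unfolding r
        by (rule ennreal_leI)
    then have le: "ineq_P s t a (?c b N) (?c c N) h k w" for N using elim(2) n0(1) by blast
    have "ennreal_powr (SUP N. ?c b N (w + \<iota> h)) s * ennreal_powr (SUP N. ?c c N (w + \<iota> k)) t
        \<le> a (w + \<iota> (s *\<^sub>R h + t *\<^sub>R k)) * ?E"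
      by (rule ennreal_powr_SUP_le[OF st(1,2) incseq_min_nat incseq_min_nat le])
    then show ?case by (simp only: ennreal_min_nat_SUP)
  qed
qed

end

theorem theorem9:
  fixes \<mu> :: "'w::separable_frechet_space measure"
    and \<iota> :: "'h::{real_inner,polish_space} \<Rightarrow> 'w"
    and e :: "nat \<Rightarrow> 'w \<Rightarrow> real" and I :: "nat set"
    and a b c :: "'w \<Rightarrow> ennreal" and s t :: real
  assumes "abstract_wiener_space \<mu> \<iota>"
    and "dual_basis \<iota> I e"
    and "a \<in> borel_measurable (completion \<mu>)"
    and "b \<in> borel_measurable (completion \<mu>)"
    and "c \<in> borel_measurable (completion \<mu>)"
    and "s \<in> {0..1}" and "t \<in> {0..1}" and "s + t = 1"
  shows
    "((\<forall>h k. gauss_ineq \<mu> \<iota> s t a b c h k) \<longrightarrow>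
      (\<forall>n\<ge>1. \<forall>h k. gauss_ineq \<mu> \<iota> s t
        (cond_V \<mu> I e n a) (cond_V \<mu> I e n b) (cond_V \<mu> I e n c)
        (proj_n \<iota> I e n h) (proj_n \<iota> I e n k))) \<and>
     ((AE w in \<mu>. \<exists>n\<ge>1. cond_V \<mu> I e n a w < \<infinity>) \<longrightarrow>
      (\<forall>n\<ge>1. \<forall>h k. gauss_ineq \<mu> \<iota> s t
        (cond_V \<mu> I e n a) (cond_V \<mu> I e n b) (cond_V \<mu> I e n c)
        (proj_n \<iota> I e n h) (proj_n \<iota> I e n k)) \<longrightarrow>
      (\<forall>h k. gauss_ineq \<mu> \<iota> s t a b c h k)) \<and>
     ((\<forall>h k. gauss_ineq \<mu> \<iota> s t a b c h k) \<longleftrightarrow>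
      (\<forall>\<tau>\<ge>0. \<forall>h k. gauss_ineq \<mu> \<iota> s t
        (OU_semigroup \<mu> \<tau> a) (OU_semigroup \<mu> \<tau> b) (OU_semigroup \<mu> \<tau> c) h k))"
proof -
  interpret abstract_wiener_space \<mu> \<iota> by fact
  interpret wiener_basis \<mu> \<iota> I e by standard fact
  have st: "0 \<le> s" "0 \<le> t" "s + t = 1" using assms(6-8) by auto
  have version: "\<exists>g'\<in>borel_measurable borel. AE w in \<mu>. g w
      = g' w" if "g \<in> borel_measurable (completion \<mu>)"
    for g :: "'w \<Rightarrow> ennreal"
    using completion_ex_borel_measurable[OF that] by
        (simp add: measurable_cong_sets[OF sets_mu refl])
  obtain a' where a': "a' \<in> borel_measurable borel" "AE w in \<mu>. a w
      = a' w" using version[OF assms(3)] by blast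
  obtain b' where b': "b' \<in> borel_measurable borel" "AE w in \<mu>. b w
      = b' w" using version[OF assms(4)] by blast
  obtain c' where c': "c' \<in> borel_measurable borel" "AE w in \<mu>. c w
      = c' w" using version[OF assms(5)] by blast
  note m = a'(1) b'(1) c'(1)
  have P: "(\<forall>h k. gauss_ineq \<mu> \<iota> s t a b c h k) \<longleftrightarrow> cond_P s t a' b' c'"
    unfolding gauss_ineq_cong[OF a'(2) b'(2) c'(2)] by (rule gauss_ineq_cond_P[OF st])
  have cV: "AE w in \<mu>. cond_V \<mu> I e n a w = cexp n a' w" "AE w in \<mu>. cond_V \<mu> I e n b w
      = cexp n b' w"
    "AE w in \<mu>. cond_V \<mu> I e n c w = cexp n c' w" for n
    by (rule cond_V_eq_cexp[OF assms(3) a'] cond_V_eq_cexp[OF assms(4) b'] cond_V_eq_cexp[OF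
        assms(5) c'])+
  have gV: "gauss_ineq \<mu> \<iota> s t (cond_V \<mu> I e n a) (cond_V \<mu> I e n b) (cond_V \<mu> I e n c) h k
      \<longleftrightarrow> gauss_ineq \<mu> \<iota> s t (cexp n a') (cexp n b') (cexp n c') h k" for n h k
    by (rule gauss_ineq_cong[OF cV])
  have OU: "AE w in \<mu>. OU_semigroup \<mu> \<tau> g w = OU_semigroup \<mu> \<tau> g' w" if "0
      \<le> \<tau>" "AE w in \<mu>. g w = g' w" for \<tau> g g'
    unfolding OU_eq_avg by (rule avg_AE_cong[OF rotation_OU[OF that(1)] that(2)])
  show ?thesis
  proof (intro conjI impI iffI)
    assume "\<forall>h k. gauss_ineq \<mu> \<iota> s t a b c h k"
    then have "cond_P s t a' b' c'" using P by blast
    then have "cond_P s t (cexp n a') (cexp n b') (cexp n c')" for n by (rule cond_P_cexp[OF st m])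
    then have "gauss_ineq \<mu> \<iota> s t (cexp n a') (cexp n b') (cexp n c') h k" for n h k
      using gauss_ineq_cond_P[OF st] by blast
    then show "\<forall>n\<ge>1. \<forall>h k. gauss_ineq \<mu> \<iota> s t (cond_V \<mu> I e n a) (cond_V \<mu> I e n b)
        (cond_V \<mu> I e n c)
        (proj_n \<iota> I e n h) (proj_n \<iota> I e n k)" by (simp add: gV)
  next
    assume fin: "AE w in \<mu>. \<exists>n\<ge>1. cond_V \<mu> I e n a w < \<infinity>"
      and *: "\<forall>n\<ge>1. \<forall>h k. gauss_ineq \<mu> \<iota> s t (cond_V \<mu> I e n a) (cond_V \<mu> I e n b)
          (cond_V \<mu> I e n c)
        (proj_n \<iota> I e n h) (proj_n \<iota> I e n k)"
    have "AE w in \<mu>. \<forall>n. cond_V \<mu> I e n a w = cexp n a' w" unfolding AE_all_countable using cV(1)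
        by blast
    with fin have "AE w in \<mu>. \<exists>n\<ge>1. cexp n a' w < top" by eventually_elim auto
    then have "cond_P s t a' b' c'" using * by (intro cond_P_of_cexp[OF st m]) (auto simp: gV)
    then show "\<forall>h k. gauss_ineq \<mu> \<iota> s t a b c h k" using P by blast
  next
    assume "\<forall>h k. gauss_ineq \<mu> \<iota> s t a b c h k"
    then have cond_P: "cond_P s t a' b' c'" using P by blast
    have "gauss_ineq \<mu> \<iota> s t (OU_semigroup \<mu> \<tau> a) (OU_semigroup \<mu> \<tau> b) (OU_semigroup \<mu> \<tau> c) h k"
        if \<tau>: "0 \<le> \<tau>" for \<tau> h k
    proof -
      have "cond_P s t (OU_semigroup \<mu> \<tau> a') (OU_semigroup \<mu> \<tau> b') (OU_semigroup \<mu> \<tau> c')"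
        using cond_P_OU[OF st _ m cond_P] cond_P \<tau> by (cases "\<tau> = 0") (auto simp: OU_0)
      then have "gauss_ineq \<mu> \<iota> s t (OU_semigroup \<mu> \<tau> a') (OU_semigroup \<mu> \<tau> b')
          (OU_semigroup \<mu> \<tau> c') h k"
        using gauss_ineq_cond_P[OF st] by blast
      then show ?thesis using gauss_ineq_cong[OF OU[OF \<tau> a'(2)] OU[OF \<tau> b'(2)] OU[OF \<tau> c'(2)]]
          by blast
    qed
    then show "\<forall>\<tau>\<ge>0. \<forall>h k. gauss_ineq \<mu> \<iota> s t (OU_semigroup \<mu> \<tau> a) (OU_semigroup \<mu> \<tau> b)
        (OU_semigroup \<mu> \<tau> c) h k" by blast
  next
    assume "\<forall>\<tau>\<ge>0. \<forall>h k. gauss_ineq \<mu> \<iota> s t (OU_semigroup \<mu> \<tau> a) (OU_semigroup \<mu> \<tau> b)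
        (OU_semigroup \<mu> \<tau> c) h k"
    then have "\<forall>h k. gauss_ineq \<mu> \<iota> s t (OU_semigroup \<mu> 0 a) (OU_semigroup \<mu> 0 b)
        (OU_semigroup \<mu> 0 c) h k" by simp
    then show "\<forall>h k. gauss_ineq \<mu> \<iota> s t a b c h k" by (simp add: OU_0)
  qed
qed

end
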